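(* Let $m\geq 3$ and for $i=1,\ldots,m$ let $\psi_i$ be a primitive Dirichlet character modulo $\ell_i$; put $\ell^*=\max(\ell_1,\ldots,\ell_m)$. Then for every $\varepsilon>0$ there exist constants $C_{m,\varepsilon}>0$ and $c_{m,\varepsilon}>0$ such that for all (sufficiently large) primes $q\geq C_{m,\varepsilon}(\ell^* )^{m/(2m-4)+\varepsilon}$ and every Dirichlet character $\chi$ modulo $q$, $$\#\{(\chi_i)_i\in\mathbf{Wide}^*(q,m;\chi):\ L(\psi_1\chi_1,1/2)\cdots L(\psi_m\chi_m,1/2)\neq 0\}\geq c_{m,\varepsilon}\, q^{5m/6-1-\varepsilon}(\ell^* )^{-m/6}.$$
   Context: For a Dirichlet character $\chi$, $L(\chi,s)=\sum_{n\geq1}\chi(n)n^{-s}$ (for $\mathrm{Re}\, s>1$), extended by meromorphic continuation. For an integer $q$ and a Dirichlet character $\chi$ mod $q$, $\mathbf{Wide}^*(q,m;\chi)$ denotes the set of $m$-tuples $(\chi_1,\ldots,\chi_m)$ of primitive Dirichlet characters modulo $q$ with $\chi_1\cdots\chi_m=\chi$. *)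

theory Defs
  imports "HOL-Complex_Analysis.Complex_Analysis" "HOL-Number_Theory.Cong"
begin

definition dirichlet_char :: "nat \<Rightarrow> (nat \<Rightarrow> complex) \<Rightarrow> bool" where
  "dirichlet_char q chi \<longleftrightarrow> q > 0 \<and>
     (\<forall>n. chi (n + q) = chi n) \<and>
     (\<forall>a b. chi (a * b) = chi a * chi b) \<and>
     chi 1 = 1 \<and>
     (\<forall>n. chi n \<noteq> 0 \<longleftrightarrow> coprime n q)"

definition primitive_char :: "nat \<Rightarrow> (nat \<Rightarrow> complex) \<Rightarrow> bool" where
  "primitive_char q chi \<longleftrightarrow> dirichlet_char q chi \<and>
     (\<forall>d. d dvd q \<and> d < q \<longrightarrow>
        \<not> (\<forall>a. coprime a q \<and> [a = 1] (mod d) \<longrightarrow> chi a = 1))"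

definition dirichlet_series :: "(nat \<Rightarrow> complex) \<Rightarrow> complex \<Rightarrow> complex" where
  "dirichlet_series chi s = (\<Sum>n. chi (Suc n) / (of_nat (Suc n)) powr s)"

text \<open>L(chi,s): the (unique) continuation of the Dirichlet series, holomorphic on
  C minus {1}; the value at the possible pole s = 1 is fixed to 0 by convention
  to make the function unique.\<close>
definition dirichlet_L :: "(nat \<Rightarrow> complex) \<Rightarrow> complex \<Rightarrow> complex" where
  "dirichlet_L chi = (THE f. f holomorphic_on (- {1}) \<and> f 1 = 0 \<and>
       (\<forall>s. 1 < Re s \<longrightarrow> f s = dirichlet_series chi s))"

definition Wide_star :: "nat \<Rightarrow> nat \<Rightarrow> (nat \<Rightarrow> complex) \<Rightarrow> (nat \<Rightarrow> nat \<Rightarrow> complex) set" where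
  "Wide_star q m chi = {c. (\<forall>i<m. primitive_char q (c i)) \<and> (\<forall>i\<ge>m. c i = (\<lambda>_. 0)) \<and>
       (\<forall>n. (\<Prod>i<m. c i n) = chi n)}"

end

theory Submission
  imports Defs "HOL-Number_Theory.Number_Theory"
begin

text \<open>By orthogonality of the characters modulo \<open>q\<close>, the sum of
  \<open>L(\<psi>\<^sub>1\<chi>\<^sub>1,1/2) \<cdots> L(\<psi>\<^sub>m\<chi>\<^sub>m,1/2)\<close> over all tuples with product \<open>\<chi>\<close> is
  \<open>\<phi>(q)\<^bsup>m-1\<^esup> \<Sum>\<^sub>b \<chi>(b) \<Prod>\<^sub>i F\<^sub>i(b)\<close>, where \<open>F\<^sub>i(b)\<close> is the sum of \<open>\<psi>\<^sub>i(n) n\<^bsup>-1/2\<^esup>\<close> over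
  \<open>n \<equiv> b (mod q)\<close>. The terms \<open>n = b < q\<close> contribute a main term close to
  \<open>L(\<chi>\<psi>\<^sub>1\<cdots>\<psi>\<^sub>m, m/2)\<close>, which is bounded away from \<open>0\<close> because \<open>m \<ge> 3\<close>; by the
  Polya-Vinogradov inequality the remaining \<open>n\<close> contribute
  \<open>O(q\<^bsup>-1/2\<^esup> \<ell>\<^bsup>1/4\<^esup>)\<close> to each \<open>F\<^sub>i(b)\<close> up to logarithms, which is negligible exactly in the stated
  range of \<open>q\<close>. Cauchy's inequality then bounds the number of nonvanishing tuples from below in
  terms of the second moment of the product, and one factor is estimated by the
  convexity bound \<open>(q\<ell>)\<^bsup>1/4\<^esup>\<close>, the others in mean square by \<open>max(1, (\<ell>/q)\<^bsup>1/2\<^esup>)\<close>. For \<open>m \<ge> 3\<close> this is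
  no worse than the Weyl bound \<open>(q\<ell>)\<^bsup>1/6\<^esup>\<close> applied to every factor.\<close>

section \<open>Characters and Gauss sums\<close>

text \<open>Writing \<open>L\<close> for the largest conductor, the error per residue class is
  \<open>d\<close> of size \<open>q^(-1/2) L^(1/4)\<close>, and the accumulated error
  \<open>q d^m\<close> drops below 1, up to logarithms, once \<open>q\<close> exceeds
  \<open>L^(m/(2m-4))\<close>; this is the origin of the threshold. The count is the squared first
  moment \<open>q^(2(m-1))\<close> over the second moment \<open>q^(m-1) (L q)^(m/6)\<close>. Only
  one factor needs a pointwise bound, because the product condition determines one character from
  the other \<open>m-1\<close>, which can then be averaged independently. The obstacle that shapes
  the proof is that nothing is assumed about common factors of the conductors and \<open>q\<close>.
  If \<open>l\<close> divides \<open>q\<close>, the class sums diverge and are regularised. If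
  \<open>q\<close> divides \<open>l\<close>, a twist need not be primitive, and a mean value
  replaces the convexity bound. The fraction \<open>q/l\<close> has to be reduced before
  progressions of difference \<open>q\<close> can be analysed. Twists that are principal, or built
  from the principal character modulo \<open>q\<close>, are removed from the character transform
  before the moments are taken.\<close>

lemma periodic_mod:
  fixes f :: "nat \<Rightarrow> 'a"
  assumes "\<And>k. f (k + n) = f k"
  shows "f (k mod n) = f k"
proof -
  have "f (r + n * j) = f r" for r j
    by (induction j) (use assms in \<open>auto simp: algebra_simps\<close>, metis assms add.commute)
  from this[of "k mod n" "k div n"] show ?thesis by simp
qed

lemma sum_mult_coprime:
  fixes g :: "nat \<Rightarrow> 'a::comm_monoid_add"
  assumes "coprime a n" "n > 0" and per: "\<And>k. g (k mod n) = g k"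
  shows "(\<Sum>k<n. g (a * k)) = (\<Sum>k<n. g k)"
proof -
  have inj: "inj_on (\<lambda>k. a * k mod n) {..<n}"
  proof (rule inj_onI)
    fix x y assume xy: "x \<in> {..<n}" "y \<in> {..<n}" "a * x mod n = a * y mod n"
    then have "[a * x = a * y] (mod n)" by (simp add: cong_def)
    then have "[x = y] (mod n)" using assms(1) by (simp add: cong_mult_lcancel_nat)
    with xy show "x = y" by (simp add: cong_def)
  qed
  have sub: "(\<lambda>k. a * k mod n) ` {..<n} \<subseteq> {..<n}" using assms(2) by auto
  have "bij_betw (\<lambda>k. a * k mod n) {..<n} {..<n}"
    using inj sub by (simp add: bij_betw_def endo_inj_surj)
  then have "(\<Sum>k<n. g (a * k mod n)) = (\<Sum>k<n. g k)"
    by (rule sum.reindex_bij_betw)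
  then show ?thesis by (simp add: per)
qed

section \<open>Additive characters modulo n\<close>

definition echar :: "nat \<Rightarrow> nat \<Rightarrow> complex" where
  "echar n k = cis (2 * pi * real k / real n)"

lemma echar_add: "echar n (a + b) = echar n a * echar n b"
  by (simp add: echar_def cis_mult add_divide_distrib ring_distribs)

lemma echar_0 [simp]: "echar n 0 = 1"
  by (simp add: echar_def)

lemma norm_echar [simp]: "cmod (echar n k) = 1"
  by (simp add: echar_def)

lemma echar_mult: "echar n (a * b) = echar n a ^ b"
  by (induction b) (auto simp: echar_add)

lemma echar_self: "echar n n = 1"
  by (cases "n = 0") (auto simp: echar_def)

lemma echar_mult_self: "echar n (n * a) = 1"
  by (simp add: echar_mult echar_self)

lemma echar_cancel: "g > 0 \<Longrightarrow> echar (g * n) (g * k) = echar n k"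
  by (simp add: echar_def mult_ac)

lemma echar_mod [simp]: "echar n (k mod n) = echar n k"
  by (rule periodic_mod) (simp add: echar_add echar_self)

lemma echar_cong: "[a = b] (mod n) \<Longrightarrow> echar n a = echar n b"
  by (metis cong_def echar_mod)

lemma echar_eq_1_iff: assumes "n > 0" shows "echar n k = 1 \<longleftrightarrow> n dvd k"
proof
  assume "echar n k = 1"
  then have "echar n (k mod n) = 1" by simp
  have "inj_on (\<lambda>k. cis (2 * pi * real k / real n)) {..<n}"
    using Complex.bij_betw_roots_unity[OF assms] by (simp add: bij_betw_def)
  with \<open>echar n (k mod n) = 1\<close> assms have "k mod n = 0"
    by (auto simp: inj_on_def echar_def)
  then show "n dvd k" by auto
qed (auto simp: echar_mult_self)

lemma cnj_echar_mult [simp]: "cnj (echar n k) * echar n k = 1" "echar n k * cnj (echar n k) = 1"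
  using complex_norm_square[of "echar n k"] by (simp_all add: mult.commute)

lemma sum_echar_orthogonal:
  assumes "n > 0"
  shows "(\<Sum>h<n. echar n (h * a) * cnj (echar n (h * b))) = (if [a = b] (mod n) then of_nat n else 0)"
proof -
  define z where "z = echar n a * cnj (echar n b)"
  have *: "echar n (h * a) * cnj (echar n (h * b)) = z ^ h" for h
    by (simp add: z_def power_mult_distrib mult.commute[of h] echar_mult)
  have "z = 1 \<longleftrightarrow> echar n a = echar n b"
  proof
    assume "z = 1"
    then have "z * echar n b = echar n b" by simp
    then show "echar n a = echar n b" by (simp add: z_def mult.assoc)
  qed (simp add: z_def)
  also have "\<dots> \<longleftrightarrow> [a = b] (mod n)"
  proof
    assume "echar n a = echar n b"
    then have "echar n (a mod n) = echar n (b mod n)" by simp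
    moreover have "inj_on (\<lambda>k. cis (2 * pi * real k / real n)) {..<n}"
      using Complex.bij_betw_roots_unity[OF assms] by (simp add: bij_betw_def)
    ultimately show "[a = b] (mod n)" using assms
      by (auto simp: inj_on_def echar_def cong_def)
  qed (rule echar_cong)
  finally have z1: "z = 1 \<longleftrightarrow> [a = b] (mod n)" .
  have zn: "z ^ n = 1" unfolding *[symmetric] by (simp add: echar_mult_self)
  show ?thesis
  proof (cases "z = 1")
    case True
    then show ?thesis using z1 by (simp add: *)
  next
    case False
    then have "(\<Sum>h<n. z ^ h) = 0" using zn by (simp add: geometric_sum)
    then show ?thesis using False z1 by (simp add: *)
  qed
qed

text \<open>Opening the square and summing over \<open>h\<close> leaves only the diagonal, since the
  frequencies \<open>x k\<close> are distinct modulo \<open>n\<close>.\<close>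

lemma parseval_echar:
  assumes "n > 0" "finite A" and inj: "inj_on (\<lambda>k. x k mod n) A"
  shows "(\<Sum>h<n. (cmod (\<Sum>k\<in>A. c k * echar n (h * x k)))\<^sup>2) = real n * (\<Sum>k\<in>A. (cmod (c k))\<^sup>2)"
proof -
  have "complex_of_real (\<Sum>h<n. (cmod (\<Sum>k\<in>A. c k * echar n (h * x k)))\<^sup>2)
      = (\<Sum>h<n. (\<Sum>k\<in>A. c k * echar n (h * x k)) * cnj (\<Sum>k\<in>A. c k * echar n (h * x k)))"
    unfolding of_real_sum by (intro sum.cong refl) (metis complex_norm_square)
  also have "\<dots> = (\<Sum>h<n. \<Sum>k\<in>A. \<Sum>j\<in>A. (c k * cnj (c j)) * (echar n (h * x k) * cnj (echar n (h * x j))))"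
    by (simp add: sum_product mult_ac)
  also have "\<dots> = (\<Sum>k\<in>A. \<Sum>j\<in>A. (c k * cnj (c j)) * (\<Sum>h<n. echar n (h * x k) * cnj (echar n (h * x j))))"
    unfolding sum_distrib_left
    by (subst sum.swap, rule sum.cong[OF refl], subst sum.swap) simp
  also have "\<dots> = (\<Sum>k\<in>A. \<Sum>j\<in>A. (if j = k then (c k * cnj (c j)) * of_nat n else 0))"
  proof (intro sum.cong refl)
    fix k j assume "k \<in> A" "j \<in> A"
    then have "[x k = x j] (mod n) \<longleftrightarrow> j = k" using inj by (auto simp: cong_def inj_on_def)
    then show "c k * cnj (c j) * (\<Sum>h<n. echar n (h * x k) * cnj (echar n (h * x j))) =
          (if j = k then c k * cnj (c j) * of_nat n else 0)"
      by (simp add: sum_echar_orthogonal assms(1))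
  qed
  also have "\<dots> = (\<Sum>k\<in>A. (c k * cnj (c k)) * of_nat n)"
    using assms(2) by simp
  also have "\<dots> = complex_of_real (real n * (\<Sum>k\<in>A. (cmod (c k))\<^sup>2))"
    by (simp add: sum_distrib_left complex_norm_square[symmetric] mult_ac del: of_real_power)
  finally show ?thesis by (simp only: of_real_eq_iff)
qed

section \<open>Elementary properties of Dirichlet characters\<close>

lemma dirichlet_char_mod: "dirichlet_char n f \<Longrightarrow> f (k mod n) = f k"
  by (rule periodic_mod) (simp add: dirichlet_char_def)

lemma dirichlet_char_cong: "dirichlet_char n f \<Longrightarrow> [a = b] (mod n) \<Longrightarrow> f a = f b"
  by (metis cong_def dirichlet_char_mod)

lemma dirichlet_char_mult: "dirichlet_char n f \<Longrightarrow> f (a * b) = f a * f b"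
  by (simp add: dirichlet_char_def)

lemma dirichlet_char_1: "dirichlet_char n f \<Longrightarrow> f 1 = 1"
  unfolding dirichlet_char_def by blast

lemma dirichlet_char_eq_0: "dirichlet_char n f \<Longrightarrow> \<not> coprime k n \<Longrightarrow> f k = 0"
  by (auto simp: dirichlet_char_def)

lemma dirichlet_char_power: "dirichlet_char n f \<Longrightarrow> f (a ^ k) = f a ^ k"
  by (induction k) (simp_all add: dirichlet_char_mult dirichlet_char_1[unfolded One_nat_def])

lemma dirichlet_char_pos: "dirichlet_char n f \<Longrightarrow> n > 0"
  by (simp add: dirichlet_char_def)

lemma dirichlet_char_root_unity:
  assumes "dirichlet_char n f" "coprime k n"
  shows "f k ^ totient n = 1"
proof -
  have "f (k ^ totient n) = f 1"
    using assms euler_theorem[of k n] dirichlet_char_cong by blast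
  then show ?thesis
    by (simp only: dirichlet_char_power[OF assms(1)] dirichlet_char_1[OF assms(1)])
qed

lemma norm_dirichlet_char:
  assumes "dirichlet_char n f" "coprime k n"
  shows "cmod (f k) = 1"
proof -
  have "cmod (f k) ^ totient n = 1"
    by (metis assms dirichlet_char_root_unity norm_one norm_power)
  moreover have "totient n > 0" using assms dirichlet_char_pos by auto
  ultimately show ?thesis using power_eq_1_iff[of "cmod (f k)" "totient n"] by simp
qed

lemma norm_dirichlet_char_le: "dirichlet_char n f \<Longrightarrow> cmod (f k) \<le> 1"
  by (cases "coprime k n") (auto simp: norm_dirichlet_char dirichlet_char_eq_0)

lemma dirichlet_char_prod:
  assumes "dirichlet_char n f" "dirichlet_char l g"
  shows "dirichlet_char (n * l) (\<lambda>k. f k * g k)"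
  unfolding dirichlet_char_def
proof (intro conjI allI)
  fix k
  have "f (k + n * l) = f k" by (rule dirichlet_char_cong[OF assms(1)]) (simp add: cong_def)
  moreover have "g (k + n * l) = g k" by (rule dirichlet_char_cong[OF assms(2)]) (simp add: cong_def)
  ultimately show "f (k + n * l) * g (k + n * l) = f k * g k" by simp
  show "f k * g k \<noteq> 0 \<longleftrightarrow> coprime k (n * l)" using assms by (auto simp: dirichlet_char_def)
next
  show "n * l > 0" using assms by (auto simp: dirichlet_char_def)
next
  fix a b
  show "f (a * b) * g (a * b) = f a * g a * (f b * g b)"
    using assms by (simp add: dirichlet_char_mult)
next
  show "f 1 * g 1 = 1"
    using dirichlet_char_1[OF assms(1)] dirichlet_char_1[OF assms(2)] by simp
qed

lemma sum_dirichlet_char_eq_0: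
  assumes "dirichlet_char n f" "coprime a n" "f a \<noteq> 1"
  shows "(\<Sum>k<n. f k) = 0"
proof -
  have "(\<Sum>k<n. f (a * k)) = (\<Sum>k<n. f k)"
    using assms by (intro sum_mult_coprime) (auto simp: dirichlet_char_mod dirichlet_char_pos)
  then have "(f a - 1) * (\<Sum>k<n. f k) = 0"
    using assms(1) by (simp add: dirichlet_char_mult sum_distrib_left[symmetric] left_diff_distrib)
  then show ?thesis using assms(3) by simp
qed

section \<open>Gauss sums of primitive characters\<close>

definition gauss_sum :: "nat \<Rightarrow> (nat \<Rightarrow> complex) \<Rightarrow> nat \<Rightarrow> complex" where
  "gauss_sum n f h = (\<Sum>k<n. f k * echar n (h * k))"

lemma gauss_sum_mult:
  assumes "dirichlet_char n f" "coprime a n"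
  shows "f a * gauss_sum n f (a * h) = gauss_sum n f h"
proof -
  have "(\<Sum>k<n. f (a * k) * echar n (h * (a * k))) = (\<Sum>k<n. f k * echar n (h * k))"
    using assms
    by (intro sum_mult_coprime[where g = "\<lambda>k. f k * echar n (h * k)"])
       (auto simp: dirichlet_char_mod dirichlet_char_pos intro!: echar_cong, simp add: cong_def mod_mult_right_eq)
  then show ?thesis using assms(1)
    by (simp add: gauss_sum_def dirichlet_char_mult sum_distrib_left mult_ac)
qed

text \<open>Primitivity supplies a unit \<open>a\<close> congruent to 1 modulo
  \<open>n div gcd h n\<close> with \<open>f a \<noteq> 1\<close>. Then \<open>a * h\<close> and
  \<open>h\<close> agree modulo \<open>n\<close>, so passing from \<open>h\<close> to
  \<open>a * h\<close> both fixes the Gauss sum and rescales it.\<close>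

lemma gauss_sum_not_coprime:
  assumes prim: "primitive_char n f" and "\<not> coprime h n"
  shows "gauss_sum n f h = 0"
proof -
  have f: "dirichlet_char n f" using prim by (simp add: primitive_char_def)
  define g where "g = gcd h n"
  define d where "d = n div g"
  have n: "n > 0" using f by (rule dirichlet_char_pos)
  have "g \<noteq> 1" using assms(2) unfolding g_def by (simp only: coprime_iff_gcd_eq_1) simp
  moreover have "g > 0" using n by (simp add: g_def)
  ultimately have g1: "g > 1" by simp
  have nd: "n = g * d" by (simp add: d_def g_def)
  have "d dvd n" "d < n" using nd g1 n by simp_all
  then obtain a where a: "coprime a n" "[a = 1] (mod d)" "f a \<noteq> 1"
    using prim by (auto simp: primitive_char_def)
  have "[a * h = 1 * h] (mod n)"
  proof -
    obtain h' where h': "h = g * h'" by (metis dvdE g_def gcd_dvd1)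
    have "[g * a = g * 1] (mod (g * d))" using a(2)
      by (simp add: cong_def mult_mod_right[symmetric])
    then have "[g * a * h' = g * 1 * h'] (mod (g * d))" by (rule cong_scalar_right)
    then show ?thesis by (simp add: h' nd mult_ac)
  qed
  then have "gauss_sum n f (a * h) = gauss_sum n f h"
    unfolding gauss_sum_def
    by (intro sum.cong refl arg_cong2[of _ _ _ _ "(*)"] echar_cong cong_scalar_right) simp
  with gauss_sum_mult[OF f a(1), of h] have "(f a - 1) * gauss_sum n f h = 0"
    by (simp add: algebra_simps)
  with a(3) show ?thesis by simp
qed

text \<open>The modulus is the same at every \<open>h\<close> coprime to \<open>n\<close> and
  vanishes elsewhere, so the Parseval total \<open>n * c\<close> is shared equally by the
  \<open>c\<close> units.\<close>

lemma norm_gauss_sum: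
  assumes prim: "primitive_char n f" and "coprime h n"
  shows "(cmod (gauss_sum n f h))\<^sup>2 = real n"
proof -
  have f: "dirichlet_char n f" using prim by (simp add: primitive_char_def)
  have n: "n > 0" using f by (rule dirichlet_char_pos)
  have eq: "cmod (gauss_sum n f k) = (if coprime k n then cmod (gauss_sum n f 1) else 0)" for k
  proof (cases "coprime k n")
    case True
    have "cmod (f k * gauss_sum n f (k * 1)) = cmod (gauss_sum n f 1)"
      using gauss_sum_mult[OF f True, of 1] by simp
    then show ?thesis using True norm_dirichlet_char[OF f True] by (simp add: norm_mult)
  qed (simp add: gauss_sum_not_coprime[OF prim])
  define c where "c = card {k\<in>{..<n}. coprime k n}"
  have "(\<Sum>h<n. (cmod (gauss_sum n f h))\<^sup>2) = real n * (\<Sum>k<n. (cmod (f k))\<^sup>2)"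
    unfolding gauss_sum_def using n by (intro parseval_echar) (auto simp: inj_on_def)
  also have "(\<Sum>k<n. (cmod (f k))\<^sup>2) = (\<Sum>k<n. if coprime k n then 1 else 0)"
    by (intro sum.cong refl) (auto simp: norm_dirichlet_char[OF f] dirichlet_char_eq_0[OF f])
  also have "\<dots> = real c" by (simp add: c_def sum.If_cases Int_def)
  finally have 1: "(\<Sum>h<n. (cmod (gauss_sum n f h))\<^sup>2) = real n * real c" .
  have "(\<Sum>h<n. (cmod (gauss_sum n f h))\<^sup>2) =
        (\<Sum>h<n. if coprime h n then (cmod (gauss_sum n f 1))\<^sup>2 else 0)"
  proof (intro sum.cong refl)
    show "(cmod (gauss_sum n f h))\<^sup>2 = (if coprime h n then (cmod (gauss_sum n f 1))\<^sup>2 else 0)" for h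
      using eq[of h] by (simp split: if_splits)
  qed
  also have "\<dots> = real c * (cmod (gauss_sum n f 1))\<^sup>2"
    by (simp add: c_def sum.If_cases Int_def)
  finally have 2: "real c * (cmod (gauss_sum n f 1))\<^sup>2 = real n * real c" using 1 by linarith
  \<comment> \<open>The residue \<open>1 mod n\<close> instead of 1 covers \<open>n = 1\<close>,
    where the only residue is 0.\<close>
  have "coprime (1 mod n) n" by (subst coprime_mod_left_iff) (use n in auto)
  then have "1 mod n \<in> {k\<in>{..<n}. coprime k n}" using n by simp
  moreover have "finite {k\<in>{..<n}. coprime k n}" by (rule finite_subset[of _ "{..<n}"]) auto
  ultimately have "c > 0" unfolding c_def card_gt_0_iff by (metis empty_iff)
  with 2 have "(cmod (gauss_sum n f 1))\<^sup>2 = real n" by simp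
  then show ?thesis using eq[of h] assms(2) by (simp only: if_True)
qed

section \<open>Character sums along arithmetic progressions\<close>

text \<open>Weaker than Jordan's inequality but elementary: up to \<open>pi / 3\<close> the
  derivative \<open>cos t - 1 / 2\<close> is nonnegative, and beyond it the sine is at least
  \<open>sqrt 3 / 2\<close>, which exceeds \<open>pi / 4\<close>.\<close>

lemma half_le_sin:
  assumes "0 \<le> x" "x \<le> pi / 2"
  shows "x / 2 \<le> sin x"
proof (cases "x \<le> pi / 3")
  case True
  have "sin 0 - 0 / 2 \<le> sin x - x / 2"
  proof (rule DERIV_nonneg_imp_nondecreasing[OF assms(1)])
    fix t assume t: "0 \<le> t" "t \<le> x"
    have "cos (pi / 3) \<le> cos t" using t True pi_gt_zero by (intro cos_monotone_0_pi_le) auto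
    moreover have "((\<lambda>x. sin x - x / 2) has_real_derivative (cos t - 1 / 2)) (at t)"
      by (auto intro!: derivative_eq_intros)
    ultimately show "\<exists>y. ((\<lambda>x. sin x - x / 2) has_real_derivative y) (at t) \<and> 0 \<le> y"
      by (intro exI[of _ "cos t - 1 / 2"]) (simp add: cos_60)
  qed
  then show ?thesis by simp
next
  case False
  have "sin (pi / 3) \<le> sin x" using assms False pi_gt_zero by (intro sin_monotone_2pi_le) auto
  moreover have "17 / 10 \<le> sqrt (3::real)" by (rule real_le_rsqrt) (simp add: power2_eq_square)
  ultimately show ?thesis using assms pi_approx by (simp add: sin_60)
qed

text \<open>The distance from \<open>j / n\<close> to the nearest integer is
  \<open>min j (n - j) / n\<close>. Bounding the reciprocal of the minimum by the sum of both
  reciprocals turns the later sum over \<open>j\<close> into two harmonic sums.\<close>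

lemma inverse_norm_1_minus_echar_le:
  assumes "0 < j" "j < n"
  shows "2 / cmod (1 - echar n j) \<le> real n * (1 / real j + 1 / real (n - j))"
proof -
  define x where "x = pi * real j / real n"
  define m where "m = min j (n - j)"
  have m0: "m > 0" using assms by (simp add: m_def)
  have "echar n j = exp (\<i> * of_real (2 * x))" by (simp add: echar_def x_def cis_conv_exp mult_ac)
  then have "cmod (1 - echar n j) = 2 * \<bar>sin x\<bar>"
    using dist_exp_i_1[of "2 * x"] by (simp add: norm_minus_commute)
  moreover have "pi * (real m / real n) / 2 \<le> sin x"
  proof (cases "2 * j \<le> n")
    case True
    then have "real j / real n \<le> 1 / 2" using assms by (simp add: field_simps)
    then have "pi * (real j / real n) \<le> pi * (1 / 2)" by (intro mult_left_mono) auto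
    then have "x / 2 \<le> sin x" unfolding x_def by (intro half_le_sin) auto
    moreover have "m = j" using True by (simp add: m_def)
    ultimately show ?thesis by (simp add: x_def)
  next
    case False
    then have m: "m = n - j" by (simp add: m_def)
    have eq: "pi - x = pi * (real m / real n)"
      using assms by (simp add: x_def m of_nat_diff diff_divide_distrib right_diff_distrib)
    have "real m / real n \<le> 1 / 2" using assms False by (simp add: m field_simps of_nat_diff)
    then have "pi * (real m / real n) \<le> pi * (1 / 2)" by (intro mult_left_mono) auto
    then have "(pi - x) / 2 \<le> sin (pi - x)" unfolding eq by (intro half_le_sin) auto
    then show ?thesis by (simp only: eq[symmetric] sin_pi_minus)
  qed
  ultimately have "cmod (1 - echar n j) \<ge> pi * (real m / real n)"
  proof -
    have "t \<le> c" if "c = 2 * \<bar>s\<bar>" "t / 2 \<le> s" for t c s :: real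
      using that by linarith
    then show ?thesis using \<open>cmod _ = _\<close> \<open>_ \<le> sin x\<close> by blast
  qed
  moreover have "pi * (real m / real n) \<ge> 2 * (real m / real n)"
    using pi_ge_two by (intro mult_right_mono) auto
  ultimately have "cmod (1 - echar n j) \<ge> 2 * real m / real n" by simp
  moreover have "0 < 2 * real m / real n" using m0 assms by simp
  ultimately have "2 / cmod (1 - echar n j) \<le> 2 / (2 * real m / real n)"
    by (intro frac_le) simp_all
  also have "\<dots> = real n * (1 / real m)" by simp
  also have "\<dots> \<le> real n * (1 / real j + 1 / real (n - j))"
    using assms by (intro mult_left_mono) (auto simp: m_def min_def)
  finally show ?thesis .
qed

lemma sum_inverse_le_ln:
  assumes "n > 0"
  shows "(\<Sum>k=1..n. 1 / real k) \<le> 1 + ln (real n)"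
  using assms
proof (induction n rule: nat_induct_non_zero)
  case (Suc n)
  have "ln (real n / (real n + 1)) \<le> real n / (real n + 1) - 1"
    using Suc.hyps by (intro ln_le_minus_one) auto
  also have "ln (real n / (real n + 1)) = ln (real n) - ln (real n + 1)"
    using Suc.hyps by (subst ln_div) auto
  also have "real n / (real n + 1) - 1 = - (1 / (real n + 1))" by (simp add: field_simps)
  finally show ?case using Suc.IH by (simp add: add.commute)
qed auto

lemma sum_norm_1_minus_echar_le:
  assumes "n > 1"
  shows "(\<Sum>j=1..n-1. 2 / cmod (1 - echar n j)) \<le> 2 * real n * (1 + ln (real n))"
proof -
  have "(\<Sum>j=1..n-1. 2 / cmod (1 - echar n j)) \<le> (\<Sum>j=1..n-1. real n * (1 / real j + 1 / real (n - j)))"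
    by (intro sum_mono inverse_norm_1_minus_echar_le) auto
  also have "\<dots> = real n * ((\<Sum>j=1..n-1. 1 / real j) + (\<Sum>j=1..n-1. 1 / real (n - j)))"
    by (simp only: sum_distrib_left sum.distrib distrib_left)
  also have "(\<Sum>j=1..n-1. 1 / real (n - j)) = (\<Sum>j=1..n-1. 1 / real j)"
    using assms by (intro sum.reindex_bij_witness[of _ "\<lambda>j. n - j" "\<lambda>j. n - j"]) auto
  also have "(\<Sum>j=1..n-1. 1 / real j) \<le> 1 + ln (real n)"
  proof -
    have "(\<Sum>j=1..n-1. 1 / real j) \<le> 1 + ln (real (n - 1))"
      using assms by (intro sum_inverse_le_ln) auto
    also have "\<dots> \<le> 1 + ln (real n)" using assms by simp
    finally show ?thesis .
  qed
  finally show ?thesis using assms by (simp add: algebra_simps)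
qed

lemma norm_geometric_sum_le:
  assumes "cmod z = 1" "z \<noteq> 1"
  shows "cmod (\<Sum>k=1..K. z ^ k) \<le> 2 / cmod (1 - z)"
proof (cases "K = 0")
  case False
  have "(1 - z) * (\<Sum>k=1..K. z ^ k) = z ^ 1 - z ^ Suc K"
    using False by (intro sum_gp_multiplied) auto
  then have "cmod (1 - z) * cmod (\<Sum>k=1..K. z ^ k) = cmod (z ^ 1 - z ^ Suc K)"
    by (metis norm_mult)
  also have "\<dots> \<le> 2" using norm_triangle_ineq4[of "z ^ 1" "z ^ Suc K"] assms
    by (simp add: norm_mult norm_power)
  finally show ?thesis using assms by (simp add: field_simps)
qed auto

text \<open>The powers over a full period cancel. This shortens progressions to less than one
  period, so that their frequencies become distinct and Parseval applies.\<close>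

lemma geometric_sum_mod:
  fixes z :: complex
  assumes "z ^ n = 1" "z \<noteq> 1"
  shows "(\<Sum>k=1..K. z ^ k) = (\<Sum>k=1..K mod n. z ^ k)"
proof -
  have "(1 - z) * (\<Sum>k=1..J. z ^ k) = z - z ^ Suc J" for J
    using sum_gp_multiplied[of 1 J z] by (cases "J = 0") auto
  moreover have "z ^ Suc K = z ^ Suc (K mod n)"
  proof -
    have "z ^ K = z ^ (n * (K div n) + K mod n)" by simp
    also have "\<dots> = z ^ (K mod n)" unfolding power_add power_mult assms(1) by simp
    finally show ?thesis by simp
  qed
  ultimately have "(1 - z) * (\<Sum>k=1..K. z ^ k) = (1 - z) * (\<Sum>k=1..K mod n. z ^ k)" by simp
  then show ?thesis using assms(2) by simp
qed

text \<open>Starting at \<open>k = 1\<close> leaves out \<open>f c\<close>, which for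
  \<open>c < q\<close> belongs to the main term.\<close>

definition prog_sum :: "(nat \<Rightarrow> complex) \<Rightarrow> nat \<Rightarrow> nat \<Rightarrow> nat \<Rightarrow> complex" where
  "prog_sum f q K c = (\<Sum>k=1..K. f (c + k * q))"

lemma dirichlet_char_fourier:
  assumes "dirichlet_char n f"
  shows "f x = (\<Sum>h<n. gauss_sum n f h * cnj (echar n (h * x))) / of_nat n"
proof -
  have n: "n > 0" using assms by (rule dirichlet_char_pos)
  have "(\<Sum>h<n. gauss_sum n f h * cnj (echar n (h * x)))
      = (\<Sum>k<n. f k * (\<Sum>h<n. echar n (h * k) * cnj (echar n (h * x))))"
    unfolding gauss_sum_def sum_distrib_left sum_distrib_right
    by (subst sum.swap) (simp add: mult_ac)
  also have "\<dots> = (\<Sum>k<n. if k = x mod n then f k * of_nat n else 0)"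
    using n by (intro sum.cong refl) (auto simp: sum_echar_orthogonal cong_def)
  also have "\<dots> = f x * of_nat n" using n by (simp add: dirichlet_char_mod[OF assms])
  finally show ?thesis using n by simp
qed

context
  fixes l q g l' q' :: nat and f :: "nat \<Rightarrow> complex"
  assumes prim: "primitive_char l f" and ndvd: "\<not> l dvd q"
  defines "g \<equiv> gcd l q" and "l' \<equiv> l div gcd l q" and "q' \<equiv> q div gcd l q"
begin

lemma prog_sum_aux:
  shows "l > 0" "g > 0" "l = g * l'" "q = g * q'" "coprime q' l'" "l' > 1"
proof -
  show l: "l > 0" using prim by (simp add: primitive_char_def dirichlet_char_def)
  show g: "g > 0" using l by (simp add: g_def)
  show lg: "l = g * l'" "q = g * q'" by (simp_all add: g_def l'_def q'_def)
  show "coprime q' l'" using div_gcd_coprime[of q l] l by (simp add: l'_def q'_def gcd.commute)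
  have "l' \<noteq> 1" using ndvd lg by (metis dvd_triv_left mult.right_neutral)
  moreover have "l' \<noteq> 0" using l lg by (metis mult_0_right not_gr_zero)
  ultimately show "l' > 1" by simp
qed

text \<open>Stepping by \<open>q\<close> multiplies the frequency \<open>h\<close> by
  \<open>q / l\<close>, which in lowest terms is \<open>q' / l'\<close>; every frequency thus
  contributes a geometric sum whose ratio is a root of unity of order dividing
  \<open>l'\<close>.\<close>

lemma prog_sum_fourier:
  "prog_sum f q K c = (\<Sum>h<l. (gauss_sum l f h * cnj (echar l (h * c)) *
     cnj (\<Sum>k=1..K. echar l' (h * q') ^ k))) / of_nat l"
proof -
  have f: "dirichlet_char l f" using prim by (simp add: primitive_char_def)
  have e: "echar l (h * (c + k * q)) = echar l (h * c) * echar l' (h * q') ^ k" for h k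
  proof -
    have "h * (c + k * q) = h * c + g * (h * q' * k)"
      by (subst prog_sum_aux(4)) (simp add: algebra_simps)
    then have "echar l (h * (c + k * q)) = echar l (h * c) * echar (g * l') (g * (h * q' * k))"
      by (simp only: echar_add prog_sum_aux(3)[symmetric])
    then show ?thesis by (simp only: echar_cancel[OF prog_sum_aux(2)] echar_mult[of l' "h * q'" k])
  qed
  have "prog_sum f q K c = (\<Sum>k=1..K. (\<Sum>h<l. gauss_sum l f h * cnj (echar l (h * (c + k * q)))) / of_nat l)"
    unfolding prog_sum_def by (intro sum.cong refl dirichlet_char_fourier[OF f])
  also have "\<dots> = (\<Sum>h<l. \<Sum>k=1..K. gauss_sum l f h * cnj (echar l (h * (c + k * q)))) / of_nat l"
    by (subst sum.swap) (simp add: sum_divide_distrib)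
  also have "\<dots> = (\<Sum>h<l. (gauss_sum l f h * cnj (echar l (h * c)) *
     cnj (\<Sum>k=1..K. echar l' (h * q') ^ k))) / of_nat l"
    by (simp add: e sum_distrib_left mult_ac)
  finally show ?thesis .
qed

text \<open>Here \<open>\<not> l dvd q\<close> enters: it gives \<open>l' > 1\<close>, so no
  frequency with a nonzero Gauss sum resonates with the progression.\<close>

lemma echar_neq_1: "coprime h l \<Longrightarrow> echar l' (h * q') \<noteq> 1"
proof
  assume h: "coprime h l" "echar l' (h * q') = 1"
  then have "l' dvd h * q'" using prog_sum_aux by (subst (asm) echar_eq_1_iff) auto
  then have "l' dvd h" using prog_sum_aux(5) by (simp add: coprime_commute coprime_dvd_mult_left_iff)
  moreover have "l' dvd l" using prog_sum_aux(3) by simp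
  ultimately have "is_unit l'" using h(1) by (meson coprime_common_divisor)
  with prog_sum_aux(6) show False by simp
qed

text \<open>The range \<open>h < l\<close> covers the residues modulo \<open>l'\<close> exactly
  \<open>g\<close> times, and multiplication by the unit \<open>q'\<close> permutes them.\<close>

lemma sum_echar_reduce:
  assumes "\<And>k. v (k mod l') = v k"
  shows "(\<Sum>h<l. v (h * q')) = of_nat g * (\<Sum>h<l'. (v h :: real))"
proof -
  have m: "v (a + i * l') = v a" for a i by (metis assms mod_mult_self1)
  have m2: "v ((j + i * l') * q') = v (q' * j)" for j i
    using m[of "q' * j" "i * q'"] by (simp add: algebra_simps)
  have "(\<Sum>h<l. v (h * q')) = (\<Sum>i<g. \<Sum>j<l'. v ((j + i * l') * q'))"
    unfolding prog_sum_aux(3) by (rule sum_mult_product)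
  also have "\<dots> = (\<Sum>i<g. \<Sum>j<l'. v (q' * j))" by (simp add: m2)
  also have "(\<Sum>j<l'. v (q' * j)) = (\<Sum>j<l'. v j)"
    using prog_sum_aux assms by (intro sum_mult_coprime) auto
  finally show ?thesis by simp
qed

text \<open>Only frequencies coprime to \<open>l\<close> survive; each Gauss sum has modulus
  \<open>sqrt l\<close>, and the geometric sums together contribute \<open>l\<close> times a
  logarithm, whatever \<open>K\<close> and \<open>c\<close> are.\<close>

lemma polya_vinogradov: "cmod (prog_sum f q K c) \<le> 2 * sqrt (real l) * (1 + ln (real l))"
proof -
  \<comment> \<open>The value 0 at multiples of \<open>l'\<close> loses nothing: if
    \<open>l' dvd h * q'\<close> then \<open>h\<close> is not coprime to \<open>l\<close> and its
    Gauss sum vanishes.\<close>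
  define v where "v j = (if l' dvd j then 0 else 2 / cmod (1 - echar l' j))" for j
  have l: "real l > 0" using prog_sum_aux by simp
  have v: "v (k mod l') = v k" for k by (simp add: v_def dvd_mod_iff)
  have "cmod (prog_sum f q K c) \<le> (\<Sum>h<l. cmod (gauss_sum l f h * cnj (echar l (h * c)) *
     cnj (\<Sum>k=1..K. echar l' (h * q') ^ k))) / real l"
    unfolding prog_sum_fourier norm_divide norm_of_nat by (intro divide_right_mono norm_sum) auto
  also have "\<dots> \<le> (\<Sum>h<l. sqrt (real l) * v (h * q')) / real l"
  proof (intro divide_right_mono sum_mono)
    fix h
    show "cmod (gauss_sum l f h * cnj (echar l (h * c)) * cnj (\<Sum>k=1..K. echar l' (h * q') ^ k))
        \<le> sqrt (real l) * v (h * q')"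
    proof (cases "coprime h l")
      case True
      have 1: "cmod (gauss_sum l f h) = sqrt (real l)"
        using norm_gauss_sum[OF prim True] by (metis norm_ge_zero real_sqrt_unique)
      have ne: "echar l' (h * q') \<noteq> 1" using True by (rule echar_neq_1)
      then have "\<not> l' dvd h * q'" using prog_sum_aux by (subst (asm) echar_eq_1_iff) auto
      then have v': "v (h * q') = 2 / cmod (1 - echar l' (h * q'))" by (simp add: v_def)
      have "cmod (\<Sum>k=1..K. echar l' (h * q') ^ k) \<le> v (h * q')"
        unfolding v' by (rule norm_geometric_sum_le[OF norm_echar ne])
      then show ?thesis
        by (simp only: norm_mult 1 norm_echar complex_mod_cnj mult_1_right)
           (erule mult_left_mono, simp)
    qed (auto simp: gauss_sum_not_coprime[OF prim] v_def)
  qed auto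
  also have "\<dots> = sqrt (real l) * (real g * (\<Sum>h<l'. v h)) / real l"
    by (simp add: sum_distrib_left[symmetric] sum_echar_reduce[where v = v, OF v])
  also have "(\<Sum>h<l'. v h) = (\<Sum>j=1..l'-1. 2 / cmod (1 - echar l' j))"
  proof (rule sum.mono_neutral_cong_right)
    show "\<forall>j\<in>{..<l'} - {1..l' - 1}. v j = 0"
    proof
      fix j assume "j \<in> {..<l'} - {1..l' - 1}"
      then have "j = 0" by (cases j) auto
      then show "v j = 0" by (simp add: v_def)
    qed
  qed (auto simp: v_def dest!: dvd_imp_le)
  also have "sqrt (real l) * (real g * \<dots>) / real l
      \<le> sqrt (real l) * (real g * (2 * real l' * (1 + ln (real l')))) / real l"
    using prog_sum_aux(6) by (intro divide_right_mono mult_left_mono sum_norm_1_minus_echar_le) auto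
  also have "\<dots> = 2 * sqrt (real l) * (1 + ln (real l'))"
  proof -
    have "real g * (2 * real l' * (1 + ln (real l'))) = real l * (2 * (1 + ln (real l')))"
    proof -
      have "real l = real g * real l'" by (metis prog_sum_aux(3) of_nat_mult)
      then show ?thesis by (simp only: mult_ac)
    qed
    then show ?thesis using l by (simp only: times_divide_eq_left nonzero_mult_div_cancel_left)
        (simp add: mult_ac)
  qed
  also have "\<dots> \<le> 2 * sqrt (real l) * (1 + ln (real l))"
  proof -
    have "l' \<le> l" using prog_sum_aux by simp
    then have "ln (real l') \<le> ln (real l)" using prog_sum_aux(6) by simp
    then show ?thesis by (intro mult_left_mono) auto
  qed
  finally show ?thesis .
qed

text \<open>Parseval is applied twice, first over the starting point \<open>c\<close> modulo
  \<open>l\<close>, then over the frequencies modulo \<open>l'\<close> after the geometric sums have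
  been cut to length \<open>K mod l'\<close>. The outcome is square-root cancellation on
  average.\<close>

lemma prog_sum_mean_square: "(\<Sum>c<l. (cmod (prog_sum f q K c))\<^sup>2) \<le> real l * real K"
proof -
  define J where "J = K mod l'"
  define b where "b h = gauss_sum l f h * cnj (\<Sum>k=1..K. echar l' (h * q') ^ k)" for h
  have l: "l > 0" using prog_sum_aux by simp
  have "(\<Sum>c<l. (cmod (prog_sum f q K c))\<^sup>2) = (\<Sum>c<l. (cmod (\<Sum>h<l. cnj (b h) * echar l (c * h)))\<^sup>2) / (real l)\<^sup>2"
  proof -
    have "prog_sum f q K c = cnj (\<Sum>h<l. cnj (b h) * echar l (c * h)) / of_nat l" for c
      unfolding prog_sum_fourier b_def by (simp add: mult_ac)
    then have "cmod (prog_sum f q K c) = cmod (\<Sum>h<l. cnj (b h) * echar l (c * h)) / real l" for c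
      by (simp only: norm_divide complex_mod_cnj norm_of_nat)
    then show ?thesis by (simp add: power_divide sum_divide_distrib)
  qed
  also have "\<dots> = real l * (\<Sum>h<l. (cmod (cnj (b h)))\<^sup>2) / (real l)\<^sup>2"
    using l by (subst parseval_echar) (auto simp: inj_on_def)
  also have "\<dots> = (\<Sum>h<l. (cmod (b h))\<^sup>2) / real l" using l by (simp add: power2_eq_square)
  also have "\<dots> \<le> (\<Sum>h<l. real l * (cmod (\<Sum>k=1..J. echar l' (h * q') ^ k))\<^sup>2) / real l"
  proof (intro divide_right_mono sum_mono)
    fix h
    show "(cmod (b h))\<^sup>2 \<le> real l * (cmod (\<Sum>k=1..J. echar l' (h * q') ^ k))\<^sup>2"
    proof (cases "coprime h l")
      case True
      have "echar l' (h * q') ^ l' = 1" by (simp add: echar_mult[symmetric] mult.commute[of _ l'] echar_mult_self)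
      then have "(\<Sum>k=1..K. echar l' (h * q') ^ k) = (\<Sum>k=1..J. echar l' (h * q') ^ k)"
        unfolding J_def using echar_neq_1[OF True] by (rule geometric_sum_mod)
      then show ?thesis using norm_gauss_sum[OF prim True]
        by (simp only: b_def norm_mult power_mult_distrib complex_mod_cnj order_refl)
    qed (simp add: b_def gauss_sum_not_coprime[OF prim])
  qed auto
  also have "\<dots> = (\<Sum>h<l. (cmod (\<Sum>k=1..J. echar l' (h * q') ^ k))\<^sup>2)"
    using l by (simp add: sum_distrib_left[symmetric])
  also have "\<dots> = real g * (\<Sum>h<l'. (cmod (\<Sum>k=1..J. echar l' h ^ k))\<^sup>2)"
    by (rule sum_echar_reduce) simp
  also have "(\<Sum>h<l'. (cmod (\<Sum>k=1..J. echar l' h ^ k))\<^sup>2)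
      = (\<Sum>h<l'. (cmod (\<Sum>k=1..J. 1 * echar l' (h * k)))\<^sup>2)"
    by (simp add: echar_mult)
  also have "\<dots> = real l' * (\<Sum>k=1..J. (cmod 1)\<^sup>2)"
  proof (rule parseval_echar)
    have "J < l'" using prog_sum_aux(6) by (simp add: J_def)
    then show "inj_on (\<lambda>k. k mod l') {1..J}" by (auto simp: inj_on_def)
  qed (use prog_sum_aux in auto)
  also have "real g * \<dots> = real l * real J" using prog_sum_aux(3) by simp
  also have "\<dots> \<le> real l * real K" by (intro mult_left_mono) (auto simp: J_def)
  finally show ?thesis .
qed

end


section \<open>Averages over an interval of starting points\<close>

lemma prog_sum_add: "prog_sum f q (a + K) b = prog_sum f q a b + prog_sum f q K (b + a * q)"
  by (induction K) (auto simp: prog_sum_def algebra_simps)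

lemma norm_prog_sum_le:
  assumes "dirichlet_char l f"
  shows "cmod (prog_sum f q K c) \<le> real K"
proof -
  have "cmod (prog_sum f q K c) \<le> (\<Sum>k=1..K. 1)"
    unfolding prog_sum_def by (intro sum_norm_le norm_dirichlet_char_le[OF assms])
  then show ?thesis by simp
qed

lemma sum_periodic_le:
  fixes g :: "nat \<Rightarrow> real"
  assumes "l > 0" "\<And>k. g (k mod l) = g k" "\<And>k. g k \<ge> 0"
  shows "(\<Sum>n<N. g n) \<le> real (N div l + 1) * (\<Sum>n<l. g n)"
proof -
  have "N = N div l * l + N mod l" by simp
  also have "\<dots> \<le> N div l * l + l" using assms(1) by (intro add_left_mono less_imp_le) simp
  finally have "N \<le> (N div l + 1) * l" by simp
  then have "(\<Sum>n<N. g n) \<le> (\<Sum>n<(N div l + 1) * l. g n)"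
    using assms(3) by (intro sum_mono2) auto
  also have "\<dots> = (\<Sum>i<N div l + 1. \<Sum>j<l. g (j + i * l))" by (rule sum_mult_product)
  also have "\<dots> = (\<Sum>i<N div l + 1. \<Sum>j<l. g j)"
  proof (intro sum.cong refl)
    show "g (j + i * l) = g j" for i j
      using assms(2)[of "j + i * l"] assms(2)[of j] by simp
  qed
  finally show ?thesis by simp
qed

text \<open>For \<open>a < A\<close> the points \<open>b + a q\<close> with \<open>b < q\<close> are distinct modulo \<open>l\<close> when \<open>A q \<le> l\<close>, and shifting
  a sum of length \<open>K\<close> by \<open>a\<close> steps changes it by at most \<open>2 a\<close>. Averaging over the shifts replaces the
  sum over \<open>q\<close> consecutive starting points by one over a full period; \<open>A \<approx> (l/q)\<^bsup>1/2\<^esup>\<close> balances the two errors.\<close>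

lemma prog_sum_interval_mean_square:
  assumes prim: "primitive_char l f" and ndvd: "\<not> l dvd q"
  shows "(\<Sum>b<q. (cmod (prog_sum f q K b))\<^sup>2) \<le> 12 * real q * real K * max 1 (sqrt (real l / real q))"
proof -
  define s where "s = sqrt (real l / real q)"
  define A where "A = nat \<lfloor>s\<rfloor>"
  define g where "g n = (cmod (prog_sum f q K n))\<^sup>2" for n
  have f: "dirichlet_char l f" using prim by (simp add: primitive_char_def)
  have l: "l > 0" using f by (rule dirichlet_char_pos)
  have q: "q > 0" using ndvd by (cases "q = 0") auto
  have per: "g (n mod l) = g n" for n
  proof -
    have "prog_sum f q K (n mod l) = prog_sum f q K n" unfolding prog_sum_def
      by (intro sum.cong refl dirichlet_char_cong[OF f]) (simp add: cong_def mod_add_left_eq)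
    then show ?thesis by (simp add: g_def)
  qed
  have s0: "s \<ge> 0" by (simp add: s_def)
  have As: "real A \<le> s" "s < real A + 1" using s0 by (simp_all add: A_def)
  have ls: "real l = real q * s\<^sup>2" using q by (simp add: s_def)
  show ?thesis
  proof (cases "A = 0")
    case True
    \<comment> \<open>Here \<open>l < q\<close>, so the \<open>q\<close> starting points already run
      through at most \<open>q div l + 1\<close> full periods and no shifting is required.\<close>
    then have "s < 1" using As by simp
    then have "s\<^sup>2 \<le> 1" using s0 by (simp add: power_le_one)
    then have "real l \<le> real q" unfolding ls by (simp add: mult_left_le)
    have "(\<Sum>b<q. g b) \<le> real (q div l + 1) * (\<Sum>n<l. g n)"
      by (intro sum_periodic_le l per) (simp add: g_def)
    also have "\<dots> \<le> real (q div l + 1) * (real l * real K)"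
      unfolding g_def by (intro mult_left_mono prog_sum_mean_square[OF prim ndvd]) auto
    also have "\<dots> = (real (q div l * l) + real l) * real K" by (simp add: algebra_simps)
    also have "\<dots> \<le> (real q + real q) * real K"
      using \<open>real l \<le> real q\<close> div_times_less_eq_dividend[of q l]
      by (intro mult_right_mono add_mono) (simp_all only: of_nat_le_iff of_nat_0_le_iff)
    also have "\<dots> \<le> 12 * real q * real K * 1" by simp
    also have "\<dots> \<le> 12 * real q * real K * max 1 s" by (intro mult_left_mono) auto
    finally show ?thesis by (simp only: g_def s_def)
  next
    case False
    then have A1: "real A \<ge> 1" by simp
    have "(\<Sum>b<q. g b) \<le> 12 * real q * real K * s"
    proof (cases "K < A")
      case True
      have "(\<Sum>b<q. g b) \<le> (\<Sum>b<q. real K * s)"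
      proof (intro sum_mono)
        fix b
        have "g b \<le> (real K)\<^sup>2" unfolding g_def
          by (intro power_mono norm_prog_sum_le[OF f]) auto
        also have "\<dots> = real K * real K" by (simp add: power2_eq_square)
        also have "\<dots> \<le> real K * s" using True As by (intro mult_left_mono) auto
        finally show "g b \<le> real K * s" .
      qed
      also have "\<dots> = 1 * (real q * real K * s)" by simp
      also have "\<dots> \<le> 12 * (real q * real K * s)" using s0 by (intro mult_right_mono) auto
      finally show ?thesis by (simp add: mult_ac)
    next
      case False
      then have KA: "real A \<le> real K" by simp
      have A2: "(real A)\<^sup>2 \<le> s\<^sup>2" using As by (intro power_mono) auto
      have "real A * 1 \<le> real A * real A" using A1 by (intro mult_left_mono) auto
      then have "real A \<le> s\<^sup>2" using A2 by (simp add: power2_eq_square)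
      then have "real (A * q) \<le> real l" unfolding ls by (simp add: mult.commute[of "real A"] mult_left_mono)
      then have Aq: "A * q \<le> l" by (simp only: of_nat_le_iff)
      have "real A * (\<Sum>b<q. g b) = (\<Sum>a<A. \<Sum>b<q. g b)" by simp
      also have "\<dots> \<le> (\<Sum>a<A. \<Sum>b<q. 2 * g (b + a * q) + 8 * (real A)\<^sup>2)"
      proof (intro sum_mono)
        fix a b assume "a \<in> {..<A}"
        \<comment> \<open>Both sides are the sum of the same \<open>a + K\<close> terms, cut after
          \<open>a\<close> and after \<open>K\<close>; the two pieces of length \<open>a\<close> are
          the cost of the shift.\<close>
        have "prog_sum f q a b + prog_sum f q K (b + a * q) = prog_sum f q K b + prog_sum f q a (b + K * q)"
          using prog_sum_add[of f q a K b] prog_sum_add[of f q K a b] by (simp add: add.commute)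
        then have "prog_sum f q K b = prog_sum f q K (b + a * q) + (prog_sum f q a b - prog_sum f q a (b + K * q))"
          by (simp add: algebra_simps)
        then have "cmod (prog_sum f q K b) \<le> cmod (prog_sum f q K (b + a * q)) + cmod (prog_sum f q a b - prog_sum f q a (b + K * q))"
          by (metis norm_triangle_ineq)
        also have "cmod (prog_sum f q a b - prog_sum f q a (b + K * q)) \<le> real a + real a"
          by (rule order_trans[OF norm_triangle_ineq4]) (intro add_mono norm_prog_sum_le[OF f])
        also have "\<dots> \<le> 2 * real A" using \<open>a \<in> {..<A}\<close> by simp
        finally have "g b \<le> (cmod (prog_sum f q K (b + a * q)) + 2 * real A)\<^sup>2"
          unfolding g_def by (intro power_mono) auto
        also have "\<dots> \<le> 2 * g (b + a * q) + 8 * (real A)\<^sup>2"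
          using sum_squares_bound[of "cmod (prog_sum f q K (b + a * q))" "2 * real A"]
          by (simp add: g_def power2_sum power_mult_distrib)
        finally show "g b \<le> 2 * g (b + a * q) + 8 * (real A)\<^sup>2" .
      qed
      also have "\<dots> = 2 * (\<Sum>a<A. \<Sum>b<q. g (b + a * q)) + real A * real q * (8 * (real A)\<^sup>2)"
        by (simp add: sum.distrib sum_distrib_left)
      also have "(\<Sum>a<A. \<Sum>b<q. g (b + a * q)) = (\<Sum>n<A*q. g n)"
        by (rule sum_mult_product[symmetric])
      also have "\<dots> \<le> (\<Sum>n<l. g n)" using Aq by (intro sum_mono2) (auto simp: g_def)
      also have "\<dots> \<le> real l * real K"
        unfolding g_def by (intro prog_sum_mean_square[OF prim ndvd])
      also have "real l \<le> real q * (s * (2 * real A))"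
        unfolding ls power2_eq_square using As A1 s0 by (intro mult_left_mono) auto
      also have "real A * real q * (8 * (real A)\<^sup>2) \<le> real A * real q * (8 * (s * real K))"
        unfolding power2_eq_square using As KA s0 by (intro mult_left_mono mult_mono) auto
      finally have "real A * (\<Sum>b<q. g b) \<le> 2 * (real q * (s * (2 * real A)) * real K) + real A * real q * (8 * (s * real K))"
        by (simp add: mult_right_mono)
      \<comment> \<open>The constant is 12 = 4 + 8, from \<open>l \<le> 2 q s A\<close> in the
        averaged term and from the shift error.\<close>
      also have "\<dots> = real A * (12 * real q * real K * s)" by (simp add: algebra_simps)
      finally show ?thesis using A1 by simp
    qed
    also have "\<dots> \<le> 12 * real q * real K * max 1 s" by (intro mult_left_mono) auto
    finally show ?thesis by (simp only: g_def s_def)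
  qed
qed

section \<open>Analytic continuation\<close>

text \<open>Each summation by parts against a balanced periodic coefficient sequence replaces
  \<open>n\<^bsup>-s\<^esup>\<close> by its difference and so gains one power of \<open>n\<close>, that is, one unit strip.\<close>

primrec ndiff :: "nat \<Rightarrow> complex \<Rightarrow> complex \<Rightarrow> complex" where
  "ndiff 0 s z = z powr (- s)"
| "ndiff (Suc k) s z = ndiff k s z - ndiff k s (z + 1)"

lemma ndiff_Suc_of_nat: "ndiff (Suc k) s (of_nat n) = ndiff k s (of_nat n) - ndiff k s (of_nat (Suc n))"
  by (simp add: add.commute)

lemma ndiff_has_field_derivative:
  assumes "Re z > 0"
  shows "((\<lambda>z. ndiff k s z) has_field_derivative (- s * ndiff k (s + 1) z)) (at z)"
  using assms
proof (induction k arbitrary: z)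
  case 0
  then have "z \<notin> \<real>\<^sub>\<le>\<^sub>0" by (auto simp: complex_nonpos_Reals_iff)
  then have "((\<lambda>z. z powr (- s)) has_field_derivative (- s * z powr (- s - 1))) (at z)"
    by (rule has_field_derivative_powr)
  then show ?case by simp
next
  case (Suc k)
  have "((\<lambda>z. ndiff k s (z + 1)) has_field_derivative (- s * ndiff k (s + 1) (z + 1))) (at z)"
    using Suc.IH[of "z + 1"] Suc.prems by (subst DERIV_shift[symmetric]) simp_all
  from DERIV_diff[OF Suc.IH[OF Suc.prems] this] show ?case by (simp add: algebra_simps)
qed

text \<open>Mean value inequality on the segment from \<open>x\<close> to \<open>x + 1\<close>:
  differentiating replaces \<open>ndiff k s\<close> by \<open>- s * ndiff k (s + 1)\<close>, so each
  difference costs a factor \<open>cmod (s + i)\<close> and gains one power of \<open>x\<close>. The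
  sign condition makes the majorant decrease along the segment.\<close>

lemma norm_ndiff_le:
  assumes "x > 0" "Re s + real k \<ge> 0"
  shows "cmod (ndiff k s (of_real x)) \<le> (\<Prod>i<k. cmod (s + of_nat i)) * x powr (- Re s - real k)"
  using assms
proof (induction k arbitrary: s x)
  case 0
  then show ?case by (simp add: norm_powr_real_powr)
next
  case (Suc k)
  define B where "B = cmod s * ((\<Prod>i<k. cmod (s + 1 + of_nat i)) * x powr (- Re s - real (Suc k)))"
  define S where "S = closed_segment (complex_of_real x) (of_real (x + 1))"
  have S: "\<exists>y. z = of_real y \<and> x \<le> y" if "z \<in> S" for z
    using that Suc.prems unfolding S_def closed_segment_of_real
    by (auto simp: closed_segment_eq_real_ivl)
  have "cmod (ndiff k s (of_real x) - ndiff k s (of_real (x + 1))) \<le> B * cmod (of_real x - of_real (x + 1))"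
  proof (rule field_differentiable_bound[where S = S])
    fix z assume "z \<in> S"
    then obtain y where y: "z = of_real y" "x \<le> y" using S by blast
    show "((\<lambda>z. ndiff k s z) has_field_derivative (- s * ndiff k (s + 1) z)) (at z within S)"
      using y Suc.prems by (intro DERIV_subset[OF ndiff_has_field_derivative]) auto
    have "cmod (ndiff k (s + 1) (of_real y)) \<le>
        (\<Prod>i<k. cmod (s + 1 + of_nat i)) * y powr (- Re (s + 1) - real k)"
      using y Suc.prems by (intro Suc.IH) auto
    also have "\<dots> \<le> (\<Prod>i<k. cmod (s + 1 + of_nat i)) * x powr (- Re s - real (Suc k))"
    proof (intro mult_left_mono prod_nonneg)
      have "y powr (- Re s - real (Suc k)) \<le> x powr (- Re s - real (Suc k))"
        using y Suc.prems by (intro powr_mono2') auto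
      then show "y powr (- Re (s + 1) - real k) \<le> x powr (- Re s - real (Suc k))"
        by (simp only: plus_complex.sel one_complex.sel of_nat_Suc minus_add_distrib diff_conv_add_uminus add_ac)
    qed auto
    finally show "cmod (- s * ndiff k (s + 1) z) \<le> B"
      unfolding B_def y by (simp add: norm_mult mult_left_mono)
  qed (auto simp: S_def)
  also have "cmod (complex_of_real x - of_real (x + 1)) = 1"
    by (simp del: of_real_add add: of_real_diff[symmetric])
  also have "B * 1 = (\<Prod>i<Suc k. cmod (s + of_nat i)) * x powr (- Re s - real (Suc k))"
    by (simp add: B_def prod.lessThan_Suc_shift add_ac del: prod.lessThan_Suc)
  finally show ?case by simp
qed

lemma ndiff_holomorphic: "z \<noteq> 0 \<Longrightarrow> Re z > 0 \<Longrightarrow> (\<lambda>s. ndiff k s z) holomorphic_on A"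
proof (induction k arbitrary: z)
  case (Suc k)
  have "z + 1 \<noteq> 0" using Suc.prems by (auto simp: complex_eq_iff)
  with Suc.IH[of z] Suc.IH[of "z + 1"] Suc.prems show ?case
    by (auto intro!: holomorphic_intros)
qed (auto intro!: holomorphic_intros)

text \<open>Vanishing of the sum over a period is what makes the partial sums periodic, hence
  bounded. Nonprincipal characters have this property.\<close>

definition balanced :: "nat \<Rightarrow> (nat \<Rightarrow> complex) \<Rightarrow> bool" where
  "balanced N f \<longleftrightarrow> N > 0 \<and> (\<forall>k. f (k + N) = f k) \<and> (\<Sum>k<N. f k) = 0"

definition psum :: "(nat \<Rightarrow> complex) \<Rightarrow> nat \<Rightarrow> complex" where
  "psum f n = (\<Sum>k=1..n. f k)"

definition pmean :: "nat \<Rightarrow> (nat \<Rightarrow> complex) \<Rightarrow> complex" where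
  "pmean N f = (\<Sum>n<N. psum f n) / of_nat N"

text \<open>Partial sums of a balanced sequence are periodic but need not be balanced; subtracting
  the mean restores this, so that summation by parts can be iterated.\<close>

definition centred_psum :: "nat \<Rightarrow> (nat \<Rightarrow> complex) \<Rightarrow> nat \<Rightarrow> complex" where
  "centred_psum N f n = psum f n - pmean N f"

lemma balanced_bounded:
  assumes "balanced N f"
  obtains B where "B \<ge> 0" "\<And>n. cmod (f n) \<le> B"
proof
  show "(\<Sum>k<N. cmod (f k)) \<ge> 0" by (intro sum_nonneg) auto
  fix n
  have "f (n mod N) = f n" using assms by (intro periodic_mod) (simp add: balanced_def)
  moreover have "cmod (f (n mod N)) \<le> (\<Sum>k<N. cmod (f k))"
    using assms by (intro member_le_sum) (auto simp: balanced_def)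
  ultimately show "cmod (f n) \<le> (\<Sum>k<N. cmod (f k))" by simp
qed

lemma balanced_centred_psum:
  assumes "balanced N f"
  shows "balanced N (centred_psum N f)"
proof -
  have N: "N > 0" and per: "\<And>k. f (k + N) = f k" and 0: "(\<Sum>k<N. f k) = 0"
    using assms by (auto simp: balanced_def)
  have "psum f N = (\<Sum>k<N. f k)"
  proof -
    have "psum f N = (\<Sum>k<N. f (Suc k))"
      unfolding psum_def using sum.atLeast1_atMost_eq[of f N] by simp
    also have "\<dots> + f 0 = (\<Sum>k<Suc N. f k)" by (simp only: sum.lessThan_Suc_shift add.commute)
    also have "\<dots> = (\<Sum>k<N. f k) + f 0" using per[of 0] by simp
    finally show ?thesis by simp
  qed
  then have "psum f (k + N) = psum f k" for k
  proof (induction k)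
    case (Suc k)
    then show ?case using per[of "Suc k"] by (simp add: psum_def)
  qed (simp add: psum_def 0)
  then show ?thesis using N
    by (simp add: balanced_def centred_psum_def sum_subtractf pmean_def)
qed

lemma abel_summation:
  fixes u :: "nat \<Rightarrow> complex"
  shows "(\<Sum>n<M. f (Suc n) * u (Suc n)) = pmean N f * u 1 + centred_psum N f M * u (Suc M)
    + (\<Sum>n<M. centred_psum N f (Suc n) * (u (Suc n) - u (Suc (Suc n))))"
  by (induction M) (simp_all add: centred_psum_def psum_def algebra_simps)

text \<open>For \<open>k = 0\<close> this is the Dirichlet series of \<open>f\<close>; larger
  \<open>k\<close> arise after \<open>k\<close> summations by parts.\<close>

definition nseries :: "(nat \<Rightarrow> complex) \<Rightarrow> nat \<Rightarrow> complex \<Rightarrow> complex" where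
  "nseries f k s = (\<Sum>n. f (Suc n) * ndiff k s (of_nat (Suc n)))"

text \<open>The right-hand side does not depend on \<open>s\<close> within the disc of radius
  \<open>R\<close>, as the Weierstrass M-test requires.\<close>

lemma nseries_majorant:
  assumes "\<And>n. cmod (f n) \<le> B" "B \<ge> 0" "1 + d \<le> Re s + real k" "d > 0" "cmod s \<le> R"
  shows "cmod (f (Suc n) * ndiff k s (of_nat (Suc n))) \<le> B * (R + real k) ^ k * real (Suc n) powr (- 1 - d)"
proof -
  have "cmod (ndiff k s (of_real (real (Suc n)))) \<le>
      (\<Prod>i<k. cmod (s + of_nat i)) * real (Suc n) powr (- Re s - real k)"
    using assms by (intro norm_ndiff_le) auto
  also have "\<dots> \<le> (R + real k) ^ k * real (Suc n) powr (- 1 - d)"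
  proof (intro mult_mono)
    have "(\<Prod>i<k. cmod (s + of_nat i)) \<le> (\<Prod>i<k. R + real k)"
    proof (intro prod_mono conjI)
      fix i assume "i \<in> {..<k}"
      then show "cmod (s + of_nat i) \<le> R + real k"
        using assms(5) norm_triangle_ineq[of s "of_nat i"] by simp
    qed auto
    then show "(\<Prod>i<k. cmod (s + of_nat i)) \<le> (R + real k) ^ k" by simp
    show "real (Suc n) powr (- Re s - real k) \<le> real (Suc n) powr (- 1 - d)"
      using assms(3) by (intro powr_mono) auto
    have "R \<ge> 0" using assms(5) norm_ge_zero[of s] by linarith
    then show "0 \<le> (R + real k) ^ k" by simp
  qed (auto intro: prod_nonneg)
  finally have "cmod (ndiff k s (of_nat (Suc n))) \<le> (R + real k) ^ k * real (Suc n) powr (- 1 - d)"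
    by simp
  then have "cmod (f (Suc n)) * cmod (ndiff k s (of_nat (Suc n))) \<le>
     B * ((R + real k) ^ k * real (Suc n) powr (- 1 - d))"
    using assms by (intro mult_mono) auto
  then show ?thesis by (simp add: norm_mult mult_ac)
qed

lemma summable_Suc_powr: "d > 0 \<Longrightarrow> summable (\<lambda>n. C * real (Suc n) powr (- 1 - d))"
  using summable_real_powr_iff[of "- 1 - d"] by (subst (asm) summable_Suc_iff[symmetric]) (simp add: summable_mult)

lemma nseries_summable:
  assumes "balanced N f" "1 < Re s + real k"
  shows "summable (\<lambda>n. f (Suc n) * ndiff k s (of_nat (Suc n)))"
proof -
  obtain B where B: "B \<ge> 0" "\<And>n. cmod (f n) \<le> B" using balanced_bounded[OF assms(1)] by blast
  define d where "d = Re s + real k - 1"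
  have d: "d > 0" using assms by (simp add: d_def)
  show ?thesis
  proof (rule summable_comparison_test[OF _ summable_Suc_powr[OF d]])
    show "\<exists>M. \<forall>n\<ge>M. cmod (f (Suc n) * ndiff k s (of_nat (Suc n)))
        \<le> B * (cmod s + real k) ^ k * real (Suc n) powr (- 1 - d)"
      using B d by (intro exI[of _ 0] allI impI nseries_majorant) (auto simp: d_def)
  qed
qed

lemma nseries_holomorphic:
  assumes "balanced N f"
  shows "nseries f k holomorphic_on {s. Re s > 1 - real k}"
proof -
  obtain B where B: "B \<ge> 0" "\<And>n. cmod (f n) \<le> B" using balanced_bounded[OF assms(1)] by blast
  show ?thesis
  proof (rule holomorphic_uniform_sequence)
    show "open {s. Re s > 1 - real k}" by (rule open_halfspace_Re_gt)
    show "(\<lambda>s. \<Sum>n<M. f (Suc n) * ndiff k s (of_nat (Suc n))) holomorphic_on {s. Re s > 1 - real k}" for M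
      by (intro holomorphic_intros ndiff_holomorphic) (auto simp del: of_nat_Suc)
    fix z assume z: "z \<in> {s. Re s > 1 - real k}"
    \<comment> \<open>Half the distance from \<open>z\<close> to the boundary line, so that
      \<open>Re s + k\<close> still exceeds 1 by \<open>d\<close> on the closed disc of radius
      \<open>d\<close>.\<close>
    define d where "d = (Re z + real k - 1) / 2"
    have d: "d > 0" using z by (simp add: d_def)
    have re: "1 + d \<le> Re s + real k" "cmod s \<le> cmod z + d" if "s \<in> cball z d" for s
    proof -
      have "\<bar>Re (z - s)\<bar> \<le> d" using that abs_Re_le_cmod[of "z - s"] by (simp add: dist_norm)
      then have "Re z - Re s \<le> d" using abs_ge_self[of "Re z - Re s"] by simp
      then show "1 + d \<le> Re s + real k" by (simp add: d_def field_simps)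
      show "cmod s \<le> cmod z + d"
        using that norm_triangle_ineq2[of s z] by (simp add: dist_norm norm_minus_commute)
    qed
    have "uniform_limit (cball z d) (\<lambda>M s. \<Sum>n<M. f (Suc n) * ndiff k s (of_nat (Suc n))) (nseries f k) sequentially"
      unfolding nseries_def
      by (rule Weierstrass_m_test[OF _ summable_Suc_powr[OF d]])
         (rule nseries_majorant[OF B(2) B(1) re(1) d re(2)])
    moreover have "cball z d \<subseteq> {s. Re s > 1 - real k}" using re(1) d by force
    ultimately show "\<exists>d. 0 < d \<and> cball z d \<subseteq> {s. Re s > 1 - real k} \<and>
       uniform_limit (cball z d) (\<lambda>M s. \<Sum>n<M. f (Suc n) * ndiff k s (of_nat (Suc n))) (nseries f k) sequentially"
      using d by blast
  qed
qed

text \<open>The left series is only claimed to converge for \<open>Re s + k > 0\<close>, one unit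
  beyond its region of absolute convergence, while the right one converges absolutely there. At
  \<open>k = 0\<close> this reaches the point \<open>s = 1/2\<close>.\<close>

lemma nseries_step:
  assumes "balanced N f" "0 < Re s + real k"
  shows "(\<lambda>n. f (Suc n) * ndiff k s (of_nat (Suc n))) sums
     (pmean N f * ndiff k s 1 + nseries (centred_psum N f) (Suc k) s)"
proof -
  obtain B where B: "B \<ge> 0" "\<And>n. cmod (centred_psum N f n) \<le> B"
    using balanced_bounded[OF balanced_centred_psum[OF assms(1)]] by blast
  have lim0: "(\<lambda>M. centred_psum N f M * ndiff k s (of_nat (Suc M))) \<longlonglongrightarrow> 0"
  proof (rule Lim_null_comparison)
    define C where "C = (\<Prod>i<k. cmod (s + of_nat i))"
    show "\<forall>\<^sub>F M in sequentially. cmod (centred_psum N f M * ndiff k s (of_nat (Suc M))) \<le>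
        B * (C * real (Suc M) powr (- Re s - real k))"
    proof (intro always_eventually allI)
      fix M
      have "cmod (ndiff k s (of_real (real (Suc M)))) \<le> C * real (Suc M) powr (- Re s - real k)"
        unfolding C_def using assms by (intro norm_ndiff_le) auto
      then show "cmod (centred_psum N f M * ndiff k s (of_nat (Suc M))) \<le>
        B * (C * real (Suc M) powr (- Re s - real k))"
        using B by (auto simp: norm_mult intro!: mult_mono)
    qed
    have "(\<lambda>M. real (Suc M) powr (- Re s - real k)) \<longlonglongrightarrow> 0"
      using assms(2) by (intro tendsto_neg_powr filterlim_compose[OF filterlim_real_sequentially filterlim_Suc]) auto
    then have "(\<lambda>M. B * (C * real (Suc M) powr (- Re s - real k))) \<longlonglongrightarrow> B * (C * 0)"
      by (intro tendsto_intros)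
    then show "(\<lambda>M. B * (C * real (Suc M) powr (- Re s - real k))) \<longlonglongrightarrow> 0" by simp
  qed
  have "(\<lambda>n. centred_psum N f (Suc n) * ndiff (Suc k) s (of_nat (Suc n))) sums nseries (centred_psum N f) (Suc k) s"
    unfolding nseries_def using assms(2)
    by (intro summable_sums nseries_summable[OF balanced_centred_psum[OF assms(1)]]) auto
  then have "(\<lambda>M. pmean N f * ndiff k s 1 + centred_psum N f M * ndiff k s (of_nat (Suc M)) +
      (\<Sum>n<M. centred_psum N f (Suc n) * ndiff (Suc k) s (of_nat (Suc n)))) \<longlonglongrightarrow>
      pmean N f * ndiff k s 1 + 0 + nseries (centred_psum N f) (Suc k) s"
    unfolding sums_def by (intro tendsto_add lim0 tendsto_const)
  also have "(\<lambda>M. pmean N f * ndiff k s 1 + centred_psum N f M * ndiff k s (of_nat (Suc M)) +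
      (\<Sum>n<M. centred_psum N f (Suc n) * ndiff (Suc k) s (of_nat (Suc n)))) =
      (\<lambda>M. \<Sum>n<M. f (Suc n) * ndiff k s (of_nat (Suc n)))"
    using abel_summation[where u = "\<lambda>n. ndiff k s (of_nat n)" and f = f and N = N]
    by (intro ext) (simp only: ndiff_Suc_of_nat of_nat_1)
  finally show ?thesis by (simp add: sums_def)
qed

text \<open>The induction varies \<open>k\<close> and \<open>f\<close>, since each step replaces
  \<open>f\<close> by its centred partial sums and \<open>k\<close> by \<open>Suc k\<close>.\<close>

lemma nseries_continuation:
  assumes "balanced N f"
  shows "\<exists>g. g holomorphic_on {s. Re s > 1 - real (k + j)} \<and> (\<forall>s. Re s > 1 - real k \<longrightarrow> g s = nseries f k s)"
  using assms
proof (induction j arbitrary: k f)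
  case 0
  then show ?case using nseries_holomorphic[OF 0] by auto
next
  case (Suc j)
  obtain g where g: "g holomorphic_on {s. Re s > 1 - real (Suc k + j)}"
    "\<And>s. Re s > 1 - real (Suc k) \<Longrightarrow> g s = nseries (centred_psum N f) (Suc k) s"
    using Suc.IH[OF balanced_centred_psum[OF Suc.prems], of "Suc k"] by blast
  show ?case
  proof (intro exI[of _ "\<lambda>s. pmean N f * ndiff k s 1 + g s"] conjI allI impI)
    show "(\<lambda>s. pmean N f * ndiff k s 1 + g s) holomorphic_on {s. Re s > 1 - real (k + Suc j)}"
      using g(1) by (intro holomorphic_intros ndiff_holomorphic) (auto simp: algebra_simps)
    fix s assume "Re s > 1 - real k"
    then show "pmean N f * ndiff k s 1 + g s = nseries f k s"
      using nseries_step[OF Suc.prems, of s k] g(2)[of s] unfolding nseries_def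
      by (simp add: sums_iff)
  qed
qed

text \<open>Continuations to growing half-planes agree where they overlap by the identity theorem
  and are glued together.\<close>

lemma entire_continuation:
  assumes "balanced N f"
  obtains G where "G holomorphic_on UNIV" "\<And>s. Re s > 1 \<Longrightarrow> G s = nseries f 0 s"
proof -
  have "\<forall>j. \<exists>g. g holomorphic_on {s. Re s > 1 - real j} \<and> (\<forall>s. Re s > 1 \<longrightarrow> g s = nseries f 0 s)"
    using nseries_continuation[OF assms, of 0] by simp
  then obtain g where g: "\<And>j. g j holomorphic_on {s. Re s > 1 - real j}"
    "\<And>j s. Re s > 1 \<Longrightarrow> g j s = nseries f 0 s" by metis
  have agree: "g i s = g j s" if "i \<le> j" "Re s > 1 - real i" for i j s
  proof (rule analytic_continuation_open[of "{s. Re s > 1}" "{s. Re s > 1 - real i}" "g i" "g j"])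
    show "{s. Re s > 1} \<noteq> {}" by (auto intro: exI[of _ 2])
    show "connected {s. Re s > 1 - real i}" by (intro convex_connected convex_halfspace_Re_gt)
    show "g j holomorphic_on {s. Re s > 1 - real i}"
      using that by (intro holomorphic_on_subset[OF g(1)]) auto
  qed (use that g in \<open>auto intro: open_halfspace_Re_gt\<close>)
  \<comment> \<open>\<open>J s\<close> selects one half-plane that contains \<open>s\<close>; by
    agreement the choice is immaterial.\<close>
  define J where "J s = nat \<lceil>1 - Re s\<rceil> + 1" for s
  have J: "Re s > 1 - real (J s)" for s unfolding J_def by linarith
  define G where "G s = g (J s) s" for s
  have G: "G s = g j s" if "Re s > 1 - real j" for s j
  proof (cases "J s \<le> j")
    case True
    then show ?thesis unfolding G_def by (rule agree[OF _ J])
  next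
    case False
    then show ?thesis unfolding G_def by (intro agree[symmetric] that) simp
  qed
  show ?thesis
  proof (rule that)
    have "G holomorphic_on (\<Union>j\<in>UNIV. {s. Re s > 1 - real j})"
    proof (rule holomorphic_on_UN_open)
      fix j :: nat
      show "G holomorphic_on {s. Re s > 1 - real j}"
        by (rule holomorphic_transform[OF g(1)], rule G[symmetric]) simp
    qed (rule open_halfspace_Re_gt)
    moreover have "(\<Union>j\<in>UNIV. {s. Re s > 1 - real j}) = UNIV" using J by blast
    ultimately show "G holomorphic_on UNIV" by (simp only:)
    show "G s = nseries f 0 s" if "Re s > 1" for s
    proof -
      have "G s = g 0 s" using that by (intro G) simp
      then show ?thesis using g(2)[OF that] by (simp only:)
    qed
  qed
qed

text \<open>Resolves the definite description: uniqueness is the identity theorem on the punctured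
  plane, which is connected. The value of \<open>G\<close> at 1 is overwritten by the conventional
  0, hence the exclusion of \<open>s = 1\<close>.\<close>

lemma dirichlet_L_eq:
  assumes "G holomorphic_on UNIV" "\<And>s. Re s > 1 \<Longrightarrow> G s = dirichlet_series f s" "s \<noteq> 1"
  shows "dirichlet_L f s = G s"
proof -
  define H where "H s = (if s = 1 then 0 else G s)" for s
  have H: "H holomorphic_on - {1}"
  proof -
    have "G holomorphic_on - {1}" using assms(1) by (rule holomorphic_on_subset) auto
    then show ?thesis by (rule holomorphic_transform) (auto simp: H_def)
  qed
  have "dirichlet_L f = H"
    unfolding dirichlet_L_def
  proof (rule the_equality)
    show "H holomorphic_on - {1} \<and> H 1 = 0 \<and> (\<forall>s. 1 < Re s \<longrightarrow> H s = dirichlet_series f s)"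
      using H assms(2) by (auto simp: H_def)
    fix h assume h: "h holomorphic_on - {1} \<and> h 1 = 0 \<and> (\<forall>s. 1 < Re s \<longrightarrow> h s = dirichlet_series f s)"
    show "h = H"
    proof
      fix z
      show "h z = H z"
      proof (cases "z = 1")
        case False
        show ?thesis
        proof (rule analytic_continuation_open[of "{s. Re s > 1}" "- {1}" h H])
          show "{s. Re s > 1} \<noteq> {}" by (auto intro: exI[of _ 2])
          show "connected (- {1 :: complex})" by (rule connected_punctured_universe) simp
        qed (use h H False assms(2) in \<open>auto intro: open_halfspace_Re_gt simp: H_def\<close>)
      qed (use h in \<open>auto simp: H_def\<close>)
    qed
  qed
  then show ?thesis using assms(3) by (simp add: H_def)
qed

text \<open>The entire continuation only identifies the L-function abstractly. A single summation by
  parts gives a holomorphic function on \<open>Re s > 0\<close> that is the limit of the series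
  there, and the two agree because they agree for \<open>Re s > 1\<close>.\<close>

lemma dirichlet_L_half_sums:
  assumes "balanced N f"
  shows "(\<lambda>n. f (Suc n) / of_real (sqrt (real (Suc n)))) sums dirichlet_L f (1 / 2)"
proof -
  obtain G where G: "G holomorphic_on UNIV" "\<And>s. Re s > 1 \<Longrightarrow> G s = nseries f 0 s"
    using entire_continuation[OF assms] by blast
  have "nseries f 0 s = dirichlet_series f s" for s
    unfolding nseries_def dirichlet_series_def by (simp add: powr_minus_divide)
  then have L: "dirichlet_L f (1 / 2) = G (1 / 2)" using G by (intro dirichlet_L_eq) auto
  define F where "F s = pmean N f * ndiff 0 s 1 + nseries (centred_psum N f) (Suc 0) s" for s
  have F: "F holomorphic_on {s. Re s > 0}"
    unfolding F_def using nseries_holomorphic[OF balanced_centred_psum[OF assms], of "Suc 0"]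
    by (intro holomorphic_intros ndiff_holomorphic) auto
  have Fs: "(\<lambda>n. f (Suc n) * ndiff 0 s (of_nat (Suc n))) sums F s" if "Re s > 0" for s
    unfolding F_def using that by (intro nseries_step[OF assms]) auto
  have "G (1 / 2) = F (1 / 2)"
  proof (rule analytic_continuation_open[of "{s. Re s > 1}" "{s. Re s > 0}" G F])
    show "{s. Re s > 1} \<noteq> {}" by (auto intro: exI[of _ 2])
    show "connected {s. Re s > 0}" by (intro convex_connected convex_halfspace_Re_gt)
    fix z assume "z \<in> {s. Re s > 1}"
    then show "G z = F z" using Fs[of z] G(2)[of z] by (simp add: nseries_def sums_iff)
  qed (use F in \<open>auto intro: open_halfspace_Re_gt holomorphic_on_subset[OF G(1)]\<close>)
  moreover have "ndiff 0 (1 / 2) (of_nat (Suc n)) = 1 / of_real (sqrt (real (Suc n)))" for n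
  proof -
    have "ndiff 0 (1 / 2) (of_nat (Suc n)) = of_real (real (Suc n)) powr of_real (- (1 / 2))" by simp
    also have "\<dots> = of_real (real (Suc n) powr (- (1 / 2)))" by (rule powr_of_real) auto
    also have "real (Suc n) powr (- (1 / 2)) = 1 / sqrt (real (Suc n))"
      by (simp only: powr_minus_divide powr_half_sqrt of_nat_0_le_iff)
    finally show ?thesis by simp
  qed
  ultimately show ?thesis using Fs[of "1 / 2"] L by simp
qed

section \<open>Tails of residue class sums\<close>

text \<open>Dirichlet's test with the limit made explicit: the boundary term tends to 0 and the
  differenced weights telescope, which gives absolute convergence.\<close>

lemma abel_sums:
  fixes a :: "nat \<Rightarrow> complex" and w :: "nat \<Rightarrow> real"
  assumes B: "\<And>K. cmod (\<Sum>k=1..K. a k) \<le> B"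
    and dec: "\<And>k. w (Suc (Suc k)) \<le> w (Suc k)" and lim: "w \<longlonglongrightarrow> 0"
  shows "(\<lambda>n. a (Suc n) * of_real (w (Suc n))) sums
      (\<Sum>n. (\<Sum>k=1..Suc n. a k) * of_real (w (Suc n) - w (Suc (Suc n))))" (is ?A)
    and "summable (\<lambda>n. cmod (\<Sum>k=1..Suc n. a k) * (w (Suc n) - w (Suc (Suc n))))" (is ?B)
proof -
  define S where "S K = (\<Sum>k=1..K. a k)" for K
  have "B \<ge> 0" using B[of 0] by simp
  have tele: "(\<lambda>n. w (Suc n) - w (Suc (Suc n))) sums (w (Suc 0) - 0)"
    using telescope_sums'[OF LIMSEQ_Suc[OF lim]] by simp
  have sB: "summable (\<lambda>n. B * (w (Suc n) - w (Suc (Suc n))))"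
    using tele by (intro summable_mult) (rule sums_summable)
  have s: "summable (\<lambda>n. cmod (S (Suc n)) * (w (Suc n) - w (Suc (Suc n))))"
  proof (rule summable_comparison_test[OF _ sB], intro exI[of _ 0] allI impI)
    fix n
    have "cmod (S (Suc n)) * (w (Suc n) - w (Suc (Suc n))) \<le> B * (w (Suc n) - w (Suc (Suc n)))"
      using B[of "Suc n"] dec[of n] by (intro mult_right_mono) (auto simp: S_def)
    then show "norm (cmod (S (Suc n)) * (w (Suc n) - w (Suc (Suc n)))) \<le> B * (w (Suc n) - w (Suc (Suc n)))"
      using dec[of n] by (simp add: abs_mult)
  qed
  then show ?B by (simp only: S_def)
  have eq: "(\<Sum>n<M. a (Suc n) * of_real (w (Suc n))) =
     S M * of_real (w (Suc M)) + (\<Sum>n<M. S (Suc n) * of_real (w (Suc n) - w (Suc (Suc n))))" for M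
    by (induction M) (simp_all add: S_def algebra_simps)
  have "(\<lambda>M. S M * of_real (w (Suc M))) \<longlonglongrightarrow> 0"
  proof (rule Lim_null_comparison)
    show "\<forall>\<^sub>F M in sequentially. cmod (S M * of_real (w (Suc M))) \<le> B * \<bar>w (Suc M)\<bar>"
      using B \<open>B \<ge> 0\<close> by (auto simp: S_def norm_mult intro!: always_eventually mult_right_mono)
    have "(\<lambda>M. B * \<bar>w (Suc M)\<bar>) \<longlonglongrightarrow> B * \<bar>0\<bar>"
      by (intro tendsto_intros LIMSEQ_Suc lim)
    then show "(\<lambda>M. B * \<bar>w (Suc M)\<bar>) \<longlonglongrightarrow> 0" by simp
  qed
  moreover have "summable (\<lambda>n. S (Suc n) * of_real (w (Suc n) - w (Suc (Suc n))))"
  proof (rule summable_norm_cancel)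
    have "cmod (S (Suc n) * of_real (w (Suc n) - w (Suc (Suc n)))) = cmod (S (Suc n)) * (w (Suc n) - w (Suc (Suc n)))" for n
      using dec[of n] by (simp add: norm_mult del: of_real_diff)
    then show "summable (\<lambda>n. cmod (S (Suc n) * of_real (w (Suc n) - w (Suc (Suc n)))))" using s by simp
  qed
  ultimately have "(\<lambda>M. S M * of_real (w (Suc M)) + (\<Sum>n<M. S (Suc n) * of_real (w (Suc n) - w (Suc (Suc n)))))
     \<longlonglongrightarrow> 0 + (\<Sum>n. S (Suc n) * of_real (w (Suc n) - w (Suc (Suc n))))"
    by (intro tendsto_add) (auto dest: summable_sums simp: sums_def)
  then show ?A unfolding sums_def eq[symmetric] by (simp add: S_def)
qed

lemma abel_suminf_norm_le:
  fixes a :: "nat \<Rightarrow> complex" and w :: "nat \<Rightarrow> real"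
  assumes "\<And>K. cmod (\<Sum>k=1..K. a k) \<le> B"
    and "\<And>k. w (Suc (Suc k)) \<le> w (Suc k)" and "w \<longlonglongrightarrow> 0"
  shows "cmod (\<Sum>n. a (Suc n) * of_real (w (Suc n))) \<le>
     (\<Sum>n. cmod (\<Sum>k=1..Suc n. a k) * (w (Suc n) - w (Suc (Suc n))))"
proof -
  have eq: "cmod ((\<Sum>k=1..Suc n. a k) * of_real (w (Suc n) - w (Suc (Suc n)))) =
      cmod (\<Sum>k=1..Suc n. a k) * (w (Suc n) - w (Suc (Suc n)))" for n
    using assms(2)[of n] by (simp only: norm_mult norm_of_real abs_of_nonneg diff_ge_0_iff_ge)
  have "cmod (\<Sum>n. (\<Sum>k=1..Suc n. a k) * of_real (w (Suc n) - w (Suc (Suc n)))) \<le>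
     (\<Sum>n. cmod ((\<Sum>k=1..Suc n. a k) * of_real (w (Suc n) - w (Suc (Suc n)))))"
  proof (rule summable_norm)
    show "summable (\<lambda>n. cmod ((\<Sum>k=1..Suc n. a k) * of_real (w (Suc n) - w (Suc (Suc n)))))"
      unfolding eq by (rule abel_sums(2)[OF assms])
  qed
  then show ?thesis unfolding eq using abel_sums(1)[OF assms] by (simp only: sums_iff)
qed

text \<open>The two hypotheses bound the partial sums by \<open>min k J\<close>, which are the
  partial sums of the sequence equal to 1 up to \<open>J\<close> and 0 afterwards. Undoing the
  summation by parts for that sequence leaves the first \<open>J\<close> weights.\<close>

lemma abel_pointwise:
  fixes a :: "nat \<Rightarrow> complex" and w :: "nat \<Rightarrow> real"
  assumes B: "\<And>K. cmod (\<Sum>k=1..K. a k) \<le> real J" and K: "\<And>K. cmod (\<Sum>k=1..K. a k) \<le> real K"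
    and dec: "\<And>k. w (Suc (Suc k)) \<le> w (Suc k)" and lim: "w \<longlonglongrightarrow> 0" and pos: "\<And>k. w k \<ge> 0"
  shows "cmod (\<Sum>n. a (Suc n) * of_real (w (Suc n))) \<le> (\<Sum>k=1..J. w k)"
proof -
  have eq: "(\<Sum>n<M. real (min (Suc n) J) * (w (Suc n) - w (Suc (Suc n)))) =
      (\<Sum>k=1..min M J. w k) - real (min M J) * w (Suc M)" for M
  proof (induction M)
    case (Suc M)
    show ?case
    proof (cases "Suc M \<le> J")
      case True
      then show ?thesis using Suc by (simp add: min_def algebra_simps)
    next
      case False
      then have "min (Suc M) J = J" "min M J = J" by auto
      then show ?thesis using Suc by (simp add: algebra_simps)
    qed
  qed auto
  have "(\<Sum>n. cmod (\<Sum>k=1..Suc n. a k) * (w (Suc n) - w (Suc (Suc n)))) \<le> (\<Sum>k=1..J. w k)"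
  proof (rule suminf_le_const[OF abel_sums(2)[OF B dec lim]])
    fix M
    have "(\<Sum>n<M. cmod (\<Sum>k=1..Suc n. a k) * (w (Suc n) - w (Suc (Suc n)))) \<le>
        (\<Sum>n<M. real (min (Suc n) J) * (w (Suc n) - w (Suc (Suc n))))"
    proof (intro sum_mono mult_right_mono)
      fix n
      show "cmod (\<Sum>k=1..Suc n. a k) \<le> real (min (Suc n) J)"
        by (cases "Suc n \<le> J") (use B[of "Suc n"] K[of "Suc n"] in \<open>simp_all only: min_def if_True if_False\<close>)
      show "0 \<le> w (Suc n) - w (Suc (Suc n))" using dec[of n] by simp
    qed
    also have "\<dots> \<le> (\<Sum>k=1..min M J. w k)" unfolding eq using pos[of "Suc M"] by simp
    also have "\<dots> \<le> (\<Sum>k=1..J. w k)" using pos by (intro sum_mono2) auto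
    finally show "(\<Sum>n<M. cmod (\<Sum>k=1..Suc n. a k) * (w (Suc n) - w (Suc (Suc n)))) \<le> (\<Sum>k=1..J. w k)" .
  qed
  with abel_suminf_norm_le[OF B dec lim] show ?thesis by linarith
qed

lemma sum_inverse_sqrt_le: "(\<Sum>k=1..J. 1 / sqrt (real k)) \<le> 2 * sqrt (real J)"
proof (induction J)
  case (Suc J)
  define x y where "x = sqrt (real J)" and "y = sqrt (real (Suc J))"
  have xy: "0 \<le> x" "x < y" "y\<^sup>2 = x\<^sup>2 + 1" by (simp_all add: x_def y_def)
  have "2 * x + 1 / y \<le> 2 * y"
  proof -
    have "(y - x)\<^sup>2 \<ge> 0" by simp
    then have "2 * x * y + 1 \<le> 2 * y * y" using xy(3) by (simp add: power2_eq_square algebra_simps)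
    then have "(2 * x * y + 1) / y \<le> 2 * y" using xy by (simp add: divide_le_eq)
    then show ?thesis using xy by (simp add: add_divide_distrib)
  qed
  then show ?case using Suc by (simp add: x_def y_def)
qed auto

section \<open>The weights n^(-1/2) along a residue class\<close>

definition sqw :: "nat \<Rightarrow> nat \<Rightarrow> nat \<Rightarrow> real" where
  "sqw q b k = 1 / sqrt (real (b + k * q))"

lemma inverse_sqrt_antimono: "0 < m \<Longrightarrow> m \<le> n \<Longrightarrow> 1 / sqrt (real n) \<le> 1 / sqrt (real m)"
  by (intro frac_le) auto

lemma sqw_nonneg: "sqw q b k \<ge> 0"
  by (simp add: sqw_def)

lemma sqw_decreasing: "q > 0 \<Longrightarrow> sqw q b (Suc (Suc k)) \<le> sqw q b (Suc k)"
  unfolding sqw_def by (rule inverse_sqrt_antimono) auto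

lemma sqw_tendsto: assumes "q > 0" shows "sqw q b \<longlonglongrightarrow> 0"
proof -
  have "filterlim (\<lambda>k. b + k * q) at_top at_top"
  proof (rule filterlim_at_top_mono[OF filterlim_ident])
    have "k \<le> b + k * q" for k
    proof -
      have "k * 1 \<le> k * q" using assms by (intro mult_le_mono2) simp
      then show ?thesis by linarith
    qed
    then show "\<forall>\<^sub>F k in sequentially. k \<le> b + k * q" by (intro always_eventually allI)
  qed
  then have "filterlim (\<lambda>k. real (b + k * q)) at_top at_top"
    by (rule filterlim_compose[OF filterlim_real_sequentially])
  then have "filterlim (\<lambda>k. sqrt (real (b + k * q))) at_top at_top"
    by (rule filterlim_compose[OF sqrt_at_top])
  then have "((\<lambda>k. 1 / sqrt (real (b + k * q))) \<longlongrightarrow> 0) at_top"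
    by (rule tendsto_divide_0[OF tendsto_const filterlim_at_top_imp_at_infinity])
  then show ?thesis by (simp add: sqw_def[abs_def])
qed

lemma sqw_le: "q > 0 \<Longrightarrow> k > 0 \<Longrightarrow> sqw q b k \<le> 1 / sqrt (real q) * (1 / sqrt (real k))"
proof -
  assume "q > 0" "k > 0"
  then have "1 / sqrt (real (b + k * q)) \<le> 1 / sqrt (real (k * q))"
    by (intro inverse_sqrt_antimono) auto
  then show ?thesis by (simp add: sqw_def real_sqrt_mult mult.commute)
qed

text \<open>With \<open>x\<close> and \<open>y\<close> the two square roots, the difference is
  \<open>q / (x * y * (x + y))\<close>, and all three factors of the denominator are at least
  \<open>sqrt (k * q)\<close>.\<close>

lemma sqw_diff_le:
  assumes "q > 0" "k > 0"
  shows "sqw q b k - sqw q b (Suc k) \<le> 1 / (sqrt (real q) * real k * sqrt (real k))"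
proof -
  define x y where "x = sqrt (real (b + k * q))" and "y = sqrt (real (b + Suc k * q))"
  have "0 < real (b + k * q)" using assms by (simp only: of_nat_0_less_iff) simp
  then have x: "x > 0" "x \<le> y" by (simp_all add: x_def y_def)
  have y2: "y\<^sup>2 = x\<^sup>2 + real q" by (simp add: x_def y_def)
  have "sqrt (real k * real q) \<le> x" by (simp add: x_def)
  then have kx: "sqrt (real k) * sqrt (real q) \<le> x" by (simp add: real_sqrt_mult)
  have "1 / x - 1 / y = (y - x) / (x * y)" using x by (simp add: field_simps)
  also have "\<dots> = real q / (x * y * (x + y))"
  proof -
    have "(y - x) * (x + y) = real q" using y2 by (simp add: power2_eq_square algebra_simps)
    have "x + y \<noteq> 0" using x by linarith
    then have "(y - x) / (x * y) = (y - x) * (x + y) / (x * y * (x + y))" by simp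
    with \<open>(y - x) * (x + y) = real q\<close> show ?thesis by simp
  qed
  also have "\<dots> \<le> real q / ((sqrt (real k) * sqrt (real q)) * (sqrt (real k) * sqrt (real q)) * (sqrt (real k) * sqrt (real q)))"
  proof (intro divide_left_mono mult_mono mult_pos_pos)
    show "sqrt (real k) * sqrt (real q) \<le> x + y" using kx x by linarith
    show "sqrt (real k) * sqrt (real q) \<le> y" using kx x by linarith
  qed (use x kx assms in auto)
  also have "\<dots> = 1 / (sqrt (real q) * real k * sqrt (real k))"
  proof -
    have "(sqrt (real k) * sqrt (real q)) * (sqrt (real k) * sqrt (real q)) * (sqrt (real k) * sqrt (real q))
       = (sqrt (real k) * sqrt (real k)) * (sqrt (real q) * sqrt (real q)) * (sqrt (real k) * sqrt (real q))"
      by (simp only: mult_ac)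
    also have "\<dots> = real q * (sqrt (real q) * real k * sqrt (real k))"
      by (simp add: mult_ac)
    finally have e: "(sqrt (real k) * sqrt (real q)) * (sqrt (real k) * sqrt (real q)) * (sqrt (real k) * sqrt (real q))
       = real q * (sqrt (real q) * real k * sqrt (real k))" .
    show ?thesis unfolding e using assms by simp
  qed
  finally show ?thesis by (simp only: sqw_def x_def y_def)
qed

text \<open>If \<open>l dvd q\<close> then \<open>f\<close> is constant on residue classes modulo \<open>q\<close> and the class sums diverge. The subtracted
  multiple of \<open>f b\<close> makes them converge, and it disappears when \<open>chi b\<close> is summed against it with \<open>f chi\<close> nonprincipal.\<close>

definition eterm :: "(nat \<Rightarrow> complex) \<Rightarrow> nat \<Rightarrow> nat \<Rightarrow> nat \<Rightarrow> nat \<Rightarrow> complex" where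
  "eterm f l q b n = f (b + Suc n * q) * of_real (sqw q b (Suc n))
     - (if l dvd q then f b * of_real (sqw q 0 (Suc n)) else 0)"

definition etail :: "(nat \<Rightarrow> complex) \<Rightarrow> nat \<Rightarrow> nat \<Rightarrow> nat \<Rightarrow> complex" where
  "etail f l q b = (\<Sum>n. eterm f l q b n)"

definition loglen :: "nat \<Rightarrow> real" where
  "loglen l = 1 + ln (real l)"

lemma loglen_ge_1: "l > 0 \<Longrightarrow> loglen l \<ge> 1"
  by (simp add: loglen_def)

context
  fixes l q :: nat and f :: "nat \<Rightarrow> complex"
  assumes prim: "primitive_char l f" and q0: "q > 0"
begin

lemma char_l: "dirichlet_char l f"
  using prim by (simp add: primitive_char_def)

lemma l_pos: "l > 0"
  by (rule dirichlet_char_pos[OF char_l])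

lemma eterm_sums_ndvd:
  assumes ndvd: "\<not> l dvd q"
  shows "eterm f l q b sums etail f l q b"
    and "cmod (etail f l q b) \<le> (\<Sum>n. cmod (prog_sum f q (Suc n) b) * (sqw q b (Suc n) - sqw q b (Suc (Suc n))))"
    and "summable (\<lambda>n. cmod (prog_sum f q (Suc n) b) * (sqw q b (Suc n) - sqw q b (Suc (Suc n))))"
proof -
  have B: "cmod (\<Sum>k=1..K. f (b + k * q)) \<le> 2 * sqrt (real l) * (1 + ln (real l))" for K
    using polya_vinogradov[OF prim ndvd, of K b] by (simp add: prog_sum_def)
  have et: "eterm f l q b = (\<lambda>n. f (b + Suc n * q) * of_real (sqw q b (Suc n)))"
    using ndvd by (simp add: eterm_def fun_eq_iff)
  note facts = B sqw_decreasing[OF q0] sqw_tendsto[OF q0]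
  show "eterm f l q b sums etail f l q b"
    unfolding etail_def et by (rule summable_sums[OF sums_summable[OF abel_sums(1)[OF facts]]])
  show "cmod (etail f l q b) \<le> (\<Sum>n. cmod (prog_sum f q (Suc n) b) * (sqw q b (Suc n) - sqw q b (Suc (Suc n))))"
    unfolding etail_def et prog_sum_def by (rule abel_suminf_norm_le[OF facts])
  show "summable (\<lambda>n. cmod (prog_sum f q (Suc n) b) * (sqw q b (Suc n) - sqw q b (Suc (Suc n))))"
    unfolding prog_sum_def by (rule abel_sums(2)[OF facts])
qed

text \<open>The trivial bound on the progression sums is the better one up to about
  \<open>J = sqrt l * log l\<close> terms and Polya-Vinogradov afterwards. The first
  \<open>J\<close> weights add up to \<open>2 * sqrt (J / q)\<close>, whence the fourth root of
  \<open>l\<close>.\<close>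

lemma norm_etail_ndvd:
  assumes ndvd: "\<not> l dvd q"
  shows "cmod (etail f l q b) \<le> 4 * sqrt (sqrt (real l)) * loglen l / sqrt (real q)"
proof -
  define B where "B = 2 * sqrt (real l) * loglen l"
  define J where "J = nat \<lceil>B\<rceil>"
  have lam: "loglen l \<ge> 1" using l_pos by (rule loglen_ge_1)
  have sl: "sqrt (real l) \<ge> 1" using l_pos by simp
  have "1 * 1 \<le> sqrt (real l) * loglen l" using lam sl by (intro mult_mono) auto
  then have one: "1 \<le> sqrt (real l) * loglen l" by simp
  have J: "B \<le> real J" "real J \<le> B + 1" unfolding J_def using one by (auto simp: B_def)
  have "cmod (etail f l q b) = cmod (\<Sum>n. f (b + Suc n * q) * of_real (sqw q b (Suc n)))"
    using ndvd by (simp add: etail_def eterm_def)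
  also have "\<dots> \<le> (\<Sum>k=1..J. sqw q b k)"
  proof (rule abel_pointwise)
    fix K
    show "cmod (\<Sum>k=1..K. f (b + k * q)) \<le> real J"
      using polya_vinogradov[OF prim ndvd, of K b] J(1) by (simp add: prog_sum_def B_def loglen_def)
    show "cmod (\<Sum>k=1..K. f (b + k * q)) \<le> real K"
      using norm_prog_sum_le[OF char_l, of q K b] by (simp add: prog_sum_def)
  qed (use q0 in \<open>auto simp: sqw_nonneg sqw_decreasing sqw_tendsto\<close>)
  also have "\<dots> \<le> (\<Sum>k=1..J. 1 / sqrt (real q) * (1 / sqrt (real k)))"
    using q0 by (intro sum_mono sqw_le) auto
  also have "\<dots> = 1 / sqrt (real q) * (\<Sum>k=1..J. 1 / sqrt (real k))" by (rule sum_distrib_left[symmetric])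
  also have "\<dots> \<le> 1 / sqrt (real q) * (2 * sqrt (real J))"
    by (intro mult_left_mono sum_inverse_sqrt_le) auto
  also have "\<dots> \<le> 1 / sqrt (real q) * (2 * (2 * sqrt (sqrt (real l)) * loglen l))"
  proof (intro mult_left_mono)
    have "real J \<le> 4 * (sqrt (real l) * loglen l)" using J(2) one by (simp add: B_def)
    also have "\<dots> \<le> 4 * (sqrt (real l) * (loglen l * loglen l))"
      using lam by (intro mult_left_mono) auto
    also have "\<dots> = (2 * sqrt (sqrt (real l)) * loglen l)\<^sup>2"
      by (simp add: power_mult_distrib power2_eq_square[of "loglen l"])
    finally show "sqrt (real J) \<le> 2 * sqrt (sqrt (real l)) * loglen l"
      using lam by (intro real_le_lsqrt) auto
  qed auto
  finally show ?thesis by simp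
qed

text \<open>After summation by parts the weights decay like \<open>k^(-3/2)\<close>. Progressions of
  length up to \<open>l\<close> are averaged over the starting points; longer ones are covered by
  Polya-Vinogradov.\<close>

lemma etail_mean_square_ndvd:
  assumes ndvd: "\<not> l dvd q"
  shows "(\<Sum>b<q. (cmod (etail f l q b))\<^sup>2) \<le> 32 * (loglen l)\<^sup>2 * max 1 (sqrt (real l / real q))"
proof -
  define Y where "Y = max 1 (sqrt (real l / real q))"
  define c where "c b k = cmod (prog_sum f q k b)" for b k
  define d where "d b k = sqw q b k - sqw q b (Suc k)" for b k
  have lam: "loglen l \<ge> 1" using l_pos by (rule loglen_ge_1)
  have d0: "d b (Suc n) \<ge> 0" for b n using sqw_decreasing[OF q0, of b n] by (simp add: d_def)
  have pt: "(cmod (etail f l q b))\<^sup>2 \<le> 2 / real q * (loglen l * (\<Sum>k=1..l. (c b k)\<^sup>2 / (real k)\<^sup>2) + 4 * (loglen l)\<^sup>2)" for b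
  proof -
    define H where "H = (\<Sum>k=1..l. c b k / (real k * sqrt (real k)))"
    have s: "summable (\<lambda>n. c b (Suc n) * d b (Suc n))"
      using eterm_sums_ndvd(3)[OF ndvd, of b] by (simp add: c_def d_def)
    have "cmod (etail f l q b) \<le> (\<Sum>n. c b (Suc n) * d b (Suc n))"
      using eterm_sums_ndvd(2)[OF ndvd, of b] by (simp add: c_def d_def)
    \<comment> \<open>Cutting at \<open>l\<close> balances the far part: the telescoped weight
      \<open>1 / sqrt (q * l)\<close> cancels the factor \<open>sqrt l\<close> of
      Polya-Vinogradov.\<close>
    also have "\<dots> = (\<Sum>n. c b (Suc (n + l)) * d b (Suc (n + l))) + (\<Sum>n<l. c b (Suc n) * d b (Suc n))"
      by (rule suminf_split_initial_segment[OF s])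
    also have "(\<Sum>n<l. c b (Suc n) * d b (Suc n)) \<le> 1 / sqrt (real q) * H"
    proof -
      have "(\<Sum>n<l. c b (Suc n) * d b (Suc n)) = (\<Sum>k=1..l. c b k * d b k)"
        using sum.atLeast1_atMost_eq[of "\<lambda>k. c b k * d b k" l] by simp
      also have "\<dots> \<le> (\<Sum>k=1..l. c b k * (1 / (sqrt (real q) * real k * sqrt (real k))))"
        unfolding d_def using q0 by (intro sum_mono mult_left_mono sqw_diff_le) (auto simp: c_def)
      also have "\<dots> = 1 / sqrt (real q) * H"
        by (simp add: H_def sum_distrib_left mult_ac)
      finally show ?thesis .
    qed
    also have "(\<Sum>n. c b (Suc (n + l)) * d b (Suc (n + l))) \<le> 1 / sqrt (real q) * (2 * loglen l)"
    proof -
      define B where "B = 2 * sqrt (real l) * loglen l"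
      have tele: "(\<lambda>n. B * d b (Suc (n + l))) sums (B * (sqw q b (Suc l) - 0))"
      proof (rule sums_mult)
        have "(\<lambda>n. sqw q b (n + Suc l)) \<longlonglongrightarrow> 0" by (rule LIMSEQ_ignore_initial_segment[OF sqw_tendsto[OF q0]])
        from telescope_sums'[OF this] show "(\<lambda>n. d b (Suc (n + l))) sums (sqw q b (Suc l) - 0)"
          by (simp add: d_def)
      qed
      have "(\<Sum>n. c b (Suc (n + l)) * d b (Suc (n + l))) \<le> (\<Sum>n. B * d b (Suc (n + l)))"
      proof (rule suminf_le)
        fix n
        have "c b (Suc (n + l)) \<le> B"
          using polya_vinogradov[OF prim ndvd] by (simp add: c_def B_def loglen_def)
        then show "c b (Suc (n + l)) * d b (Suc (n + l)) \<le> B * d b (Suc (n + l))"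
          using d0 by (intro mult_right_mono)
      next
        show "summable (\<lambda>n. c b (Suc (n + l)) * d b (Suc (n + l)))"
          using summable_ignore_initial_segment[OF s, of l] by simp
      qed (rule sums_summable[OF tele])
      also have "\<dots> = B * sqw q b (Suc l)" using tele by (simp add: sums_iff)
      also have "\<dots> \<le> B * (1 / sqrt (real q) * (1 / sqrt (real (Suc l))))"
        using q0 lam by (intro mult_left_mono sqw_le) (auto simp: B_def)
      also have "\<dots> \<le> B * (1 / sqrt (real q) * (1 / sqrt (real l)))"
        using l_pos lam by (intro mult_left_mono divide_left_mono mult_pos_pos) (auto simp: B_def)
      also have "\<dots> = 1 / sqrt (real q) * (2 * loglen l)"
        using l_pos by (simp add: B_def)
      finally show ?thesis .
    qed
    finally have 1: "cmod (etail f l q b) \<le> 1 / sqrt (real q) * (H + 2 * loglen l)"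
      by (simp add: algebra_simps)
    have "(cmod (etail f l q b))\<^sup>2 \<le> (1 / sqrt (real q) * (H + 2 * loglen l))\<^sup>2"
      by (intro power_mono 1) auto
    also have "\<dots> = 1 / real q * (H + 2 * loglen l)\<^sup>2" by (simp add: power_mult_distrib power_divide)
    also have "\<dots> \<le> 1 / real q * (2 * (H\<^sup>2 + 4 * (loglen l)\<^sup>2))"
      using sum_squares_bound[of H "2 * loglen l"]
      by (intro mult_left_mono) (auto simp: power2_sum power_mult_distrib)
    also have "\<dots> = 2 / real q * (H\<^sup>2 + 4 * (loglen l)\<^sup>2)" by simp
    also have "\<dots> \<le> 2 / real q * (loglen l * (\<Sum>k=1..l. (c b k)\<^sup>2 / (real k)\<^sup>2) + 4 * (loglen l)\<^sup>2)"
    proof (intro mult_left_mono add_right_mono)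
      \<comment> \<open>Splitting \<open>k^(-3/2)\<close> as \<open>k^(-1/2)\<close> times
        \<open>1/k\<close> makes the first Cauchy-Schwarz factor harmonic; in the second,
        \<open>1/k^2\<close> meets a mean square of size \<open>k\<close> and leaves another
        harmonic sum.\<close>
      have "H = (\<Sum>k=1..l. (1 / sqrt (real k)) * (c b k / real k))"
        by (simp add: H_def mult_ac)
      then have "H\<^sup>2 \<le> (\<Sum>k=1..l. (1 / sqrt (real k))\<^sup>2) * (\<Sum>k=1..l. (c b k / real k)\<^sup>2)"
        by (simp only: Cauchy_Schwarz_ineq_sum)
      also have "(\<Sum>k=1..l. (1 / sqrt (real k))\<^sup>2) = (\<Sum>k=1..l. 1 / real k)"
        by (simp add: power_divide)
      also have "(\<Sum>k=1..l. 1 / real k) * (\<Sum>k=1..l. (c b k / real k)\<^sup>2) \<le> loglen l * (\<Sum>k=1..l. (c b k / real k)\<^sup>2)"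
        unfolding loglen_def using l_pos by (intro mult_right_mono sum_inverse_le_ln sum_nonneg) auto
      finally show "H\<^sup>2 \<le> loglen l * (\<Sum>k=1..l. (c b k)\<^sup>2 / (real k)\<^sup>2)"
        by (simp add: power_divide)
    qed auto
    finally show ?thesis .
  qed
  have "(\<Sum>b<q. (cmod (etail f l q b))\<^sup>2) \<le>
      (\<Sum>b<q. 2 / real q * (loglen l * (\<Sum>k=1..l. (c b k)\<^sup>2 / (real k)\<^sup>2) + 4 * (loglen l)\<^sup>2))"
    by (intro sum_mono pt)
  also have "\<dots> = 2 / real q * (loglen l * (\<Sum>b<q. \<Sum>k=1..l. (c b k)\<^sup>2 / (real k)\<^sup>2) + real q * (4 * (loglen l)\<^sup>2))"
    by (simp only: sum_distrib_left[symmetric] sum.distrib) (simp add: sum_distrib_left[symmetric])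
  also have "(\<Sum>b<q. \<Sum>k=1..l. (c b k)\<^sup>2 / (real k)\<^sup>2) = (\<Sum>k=1..l. (\<Sum>b<q. (c b k)\<^sup>2) / (real k)\<^sup>2)"
    by (subst sum.swap) (simp add: sum_divide_distrib)
  also have "2 / real q * (loglen l * \<dots> + real q * (4 * (loglen l)\<^sup>2)) \<le>
      2 / real q * (loglen l * (12 * real q * Y * loglen l) + real q * (4 * (loglen l)\<^sup>2))"
  proof (intro mult_left_mono add_right_mono)
    have "(\<Sum>k=1..l. (\<Sum>b<q. (c b k)\<^sup>2) / (real k)\<^sup>2) \<le> (\<Sum>k=1..l. 12 * real q * Y * (1 / real k))"
    proof (intro sum_mono)
      fix k assume k: "k \<in> {1..l}"
      have "(\<Sum>b<q. (c b k)\<^sup>2) / (real k)\<^sup>2 \<le> (12 * real q * real k * Y) / (real k)\<^sup>2"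
        unfolding c_def Y_def by (intro divide_right_mono prog_sum_interval_mean_square[OF prim ndvd]) auto
      also have "\<dots> = 12 * real q * Y * (1 / real k)" using k by (simp add: power2_eq_square)
      finally show "(\<Sum>b<q. (c b k)\<^sup>2) / (real k)\<^sup>2 \<le> 12 * real q * Y * (1 / real k)" .
    qed
    also have "\<dots> = 12 * real q * Y * (\<Sum>k=1..l. 1 / real k)" by (rule sum_distrib_left[symmetric])
    also have "\<dots> \<le> 12 * real q * Y * loglen l"
      unfolding loglen_def using l_pos by (intro mult_left_mono sum_inverse_le_ln) (auto simp: Y_def)
    finally show "(\<Sum>k=1..l. (\<Sum>b<q. (c b k)\<^sup>2) / (real k)\<^sup>2) \<le> 12 * real q * Y * loglen l" .
  qed (use lam in auto)
  also have "\<dots> = (24 * Y + 8) * (loglen l)\<^sup>2" using q0 by (simp add: field_simps power2_eq_square)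
  also have "\<dots> \<le> (32 * Y) * (loglen l)\<^sup>2" by (intro mult_right_mono) (auto simp: Y_def)
  finally show ?thesis by (simp add: Y_def mult_ac)
qed

text \<open>Now \<open>f\<close> is constant on the class, so a regularised term is
  \<open>f b\<close> times \<open>sqw q b - sqw q 0\<close>. As \<open>b < q\<close>, the point
  \<open>b + k q\<close> lies between \<open>k q\<close> and \<open>(k + 1) q\<close>, and the
  differences are dominated by a telescoping series.\<close>

lemma eterm_sums_dvd:
  assumes dvd: "l dvd q" and "b < q"
  shows "eterm f l q b sums etail f l q b" and "cmod (etail f l q b) \<le> 1 / sqrt (real q)"
proof -
  have fb: "f (b + k * q) = f b" for k
  proof (rule dirichlet_char_cong[OF char_l])
    obtain m where "q = l * m" using dvd by (rule dvdE)
    then show "[b + k * q = b] (mod l)" by (simp add: cong_def mult.left_commute[of k l])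
  qed
  define D where "D n = sqw q 0 (Suc n) - sqw q 0 (Suc (Suc n))" for n
  have D: "D sums (1 / sqrt (real q))"
    using telescope_sums'[OF LIMSEQ_Suc[OF sqw_tendsto[OF q0, of 0]]] by (simp add: D_def[abs_def] sqw_def)
  have le: "cmod (eterm f l q b n) \<le> D n" for n
  proof -
    have "eterm f l q b n = f b * of_real (sqw q b (Suc n) - sqw q 0 (Suc n))"
      using dvd by (simp add: eterm_def fb right_diff_distrib del: mult_Suc)
    then have "cmod (eterm f l q b n) = cmod (f b) * \<bar>sqw q b (Suc n) - sqw q 0 (Suc n)\<bar>"
      by (simp only: norm_mult norm_of_real)
    also have "\<dots> \<le> 1 * \<bar>sqw q b (Suc n) - sqw q 0 (Suc n)\<bar>"
      by (intro mult_right_mono norm_dirichlet_char_le[OF char_l]) auto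
    also have "\<dots> = sqw q 0 (Suc n) - sqw q b (Suc n)"
    proof -
      have "sqw q b (Suc n) \<le> sqw q 0 (Suc n)"
        unfolding sqw_def using q0 by (intro inverse_sqrt_antimono) auto
      then show ?thesis by simp
    qed
    also have "\<dots> \<le> D n"
    proof -
      have "sqw q 0 (Suc (Suc n)) \<le> sqw q b (Suc n)"
        unfolding sqw_def using q0 assms(2) by (intro inverse_sqrt_antimono) auto
      then show ?thesis by (simp add: D_def)
    qed
    finally show ?thesis .
  qed
  have s: "summable (\<lambda>n. cmod (eterm f l q b n))"
    by (rule summable_comparison_test[OF _ sums_summable[OF D]]) (use le in auto)
  then show "eterm f l q b sums etail f l q b"
    unfolding etail_def by (rule summable_sums[OF summable_norm_cancel])
  have "cmod (etail f l q b) \<le> (\<Sum>n. cmod (eterm f l q b n))"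
    unfolding etail_def by (rule summable_norm[OF s])
  also have "\<dots> \<le> (\<Sum>n. D n)" using le by (intro suminf_le s sums_summable[OF D])
  also have "\<dots> = 1 / sqrt (real q)" using D by (simp add: sums_iff)
  finally show "cmod (etail f l q b) \<le> 1 / sqrt (real q)" .
qed

lemma eterm_sums: "b < q \<Longrightarrow> eterm f l q b sums etail f l q b"
  using eterm_sums_ndvd(1) eterm_sums_dvd(1) by blast

lemma norm_etail_le: "b < q \<Longrightarrow> cmod (etail f l q b) \<le> 4 * sqrt (sqrt (real l)) * loglen l / sqrt (real q)"
proof (cases "l dvd q")
  case True
  assume "b < q"
  have "sqrt (sqrt (real l)) \<ge> 1" using l_pos by simp
  then have "1 \<le> 4 * sqrt (sqrt (real l))" by linarith
  then have "1 * 1 \<le> (4 * sqrt (sqrt (real l))) * loglen l"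
    using loglen_ge_1[OF l_pos] by (intro mult_mono) simp_all
  then have "1 / sqrt (real q) \<le> 4 * sqrt (sqrt (real l)) * loglen l / sqrt (real q)"
    by (intro divide_right_mono) auto
  then show ?thesis using eterm_sums_dvd(2)[OF True \<open>b < q\<close>] by linarith
qed (rule norm_etail_ndvd)

lemma etail_mean_square: "(\<Sum>b<q. (cmod (etail f l q b))\<^sup>2) \<le> 32 * (loglen l)\<^sup>2 * max 1 (sqrt (real l / real q))"
proof (cases "l dvd q")
  case True
  have "(\<Sum>b<q. (cmod (etail f l q b))\<^sup>2) \<le> (\<Sum>b<q. (1 / sqrt (real q))\<^sup>2)"
    by (intro sum_mono power_mono eterm_sums_dvd(2)[OF True]) auto
  also have "\<dots> = 1" using q0 by (simp add: power_divide)
  also have "\<dots> \<le> 32 * (loglen l)\<^sup>2 * max 1 (sqrt (real l / real q))"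
  proof -
    have "1 * 1 * 1 \<le> 32 * (loglen l)\<^sup>2 * max 1 (sqrt (real l / real q))"
      using loglen_ge_1[OF l_pos] by (intro mult_mono one_le_power) auto
    then show ?thesis by simp
  qed
  finally show ?thesis .
qed (rule etail_mean_square_ndvd)

end

section \<open>Twisted L-values as character sums of class sums\<close>

lemma primitive_char_nonprincipal:
  assumes "primitive_char n f" "n > 1"
  obtains a where "coprime a n" "f a \<noteq> 1"
  using assms that unfolding primitive_char_def by (metis one_dvd)

lemma balanced_dirichlet_char:
  assumes "dirichlet_char n f" "coprime a n" "f a \<noteq> 1"
  shows "balanced n f"
  using assms sum_dirichlet_char_eq_0[OF assms]
  unfolding balanced_def dirichlet_char_def by blast

text \<open>A proper divisor of \<open>l * q\<close> splits into divisors of \<open>l\<close> and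
  \<open>q\<close>, at least one of them proper. A primitivity witness at that component, joined
  with 1 at the other by the Chinese remainder theorem, is a witness for the product.\<close>

lemma primitive_char_mult:
  assumes f: "primitive_char l f" and g: "primitive_char q g" and cop: "coprime l q"
  shows "primitive_char (l * q) (\<lambda>n. f n * g n)"
proof -
  have cf: "dirichlet_char l f" and cg: "dirichlet_char q g"
    using f g by (simp_all add: primitive_char_def)
  have main: "\<exists>a. coprime a (l * q) \<and> [a = 1] (mod d) \<and> f a * g a \<noteq> 1"
    if dvd: "d dvd l * q" and less: "d < l * q" for d
  proof -
    obtain d1 d2 where d: "d = d1 * d2" "d1 dvd l" "d2 dvd q"
      using division_decomp[OF dvd] by blast
    have cop12: "coprime d1 d2" using d cop by (meson coprime_divisors)
    have le: "d1 \<le> l" "d2 \<le> q" using d dirichlet_char_pos[OF cf] dirichlet_char_pos[OF cg]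
      by (auto intro: dvd_imp_le)
    have "\<exists>u v. coprime u l \<and> [u = 1] (mod d1) \<and> coprime v q \<and> [v = 1] (mod d2) \<and> f u * g v \<noteq> 1"
    proof (cases "d1 < l")
      case True
      then obtain u where "coprime u l" "[u = 1] (mod d1)" "f u \<noteq> 1"
        using f d unfolding primitive_char_def by blast
      then show ?thesis using dirichlet_char_1[OF cg]
        by (intro exI[of _ u] exI[of _ 1]) auto
    next
      case False
      then have "d2 < q" using le less d(1) by (metis le_neq_implies_less less_irrefl)
      then obtain v where "coprime v q" "[v = 1] (mod d2)" "g v \<noteq> 1"
        using g d unfolding primitive_char_def by blast
      then show ?thesis using dirichlet_char_1[OF cf]
        by (intro exI[of _ 1] exI[of _ v]) auto
    qed
    then obtain u v where uv: "coprime u l" "[u = 1] (mod d1)" "coprime v q" "[v = 1] (mod d2)" "f u * g v \<noteq> 1"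
      by blast
    obtain a where a: "[a = u] (mod l)" "[a = v] (mod q)"
      using binary_chinese_remainder_nat[OF cop] by blast
    have "[a = 1] (mod d1)" using a(1) d(2) uv(2) by (meson cong_dvd_modulus_nat cong_trans)
    moreover have "[a = 1] (mod d2)" using a(2) d(3) uv(4) by (meson cong_dvd_modulus_nat cong_trans)
    ultimately have "[a = 1] (mod d)" unfolding d(1) using cop12 by (rule coprime_cong_mult_nat)
    moreover have "coprime a l" "coprime a q" using a uv by (meson cong_imp_coprime cong_sym)+
    then have "coprime a (l * q)" by simp
    moreover have "f a * g a \<noteq> 1"
      using dirichlet_char_cong[OF cf a(1)] dirichlet_char_cong[OF cg a(2)] uv(5) by simp
    ultimately show ?thesis by blast
  qed
  then show ?thesis unfolding primitive_char_def
    using dirichlet_char_prod[OF cf cg] by blast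
qed

text \<open>Modulus 1 and class 0 turn the tail into the whole L-series, so the convexity bound is
  an instance of the pointwise tail bound.\<close>

lemma norm_dirichlet_L_half_le:
  assumes "primitive_char N h" "N > 1"
  shows "cmod (dirichlet_L h (1 / 2)) \<le> 4 * sqrt (sqrt (real N)) * loglen N"
proof -
  have c: "dirichlet_char N h" using assms by (simp add: primitive_char_def)
  obtain a where "coprime a N" "h a \<noteq> 1" using primitive_char_nonprincipal[OF assms] .
  then have bal: "balanced N h" using c by (intro balanced_dirichlet_char)
  have nd: "\<not> N dvd 1" using assms(2) by simp
  have "eterm h N 1 0 = (\<lambda>n. h (Suc n) / of_real (sqrt (real (Suc n))))"
    using nd by (auto simp: eterm_def sqw_def fun_eq_iff)
  then have "dirichlet_L h (1 / 2) = etail h N 1 0"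
    using dirichlet_L_half_sums[OF bal] eterm_sums_ndvd(1)[OF assms(1) _ nd, of 0]
    by (simp only: sums_iff zero_less_one)
  then show ?thesis using norm_etail_ndvd[OF assms(1) _ nd, of 0] by simp
qed

text \<open>This is \<open>F\<^sub>i(b)\<close> of the overview, regularised when
  \<open>l dvd q\<close>. At \<open>b = 0\<close> the first summand is 0 because
  \<open>1 / sqrt 0 = 0\<close>.\<close>

definition class_sum :: "(nat \<Rightarrow> complex) \<Rightarrow> nat \<Rightarrow> nat \<Rightarrow> nat \<Rightarrow> complex" where
  "class_sum f l q b = f b * of_real (1 / sqrt (real b)) + etail f l q b"

text \<open>The conditionally convergent L-series is read along the cut-offs at multiples of
  \<open>q\<close>, where a partial sum is a finite array of classes and blocks and may be
  rearranged. The regularising terms cancel in each block by \<open>reg\<close>.\<close>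

lemma sum_char_class_sum:
  assumes prim: "primitive_char l f" and chi: "dirichlet_char q chi" and q: "q > 1"
    and bal: "balanced (l * q) (\<lambda>n. f n * chi n)"
    and reg: "l dvd q \<Longrightarrow> (\<Sum>b<q. f b * chi b) = 0"
  shows "(\<Sum>b<q. chi b * class_sum f l q b) = dirichlet_L (\<lambda>n. f n * chi n) (1 / 2)"
proof -
  define h where "h n = f n * chi n" for n
  define r where "r n = h n * of_real (1 / sqrt (real n))" for n
  define L where "L = dirichlet_L (\<lambda>n. f n * chi n) (1 / 2)"
  have "(\<lambda>n. h (Suc n) / of_real (sqrt (real (Suc n)))) sums L"
    unfolding L_def h_def by (rule dirichlet_L_half_sums[OF bal])
  then have "(\<lambda>n. r (Suc n)) sums L" by (simp add: r_def)
  \<comment> \<open>Adding the index 0 is free: division by zero gives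
    \<open>r 0 = 0\<close>.\<close>
  then have "r sums (L + r 0)" by (simp only: sums_Suc_iff)
  then have "r sums L" by (simp add: r_def)
  then have "(\<lambda>M. \<Sum>n<M. r n) \<longlonglongrightarrow> L" by (simp add: sums_def)
  moreover have "filterlim (\<lambda>K. Suc K * q) at_top sequentially"
  proof (rule filterlim_at_top_mono[OF filterlim_ident])
    have "K \<le> Suc K * q" for K
    proof -
      have "Suc K * 1 \<le> Suc K * q" using q by (intro mult_le_mono2) simp
      then have "Suc K \<le> Suc K * q" by (simp only: mult_1_right)
      then show ?thesis by (rule Suc_leD)
    qed
    then show "\<forall>\<^sub>F K in sequentially. K \<le> Suc K * q" by (intro always_eventually allI)
  qed
  ultimately have lim1: "(\<lambda>K. \<Sum>n<Suc K * q. r n) \<longlonglongrightarrow> L"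
    by (rule filterlim_compose)
  have chip: "chi (b + k * q) = chi b" for b k
    by (rule dirichlet_char_cong[OF chi]) (simp add: cong_def)
  have "(\<Sum>n<Suc K * q. r n) = (\<Sum>b<q. chi b * (f b * of_real (1 / sqrt (real b)) + (\<Sum>k<K. eterm f l q b k)))" for K
  proof -
    have rk: "r (b + Suc k * q) = chi b * eterm f l q b k +
        (if l dvd q then f b * chi b * of_real (sqw q 0 (Suc k)) else 0)" for b k
      unfolding r_def h_def chip eterm_def sqw_def by (simp add: algebra_simps)
    have "(\<Sum>b<q. if l dvd q then f b * chi b * of_real (sqw q 0 (Suc k)) else 0) = 0" for k
      using reg by (cases "l dvd q") (simp_all add: sum_distrib_right[symmetric])
    then have blk: "(\<Sum>b<q. r (b + Suc k * q)) = (\<Sum>b<q. chi b * eterm f l q b k)" for k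
      unfolding rk sum.distrib by simp
    have "(\<Sum>n<Suc K * q. r n) = (\<Sum>k<Suc K. \<Sum>b<q. r (b + k * q))" by (rule sum_mult_product)
    also have "\<dots> = (\<Sum>b<q. r b) + (\<Sum>k<K. \<Sum>b<q. r (b + Suc k * q))"
      by (subst sum.lessThan_Suc_shift) simp
    also have "(\<Sum>k<K. \<Sum>b<q. r (b + Suc k * q)) = (\<Sum>b<q. chi b * (\<Sum>k<K. eterm f l q b k))"
      unfolding blk sum_distrib_left by (rule sum.swap)
    also have "(\<Sum>b<q. r b) + \<dots> = (\<Sum>b<q. chi b * (f b * of_real (1 / sqrt (real b)) + (\<Sum>k<K. eterm f l q b k)))"
      by (simp add: sum.distrib r_def h_def distrib_left mult_ac)
    finally show ?thesis .
  qed
  moreover have "(\<lambda>K. \<Sum>b<q. chi b * (f b * of_real (1 / sqrt (real b)) + (\<Sum>k<K. eterm f l q b k)))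
      \<longlonglongrightarrow> (\<Sum>b<q. chi b * class_sum f l q b)"
    unfolding class_sum_def using eterm_sums[OF prim] q
    by (intro tendsto_intros) (auto simp: sums_def)
  ultimately have "(\<lambda>K. \<Sum>n<Suc K * q. r n) \<longlonglongrightarrow> (\<Sum>b<q. chi b * class_sum f l q b)" by simp
  with lim1 show ?thesis unfolding L_def using LIMSEQ_unique by blast
qed

lemma sum_lessThan_le_atLeastAtMost:
  fixes g :: "nat \<Rightarrow> real"
  assumes "g 0 = 0" "\<And>k. g k \<ge> 0"
  shows "(\<Sum>b<q. g b) \<le> (\<Sum>b=1..q. g b)"
proof -
  have "(\<Sum>b<q. g b) = (\<Sum>b\<in>{..<q} - {0}. g b)"
    using assms(1) by (intro sum.mono_neutral_right) auto
  also have "\<dots> \<le> (\<Sum>b=1..q. g b)" using assms(2) by (intro sum_mono2) auto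
  finally show ?thesis .
qed

text \<open>Bounds every twist, with no condition on the character; it serves to estimate the
  discarded characters.\<close>

lemma sum_norm_class_sum_le:
  assumes prim: "primitive_char l f" and q: "q > 0"
  shows "(\<Sum>b<q. cmod (class_sum f l q b)) \<le> 6 * sqrt (real q) * (sqrt (sqrt (real l)) * loglen l)"
proof -
  have c: "dirichlet_char l f" using prim by (simp add: primitive_char_def)
  have l: "l > 0" by (rule dirichlet_char_pos[OF c])
  define D where "D = sqrt (sqrt (real l)) * loglen l"
  have "1 * 1 \<le> D" unfolding D_def using l loglen_ge_1[OF l] by (intro mult_mono) auto
  then have D: "1 \<le> D" by simp
  have "(\<Sum>b<q. cmod (class_sum f l q b)) \<le> (\<Sum>b<q. 1 / sqrt (real b) + 4 * D / sqrt (real q))"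
  proof (intro sum_mono)
    fix b assume "b \<in> {..<q}"
    have "cmod (class_sum f l q b) \<le> cmod (f b) * (1 / sqrt (real b)) + cmod (etail f l q b)"
      unfolding class_sum_def by (rule order_trans[OF norm_triangle_ineq]) (simp add: norm_mult norm_divide)
    also have "\<dots> \<le> 1 * (1 / sqrt (real b)) + 4 * D / sqrt (real q)"
      using norm_etail_le[OF prim q, of b] \<open>b \<in> {..<q}\<close>
      by (intro add_mono mult_right_mono norm_dirichlet_char_le[OF c]) (auto simp: D_def mult_ac)
    finally show "cmod (class_sum f l q b) \<le> 1 / sqrt (real b) + 4 * D / sqrt (real q)" by simp
  qed
  also have "\<dots> = (\<Sum>b<q. 1 / sqrt (real b)) + real q * (4 * D / sqrt (real q))"
    by (simp add: sum.distrib)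
  also have "(\<Sum>b<q. 1 / sqrt (real b)) \<le> (\<Sum>b=1..q. 1 / sqrt (real b))"
    by (rule sum_lessThan_le_atLeastAtMost) simp_all
  also have "\<dots> \<le> 2 * sqrt (real q)" by (rule sum_inverse_sqrt_le)
  also have "real q * (4 * D / sqrt (real q)) = 4 * (D * sqrt (real q))"
    using q real_div_sqrt[of "real q"] by (simp add: field_simps)
  also have "2 * sqrt (real q) \<le> 2 * (D * sqrt (real q))"
    using mult_right_mono[OF D, of "sqrt (real q)"] by simp
  finally show ?thesis by (simp add: D_def mult_ac)
qed

lemma sum_norm_sq_class_sum_le:
  assumes prim: "primitive_char l f" and q: "q > 0"
    and Lam: "loglen l \<le> Lam" "loglen q \<le> Lam"
  shows "(\<Sum>b<q. (cmod (class_sum f l q b))\<^sup>2) \<le> 66 * Lam\<^sup>2 * max 1 (sqrt (real l / real q))"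
proof -
  have c: "dirichlet_char l f" using prim by (simp add: primitive_char_def)
  have l: "l > 0" by (rule dirichlet_char_pos[OF c])
  define Y where "Y = max 1 (sqrt (real l / real q))"
  have Lam1: "Lam \<ge> 1" using loglen_ge_1[OF q] Lam by linarith
  have "(\<Sum>b<q. (cmod (class_sum f l q b))\<^sup>2) \<le> (\<Sum>b<q. 2 * (1 / real b) + 2 * (cmod (etail f l q b))\<^sup>2)"
  proof (intro sum_mono)
    fix b
    have "cmod (class_sum f l q b) \<le> cmod (f b) * (1 / sqrt (real b)) + cmod (etail f l q b)"
      unfolding class_sum_def by (rule order_trans[OF norm_triangle_ineq]) (simp add: norm_mult norm_divide)
    also have "\<dots> \<le> 1 * (1 / sqrt (real b)) + cmod (etail f l q b)"
      by (intro add_right_mono mult_right_mono norm_dirichlet_char_le[OF c]) auto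
    finally have "(cmod (class_sum f l q b))\<^sup>2 \<le> (1 / sqrt (real b) + cmod (etail f l q b))\<^sup>2"
      by (intro power_mono) auto
    also have "\<dots> \<le> 2 * (1 / sqrt (real b))\<^sup>2 + 2 * (cmod (etail f l q b))\<^sup>2"
      using sum_squares_bound[of "1 / sqrt (real b)" "cmod (etail f l q b)"]
      by (simp only: power2_sum)
    also have "(1 / sqrt (real b))\<^sup>2 = 1 / real b" by (simp add: power_divide)
    finally show "(cmod (class_sum f l q b))\<^sup>2 \<le> 2 * (1 / real b) + 2 * (cmod (etail f l q b))\<^sup>2" .
  qed
  also have "\<dots> = 2 * (\<Sum>b<q. 1 / real b) + 2 * (\<Sum>b<q. (cmod (etail f l q b))\<^sup>2)"
    by (simp only: sum.distrib sum_distrib_left)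
  also have "(\<Sum>b<q. 1 / real b) \<le> (\<Sum>b=1..q. 1 / real b)"
    by (rule sum_lessThan_le_atLeastAtMost) simp_all
  also have "\<dots> \<le> loglen q" unfolding loglen_def by (rule sum_inverse_le_ln[OF q])
  also have "(\<Sum>b<q. (cmod (etail f l q b))\<^sup>2) \<le> 32 * (loglen l)\<^sup>2 * Y"
    unfolding Y_def by (rule etail_mean_square[OF prim q])
  also have "loglen q \<le> Lam\<^sup>2 * Y"
  proof -
    have "loglen q * 1 * 1 \<le> Lam * Lam * Y" using Lam Lam1 by (intro mult_mono) (auto simp: Y_def)
    then show ?thesis by (simp add: power2_eq_square)
  qed
  also have "32 * (loglen l)\<^sup>2 * Y \<le> 32 * Lam\<^sup>2 * Y"
    using Lam loglen_ge_1[OF l] by (intro mult_right_mono mult_left_mono power_mono) (auto simp: Y_def)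
  \<comment> \<open>The constant is 66 = 2 + 2 * 32.\<close>
  finally show ?thesis by (simp add: Y_def)
qed

section \<open>The character group modulo a prime\<close>

lemma primitive_char_prime:
  assumes "prime q" "dirichlet_char q chi" "coprime a q" "chi a \<noteq> 1"
  shows "primitive_char q chi"
  unfolding primitive_char_def
proof (intro conjI allI impI assms(2) notI)
  fix d assume d: "d dvd q \<and> d < q" and *: "\<forall>a. coprime a q \<and> [a = 1] (mod d) \<longrightarrow> chi a = 1"
  then have "d = 1" using assms(1) by (metis less_irrefl prime_nat_iff)
  then show False using * assms(3,4) by simp
qed

text \<open>A primitive root identifies the characters with
  \<open>n \<mapsto> echar m (j * ind n)\<close> for \<open>j < m\<close>, \<open>m = q - 1\<close>,
  so orthogonality reduces to that of additive characters modulo \<open>q - 1\<close>.\<close>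

lemma sum_chars_orthogonal:
  assumes q: "prime q"
  shows "finite {chi. dirichlet_char q chi}"
    and "\<And>a b. coprime a q \<Longrightarrow> coprime b q \<Longrightarrow>
      (\<Sum>chi\<in>{chi. dirichlet_char q chi}. chi a * cnj (chi b)) = (if [a = b] (mod q) then of_nat (q - 1) else 0)"
proof -
  define m where "m = q - 1"
  have q1: "q > 1" using q by (rule prime_gt_1_nat)
  have m: "m > 0" "totient q = m" using q1 q by (simp_all add: m_def totient_prime)
  obtain g where g: "residue_primroot q g" using prime_primitive_root_exists[of q] q1 q by blast
  have cg: "coprime q g" and og: "ord q g = m" using g m by (auto simp: residue_primroot_def)
  \<comment> \<open>A discrete logarithm. The choice fixes it only modulo \<open>m\<close>, which
    suffices because it is always inserted into the \<open>m\<close>-periodic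
    \<open>echar m\<close>.\<close>
  define ind where "ind a = (SOME i. [g ^ i = a] (mod q))" for a
  have ind: "[g ^ ind a = a] (mod q)" if "coprime a q" for a
  proof -
    have "a mod q \<in> totatives q"
    proof -
      have "coprime (a mod q) q" using that q1 by (simp add: coprime_mod_left_iff)
      moreover have "a mod q \<noteq> 0" using that q1 by (metis coprime_absorb_left dvd_eq_mod_eq_0 less_irrefl coprime_commute nat_dvd_1_iff_1)
      ultimately show ?thesis using q1 by (auto simp: totatives_def intro: less_imp_le)
    qed
    then have "a mod q \<in> (\<lambda>i. g ^ i mod q) ` {..<totient q}"
      using residue_primroot_is_generator[OF q1 g] by (simp add: bij_betw_def)
    then obtain i where "a mod q = g ^ i mod q" by blast
    then have "[g ^ i = a] (mod q)" by (simp add: cong_def)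
    then show ?thesis unfolding ind_def by (rule someI)
  qed
  define ch where "ch j n = (if coprime n q then echar m (j * ind n) else 0)" for j n
  have exp_cong: "echar m (j * x) = echar m (j * y)" if "[g ^ x = g ^ y] (mod q)" for j x y
    using that order_divides_expdiff[OF cg] og by (intro echar_cong cong_scalar_left) simp
  have ch_char: "dirichlet_char q (ch j)" for j
    unfolding dirichlet_char_def
  proof (intro conjI allI)
    show "q > 0" using q1 by simp
    fix n
    have cop: "coprime (n + q) q \<longleftrightarrow> coprime n q" by (simp only: coprime_iff_gcd_eq_1 gcd_add1)
    show "ch j (n + q) = ch j n"
    proof (cases "coprime n q")
      case True
      then have c: "coprime (n + q) q" by (simp only: cop)
      have "[g ^ ind (n + q) = g ^ ind n] (mod q)"
        using ind[OF c] ind[OF True] by (simp add: cong_def)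
      then show ?thesis using True c by (simp add: ch_def exp_cong)
    qed (simp add: ch_def cop)
    show "ch j n \<noteq> 0 \<longleftrightarrow> coprime n q"
      using norm_echar[of m "j * ind n"] by (auto simp: ch_def simp del: norm_echar)
  next
    fix a b
    show "ch j (a * b) = ch j a * ch j b"
    proof (cases "coprime a q \<and> coprime b q")
      case True
      have "[g ^ ind (a * b) = a * b] (mod q)" using True by (intro ind) simp
      also have "[a * b = g ^ ind a * g ^ ind b] (mod q)"
        using True by (intro cong_mult cong_sym[OF ind]) auto
      also have "g ^ ind a * g ^ ind b = g ^ (ind a + ind b)" by (simp add: power_add)
      finally show ?thesis using True exp_cong by (simp add: ch_def echar_add[symmetric] distrib_left[symmetric])
    qed (auto simp: ch_def)
  next
    have "[g ^ ind 1 = g ^ 0] (mod q)" using ind[of 1] by simp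
    from exp_cong[OF this, of j] show "ch j 1 = 1" by (simp add: ch_def)
  qed
  have surj: "chi \<in> ch ` {..<m}" if chi: "dirichlet_char q chi" for chi
  proof -
    have cgq: "coprime g q" using cg by (simp add: coprime_commute)
    have "chi g ^ m = 1" using dirichlet_char_root_unity[OF chi cgq] m by simp
    then obtain j where j: "j < m" "chi g = echar m j"
      using Complex.bij_betw_roots_unity[OF m(1)] by (auto simp: bij_betw_def echar_def)
    have "chi n = ch j n" for n
    proof (cases "coprime n q")
      case True
      have "chi n = chi (g ^ ind n)" using dirichlet_char_cong[OF chi ind[OF True]] by simp
      then show ?thesis using True by (simp add: dirichlet_char_power[OF chi] j(2) ch_def echar_mult)
    qed (simp add: ch_def dirichlet_char_eq_0[OF chi])
    then show ?thesis using j(1) by auto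
  qed
  have X: "{chi. dirichlet_char q chi} = ch ` {..<m}" using surj ch_char by blast
  show "finite {chi. dirichlet_char q chi}" unfolding X by simp
  have inj: "inj_on ch {..<m}"
  proof (rule inj_onI)
    fix i j assume ij: "i \<in> {..<m}" "j \<in> {..<m}" "ch i = ch j"
    have cgq: "coprime g q" using cg by (simp add: coprime_commute)
    have e: "ch j g = echar m j" for j
    proof -
      have "[g ^ ind g = g ^ 1] (mod q)" using ind[OF cgq] by simp
      from exp_cong[OF this, of j] show ?thesis using cgq by (simp add: ch_def)
    qed
    have "echar m i = echar m j" using e[of i] e[of j] ij(3) by simp
    then show "i = j" using Complex.bij_betw_roots_unity[OF m(1)] ij(1,2)
      by (auto simp: bij_betw_def inj_on_def echar_def)
  qed
  fix a b assume ab: "coprime a q" "coprime b q"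
  have "(\<Sum>chi\<in>{chi. dirichlet_char q chi}. chi a * cnj (chi b)) = (\<Sum>j<m. echar m (j * ind a) * cnj (echar m (j * ind b)))"
    unfolding X by (subst sum.reindex[OF inj]) (simp add: ch_def ab)
  also have "\<dots> = (if [ind a = ind b] (mod m) then of_nat m else 0)"
    by (rule sum_echar_orthogonal[OF m(1)])
  also have "[ind a = ind b] (mod m) \<longleftrightarrow> [g ^ ind a = g ^ ind b] (mod q)"
    using order_divides_expdiff[OF cg, of "ind a" "ind b"] og by simp
  also have "\<dots> \<longleftrightarrow> [a = b] (mod q)"
    using ind[OF ab(1)] ind[OF ab(2)] by (meson cong_sym cong_trans)
  finally show "(\<Sum>chi\<in>{chi. dirichlet_char q chi}. chi a * cnj (chi b)) = (if [a = b] (mod q) then of_nat (q - 1) else 0)"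
    by (simp add: m_def)
qed

lemma coprime_less_prime:
  fixes q b :: nat
  assumes q: "prime q" and b: "b < q"
  shows "coprime b q \<longleftrightarrow> b \<noteq> 0"
proof -
  have "coprime b q" if "b \<noteq> 0"
  proof -
    have "\<not> q dvd b" using b that by (metis dvd_imp_le leD gr0I)
    then have "coprime q b" by (rule prime_imp_coprime[OF q])
    then show ?thesis by (metis coprime_commute)
  qed
  then show ?thesis using prime_gt_1_nat[OF q] by (cases "b = 0") auto
qed

section \<open>Good twists and their class sums\<close>

definition chars :: "nat \<Rightarrow> (nat \<Rightarrow> complex) set" where
  "chars q = {chi. dirichlet_char q chi}"

text \<open>The twists for which \<open>chi\<close> is imprimitive or \<open>f chi\<close> is principal; discarding them costs no
  more than the error already present in the class sums.\<close>

definition bad_chars :: "nat \<Rightarrow> nat \<Rightarrow> (nat \<Rightarrow> complex) \<Rightarrow> (nat \<Rightarrow> complex) set" where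
  "bad_chars q l f = {chi \<in> chars q. (\<forall>n. coprime n q \<longrightarrow> chi n = 1) \<or>
     (l dvd q \<and> (\<forall>n. coprime n q \<longrightarrow> f n * chi n = 1))}"

definition good_chars :: "nat \<Rightarrow> nat \<Rightarrow> (nat \<Rightarrow> complex) \<Rightarrow> (nat \<Rightarrow> complex) set" where
  "good_chars q l f = chars q - bad_chars q l f"

definition twist_sum :: "(nat \<Rightarrow> complex) \<Rightarrow> nat \<Rightarrow> nat \<Rightarrow> (nat \<Rightarrow> complex) \<Rightarrow> complex" where
  "twist_sum f l q chi = (\<Sum>b<q. chi b * class_sum f l q b)"

text \<open>The inverse character transform restricted to good characters, that is, the class sum
  with its bad components projected out.\<close>

definition good_class_sum :: "(nat \<Rightarrow> complex) \<Rightarrow> nat \<Rightarrow> nat \<Rightarrow> nat \<Rightarrow> complex" where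
  "good_class_sum f l q b = (\<Sum>chi\<in>good_chars q l f. twist_sum f l q chi * cnj (chi b)) / of_nat (q - 1)"

text \<open>Each of the two defining conditions prescribes \<open>chi\<close> on the units, hence
  everywhere.\<close>

lemma card_bad_chars: "finite (bad_chars q l f)" "card (bad_chars q l f) \<le> 2"
proof -
  have sub: "bad_chars q l f \<subseteq>
     {\<lambda>n. if coprime n q then 1 else 0, \<lambda>n. if coprime n q then inverse (f n) else 0}"
  proof
    fix chi assume chi: "chi \<in> bad_chars q l f"
    then have c: "dirichlet_char q chi" by (simp add: bad_chars_def chars_def)
    from chi consider "\<forall>n. coprime n q \<longrightarrow> chi n = 1" | "\<forall>n. coprime n q \<longrightarrow> f n * chi n = 1"
      by (auto simp: bad_chars_def)
    then show "chi \<in> {\<lambda>n. if coprime n q then 1 else 0, \<lambda>n. if coprime n q then inverse (f n) else 0}"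
    proof cases
      case 1
      then have "chi = (\<lambda>n. if coprime n q then 1 else 0)"
        using dirichlet_char_eq_0[OF c] by (intro ext) auto
      then show ?thesis by blast
    next
      case 2
      then have "chi = (\<lambda>n. if coprime n q then inverse (f n) else 0)"
        using dirichlet_char_eq_0[OF c] by (intro ext) (auto simp: inverse_unique)
      then show ?thesis by blast
    qed
  qed
  show "finite (bad_chars q l f)" by (rule finite_subset[OF sub]) simp
  have "card (bad_chars q l f) \<le> card {\<lambda>n. if coprime n q then 1 else 0, \<lambda>n. if coprime n q then inverse (f n) else 0}"
    by (rule card_mono[OF _ sub]) simp
  also have "\<dots> \<le> 2" by (simp add: card_insert_if)
  finally show "card (bad_chars q l f) \<le> 2" .
qed

context
  fixes q l :: nat and f :: "nat \<Rightarrow> complex"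
  assumes q: "prime q" and prim: "primitive_char l f"
begin

lemma f_char: "dirichlet_char l f"
  using prim by (simp add: primitive_char_def)

lemma q_gt_1: "q > 1"
  using q by (rule prime_gt_1_nat)

lemma l_gt_0: "l > 0"
  by (rule dirichlet_char_pos[OF f_char])

lemma finite_chars: "finite (chars q)"
  unfolding chars_def by (rule sum_chars_orthogonal(1)[OF q])

lemma finite_good_chars: "finite (good_chars q l f)"
  unfolding good_chars_def by (rule finite_Diff[OF finite_chars])

lemma good_chars_char: "chi \<in> good_chars q l f \<Longrightarrow> dirichlet_char q chi"
  by (simp add: good_chars_def chars_def)

lemma good_chars_primitive: "chi \<in> good_chars q l f \<Longrightarrow> primitive_char q chi"
  unfolding good_chars_def bad_chars_def chars_def
  using primitive_char_prime[OF q] by blast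

text \<open>Three cases for the prime \<open>q\<close>. If \<open>l dvd q\<close>, the definition of
  bad characters excludes a principal product. If \<open>l\<close> and \<open>q\<close> are coprime,
  a witness for \<open>f\<close> is made congruent to 1 modulo \<open>q\<close>. Otherwise
  \<open>q\<close> is a proper divisor of \<open>l\<close>, and primitivity of \<open>f\<close>
  supplies a witness on which \<open>chi\<close> is 1.\<close>

lemma good_chars_nonprincipal:
  assumes chi: "chi \<in> good_chars q l f"
  obtains a where "coprime a (l * q)" "f a * chi a \<noteq> 1"
proof (cases "l dvd q")
  case True
  then obtain a where a: "coprime a q" "f a * chi a \<noteq> 1"
    using chi unfolding good_chars_def bad_chars_def by blast
  moreover have "coprime a l" using a(1) True by (meson coprime_divisors dvd_refl)
  ultimately show ?thesis using that by simp
next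
  case False
  have c: "dirichlet_char q chi" using chi by (rule good_chars_char)
  show ?thesis
  proof (cases "coprime l q")
    case True
    have "l > 1" using False l_gt_0 by (cases "l = 1") auto
    then obtain a where a: "coprime a l" "f a \<noteq> 1"
      using primitive_char_nonprincipal[OF prim] by blast
    obtain n where n: "[n = a] (mod l)" "[n = 1] (mod q)"
      using binary_chinese_remainder_nat[OF True] by blast
    have "coprime n l" using n(1) a(1) by (meson cong_imp_coprime cong_sym)
    moreover have "coprime n q" using n(2) by (meson cong_imp_coprime cong_sym coprime_1_left)
    moreover have "f n * chi n = f a"
      using dirichlet_char_cong[OF f_char n(1)] dirichlet_char_cong[OF c n(2)] dirichlet_char_1[OF c] by simp
    ultimately show ?thesis using that a(2) by simp
  next
    case ncop: False
    then have "q dvd l" using q by (metis coprime_commute prime_imp_coprime)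
    moreover have "q \<noteq> l" using False by auto
    moreover have "q \<le> l" using \<open>q dvd l\<close> l_gt_0 by (rule dvd_imp_le)
    ultimately have "q dvd l \<and> q < l" by simp
    then obtain a where a: "coprime a l" "[a = 1] (mod q)" "f a \<noteq> 1"
      using prim unfolding primitive_char_def by blast
    have "coprime a q" using a(1) \<open>q dvd l\<close> by (meson coprime_divisors dvd_refl)
    moreover have "f a * chi a = f a"
      using dirichlet_char_cong[OF c a(2)] dirichlet_char_1[OF c] by simp
    ultimately show ?thesis using a by (intro that[of a]) (simp, metis)
  qed
qed

lemma twist_sum_good:
  assumes chi: "chi \<in> good_chars q l f"
  shows "twist_sum f l q chi = dirichlet_L (\<lambda>n. f n * chi n) (1 / 2)"
proof -
  have c: "dirichlet_char q chi" using chi by (rule good_chars_char)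
  obtain a where a: "coprime a (l * q)" "f a * chi a \<noteq> 1" using good_chars_nonprincipal[OF chi] .
  show ?thesis unfolding twist_sum_def
  proof (rule sum_char_class_sum[OF prim c q_gt_1])
    show "balanced (l * q) (\<lambda>n. f n * chi n)"
      by (rule balanced_dirichlet_char[OF dirichlet_char_prod[OF f_char c] a])
    assume dvd: "l dvd q"
    show "(\<Sum>b<q. f b * chi b) = 0"
    proof -
      have cop: "coprime n l" if "coprime n q" for n using that dvd by (meson coprime_divisors dvd_refl)
      have per: "f (n + q) * chi (n + q) = f n * chi n" for n
      proof -
        have "[n + q = n] (mod l)" using dvd by (auto simp: cong_def elim!: dvdE)
        then have "f (n + q) = f n" by (rule dirichlet_char_cong[OF f_char])
        moreover have "chi (n + q) = chi n" by (rule dirichlet_char_cong[OF c]) (simp add: cong_def)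
        ultimately show ?thesis by simp
      qed
      have "dirichlet_char q (\<lambda>n. f n * chi n)"
        unfolding dirichlet_char_def
      proof (intro conjI allI per)
        show "q > 0" using q_gt_1 by simp
        show "f (a * b) * chi (a * b) = f a * chi a * (f b * chi b)" for a b
          by (simp add: dirichlet_char_mult[OF f_char] dirichlet_char_mult[OF c])
        show "f 1 * chi 1 = 1" using dirichlet_char_1[OF f_char] dirichlet_char_1[OF c] by simp
        show "f n * chi n \<noteq> 0 \<longleftrightarrow> coprime n q" for n
          using f_char c cop[of n] by (auto simp: dirichlet_char_def)
      qed
      then show ?thesis by (rule sum_dirichlet_char_eq_0) (use a in auto)
    qed
  qed
qed

lemma norm_twist_sum_le:
  assumes "chi \<in> chars q"
  shows "cmod (twist_sum f l q chi) \<le> (\<Sum>b<q. cmod (class_sum f l q b))"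
  unfolding twist_sum_def
proof (intro sum_norm_le)
  fix b
  have "dirichlet_char q chi" using assms by (simp add: chars_def)
  then have "cmod (chi b) \<le> 1" by (rule norm_dirichlet_char_le)
  then show "cmod (chi b * class_sum f l q b) \<le> cmod (class_sum f l q b)"
    by (simp add: norm_mult mult_left_le_one_le)
qed

lemma twist_sum_restrict:
  assumes "chi \<in> chars q"
  shows "twist_sum f l q chi = (\<Sum>b\<in>{1..<q}. chi b * class_sum f l q b)"
  unfolding twist_sum_def
proof (rule sum.mono_neutral_right)
  have c: "dirichlet_char q chi" using assms by (simp add: chars_def)
  have "chi 0 = 0" using c q_gt_1 by (intro dirichlet_char_eq_0) auto
  then show "\<forall>i\<in>{..<q} - {1..<q}. chi i * class_sum f l q i = 0" by (auto simp: not_le)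
qed auto

lemma sum_chars_delta:
  assumes "a \<in> {1..<q}" "b \<in> {1..<q}"
  shows "(\<Sum>chi\<in>chars q. chi a * cnj (chi b)) = (if a = b then of_nat (q - 1) else 0)"
proof -
  have "[a = b] (mod q) \<longleftrightarrow> a = b" using assms by (auto simp: cong_def)
  then show ?thesis
    unfolding chars_def using sum_chars_orthogonal(2)[OF q, of a b] coprime_less_prime[OF q] assms by auto
qed

lemma twist_sum_inversion:
  assumes b: "b \<in> {1..<q}"
  shows "(\<Sum>chi\<in>chars q. twist_sum f l q chi * cnj (chi b)) = of_nat (q - 1) * class_sum f l q b"
proof -
  have "(\<Sum>chi\<in>chars q. twist_sum f l q chi * cnj (chi b)) =
      (\<Sum>chi\<in>chars q. \<Sum>a\<in>{1..<q}. class_sum f l q a * (chi a * cnj (chi b)))"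
    by (intro sum.cong refl) (simp only: twist_sum_restrict sum_distrib_right, simp only: mult_ac)
  also have "\<dots> = (\<Sum>a\<in>{1..<q}. class_sum f l q a * (\<Sum>chi\<in>chars q. chi a * cnj (chi b)))"
    by (subst sum.swap) (simp add: sum_distrib_left)
  also have "\<dots> = (\<Sum>a\<in>{1..<q}. if a = b then class_sum f l q a * of_nat (q - 1) else 0)"
    using b by (intro sum.cong refl) (simp add: sum_chars_delta)
  finally show ?thesis using b by (simp add: mult.commute)
qed

lemma twist_sum_parseval:
  "(\<Sum>chi\<in>chars q. (cmod (twist_sum f l q chi))\<^sup>2) = real (q - 1) * (\<Sum>b\<in>{1..<q}. (cmod (class_sum f l q b))\<^sup>2)"
proof -
  have "complex_of_real (\<Sum>chi\<in>chars q. (cmod (twist_sum f l q chi))\<^sup>2) =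
      (\<Sum>chi\<in>chars q. twist_sum f l q chi * cnj (twist_sum f l q chi))"
    unfolding of_real_sum by (intro sum.cong refl) (metis complex_norm_square)
  also have "\<dots> = (\<Sum>chi\<in>chars q. \<Sum>b\<in>{1..<q}. cnj (class_sum f l q b) * (twist_sum f l q chi * cnj (chi b)))"
  proof (intro sum.cong refl)
    fix chi assume "chi \<in> chars q"
    then have "cnj (twist_sum f l q chi) = (\<Sum>b\<in>{1..<q}. cnj (chi b) * cnj (class_sum f l q b))"
      by (simp add: twist_sum_restrict)
    then show "twist_sum f l q chi * cnj (twist_sum f l q chi) = (\<Sum>b\<in>{1..<q}. cnj (class_sum f l q b) * (twist_sum f l q chi * cnj (chi b)))"
      by (simp add: sum_distrib_left mult_ac)
  qed
  also have "\<dots> = (\<Sum>b\<in>{1..<q}. cnj (class_sum f l q b) * (\<Sum>chi\<in>chars q. twist_sum f l q chi * cnj (chi b)))"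
    by (subst sum.swap) (simp add: sum_distrib_left)
  also have "\<dots> = (\<Sum>b\<in>{1..<q}. of_nat (q - 1) * (class_sum f l q b * cnj (class_sum f l q b)))"
    by (intro sum.cong refl) (simp add: twist_sum_inversion)
  also have "\<dots> = complex_of_real (real (q - 1) * (\<Sum>b\<in>{1..<q}. (cmod (class_sum f l q b))\<^sup>2))"
    by (simp add: sum_distrib_left complex_norm_square[symmetric] del: of_real_power of_nat_diff)
  finally show ?thesis by (simp only: of_real_eq_iff)
qed

lemma twist_sum_second_moment:
  assumes Lam: "loglen l \<le> Lam" "loglen q \<le> Lam"
  shows "(\<Sum>chi\<in>chars q. (cmod (twist_sum f l q chi))\<^sup>2) \<le> 66 * Lam\<^sup>2 * real q * max 1 (sqrt (real l / real q))"
proof -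
  have "(\<Sum>chi\<in>chars q. (cmod (twist_sum f l q chi))\<^sup>2) \<le> real q * (\<Sum>b<q. (cmod (class_sum f l q b))\<^sup>2)"
    unfolding twist_sum_parseval by (intro mult_mono sum_mono2) (auto intro: sum_nonneg)
  also have "\<dots> \<le> real q * (66 * Lam\<^sup>2 * max 1 (sqrt (real l / real q)))"
    using q_gt_1 by (intro mult_left_mono sum_norm_sq_class_sum_le[OF prim _ Lam]) auto
  finally show ?thesis by (simp add: mult_ac)
qed

lemma norm_twist_sum_sq_le:
  assumes chi: "chi \<in> good_chars q l f" and Lam: "loglen (l * q) \<le> Lam"
  shows "(cmod (twist_sum f l q chi))\<^sup>2 \<le> 66 * Lam\<^sup>2 * sqrt (real l * real q)"
proof (cases "coprime l q")
  case True
  have "primitive_char (l * q) (\<lambda>n. f n * chi n)"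
    by (rule primitive_char_mult[OF prim good_chars_primitive[OF chi] True])
  moreover have lq: "l * q > 1"
  proof -
    have "1 * q \<le> l * q" using l_gt_0 by (intro mult_le_mono1) simp
    then show ?thesis using q_gt_1 by linarith
  qed
  ultimately have "cmod (twist_sum f l q chi) \<le> 4 * sqrt (sqrt (real (l * q))) * loglen (l * q)"
    unfolding twist_sum_good[OF chi] by (rule norm_dirichlet_L_half_le)
  also have "\<dots> \<le> 4 * sqrt (sqrt (real (l * q))) * Lam" using Lam by (intro mult_left_mono) auto
  finally have "(cmod (twist_sum f l q chi))\<^sup>2 \<le> (4 * sqrt (sqrt (real (l * q))) * Lam)\<^sup>2"
    by (intro power_mono) auto
  also have "\<dots> = 16 * (Lam\<^sup>2 * sqrt (real l * real q))" by (simp add: power_mult_distrib)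
  also have "\<dots> \<le> 66 * (Lam\<^sup>2 * sqrt (real l * real q))" by (intro mult_right_mono) auto
  finally show ?thesis by (simp add: mult_ac)
next
  case False
  then have "q dvd l" using q by (metis coprime_commute prime_imp_coprime)
  then have ql: "q \<le> l" using l_gt_0 by (rule dvd_imp_le)
  have "loglen (l * q) = loglen l + ln (real q)" "loglen (l * q) = loglen q + ln (real l)"
    using q_gt_1 l_gt_0 by (simp_all add: loglen_def ln_mult)
  moreover have "ln (real q) \<ge> 0" "ln (real l) \<ge> 0" using q_gt_1 l_gt_0 by simp_all
  ultimately have Lam': "loglen l \<le> Lam" "loglen q \<le> Lam" using Lam by linarith+
  have "(cmod (twist_sum f l q chi))\<^sup>2 \<le> (\<Sum>chi\<in>chars q. (cmod (twist_sum f l q chi))\<^sup>2)"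
    using chi finite_chars by (intro member_le_sum) (auto simp: good_chars_def)
  also have "\<dots> \<le> 66 * Lam\<^sup>2 * real q * max 1 (sqrt (real l / real q))" by (rule twist_sum_second_moment[OF Lam'])
  also have "max 1 (sqrt (real l / real q)) = sqrt (real l / real q)" using ql q_gt_1 by (simp add: max_def)
  also have "66 * Lam\<^sup>2 * real q * sqrt (real l / real q) = 66 * Lam\<^sup>2 * sqrt (real l * real q)"
  proof -
    have "real q * sqrt (real l / real q) = sqrt (real q * real q) * sqrt (real l / real q)" by simp
    also have "\<dots> = sqrt (real q * real q * (real l / real q))" by (rule real_sqrt_mult[symmetric])
    also have "real q * real q * (real l / real q) = real l * real q" using q_gt_1 by simp
    finally show ?thesis by (simp only: mult.assoc)
  qed
  finally show ?thesis .
qed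

text \<open>The constant is 28 = 4 + 24: 4 from the tail, and 24 from at most two bad characters
  with constant 6 each, doubled by \<open>q - 1 \<ge> q / 2\<close>.\<close>

lemma norm_good_class_sum_diff_le:
  assumes b: "b \<in> {1..<q}"
  shows "cmod (good_class_sum f l q b - f b * of_real (1 / sqrt (real b))) \<le> 28 * (sqrt (sqrt (real l)) * loglen l / sqrt (real q))"
proof -
  define D where "D = sqrt (sqrt (real l)) * loglen l"
  have D0: "D \<ge> 0" unfolding D_def using loglen_ge_1[OF l_gt_0] by simp
  have q1: "real (q - 1) > 0" using q_gt_1 by simp
  define R where "R = (\<Sum>chi\<in>bad_chars q l f. twist_sum f l q chi * cnj (chi b))"
  have bad: "bad_chars q l f \<subseteq> chars q" by (auto simp: bad_chars_def)
  have "(\<Sum>chi\<in>good_chars q l f. twist_sum f l q chi * cnj (chi b)) = of_nat (q - 1) * class_sum f l q b - R"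
    unfolding good_chars_def R_def twist_sum_inversion[OF b, symmetric]
    by (rule sum_diff[OF finite_chars bad])
  then have "good_class_sum f l q b = class_sum f l q b - R / of_nat (q - 1)"
    unfolding good_class_sum_def using q_gt_1 by (simp add: diff_divide_distrib)
  then have "good_class_sum f l q b - f b * of_real (1 / sqrt (real b)) = etail f l q b - R / of_nat (q - 1)"
    by (simp add: class_sum_def)
  then have "cmod (good_class_sum f l q b - f b * of_real (1 / sqrt (real b))) \<le> cmod (etail f l q b) + cmod R / real (q - 1)"
    by (metis norm_triangle_ineq4 norm_divide norm_of_nat)
  also have "cmod (etail f l q b) \<le> 4 * (D / sqrt (real q))"
    using norm_etail_le[OF prim, of q b] b q_gt_1 by (simp add: D_def mult_ac)
  also have "cmod R / real (q - 1) \<le> 24 * (D / sqrt (real q))"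
  proof -
    have "cmod R \<le> (\<Sum>chi\<in>bad_chars q l f. 6 * sqrt (real q) * D)"
      unfolding R_def
    proof (intro sum_norm_le)
      fix chi assume chi: "chi \<in> bad_chars q l f"
      then have "chi \<in> chars q" using bad by blast
      then have "cmod (chi b) \<le> 1" by (intro norm_dirichlet_char_le) (simp add: chars_def)
      then have "cmod (twist_sum f l q chi * cnj (chi b)) \<le> cmod (twist_sum f l q chi)"
        by (simp add: norm_mult mult_left_le)
      also have "\<dots> \<le> (\<Sum>b<q. cmod (class_sum f l q b))" by (rule norm_twist_sum_le[OF \<open>chi \<in> chars q\<close>])
      also have "\<dots> \<le> 6 * sqrt (real q) * D"
        unfolding D_def using q_gt_1 by (intro sum_norm_class_sum_le[OF prim]) simp
      finally show "cmod (twist_sum f l q chi * cnj (chi b)) \<le> 6 * sqrt (real q) * D" .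
    qed
    also have "\<dots> = real (card (bad_chars q l f)) * (6 * sqrt (real q) * D)" by simp
    also have "\<dots> \<le> 2 * (6 * sqrt (real q) * D)"
      using card_bad_chars(2)[of q l f] D0 by (intro mult_right_mono) auto
    finally have "cmod R / real (q - 1) \<le> 2 * (6 * sqrt (real q) * D) / (real q / 2)"
      using q_gt_1 D0 by (intro frac_le) auto
    also have "\<dots> = 24 * (D * (sqrt (real q) / real q))" by simp
    also have "sqrt (real q) / real q = 1 / sqrt (real q)" using q_gt_1 by (simp add: sqrt_divide_self_eq inverse_eq_divide)
    finally show ?thesis by simp
  qed
  finally show ?thesis by (simp add: D_def mult_ac)
qed

end

section \<open>Moments over tuples of characters\<close>

text \<open>A majorant that telescopes in steps of two, made for sums over odd \<open>n\<close>. It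
  rests on \<open>sqrt (n-1) * sqrt (n+1) \<le> n\<close> and on concavity of the square
  root.\<close>

lemma three_halves_telescope:
  assumes "n \<ge> 2"
  shows "1 / (real n * sqrt (real n)) \<le> 1 / sqrt (real (n - 1)) - 1 / sqrt (real (n + 1))"
proof -
  define a c s where "a = sqrt (real (n - 1))" and "c = sqrt (real (n + 1))" and "s = sqrt (real n)"
  have pos: "a > 0" "c > 0" "s > 0" using assms by (simp_all add: a_def c_def s_def)
  have sq: "a\<^sup>2 = real n - 1" "c\<^sup>2 = real n + 1" "s\<^sup>2 = real n"
    using assms by (simp_all add: a_def c_def s_def of_nat_diff)
  have "(a * c)\<^sup>2 \<le> (real n)\<^sup>2" unfolding power_mult_distrib sq by (simp add: power2_eq_square algebra_simps)
  then have ac: "a * c \<le> real n" by (rule power2_le_imp_le) simp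
  have "(a + c)\<^sup>2 \<le> (2 * s)\<^sup>2"
    unfolding power2_sum power_mult_distrib sq using ac by simp
  then have apc: "a + c \<le> 2 * s" by (rule power2_le_imp_le) (use pos in simp)
  have "1 / (real n * s) = 2 / (real n * (2 * s))" by simp
  also have "\<dots> \<le> 2 / (a * c * (a + c))"
    using pos ac apc by (intro frac_le mult_mono mult_pos_pos add_pos_pos) auto
  also have "\<dots> = 1 / a - 1 / c"
  proof -
    have "(c - a) * (a + c) = 2" using sq by (simp add: power2_eq_square algebra_simps)
    then have "2 / (a * c * (a + c)) = (c - a) * (a + c) / (a * c * (a + c))" by simp
    also have "\<dots> = (c - a) / (a * c)" using pos by simp
    also have "\<dots> = 1 / a - 1 / c" using pos by (simp add: field_simps)
    finally show ?thesis .
  qed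
  finally show ?thesis by (simp add: a_def c_def s_def)
qed

lemma sum_odd_three_halves: "(\<Sum>k=1..K. 1 / (real (2 * k + 1) * sqrt (real (2 * k + 1)))) \<le> 1 / sqrt 2"
proof -
  have "(\<Sum>k=1..K. 1 / (real (2 * k + 1) * sqrt (real (2 * k + 1)))) \<le> 1 / sqrt 2 - 1 / sqrt (real (2 * K + 2))"
  proof (induction K)
    case (Suc K)
    have "1 / (real (2 * Suc K + 1) * sqrt (real (2 * Suc K + 1))) \<le>
        1 / sqrt (real (2 * K + 2)) - 1 / sqrt (real (2 * Suc K + 2))"
      using three_halves_telescope[of "2 * Suc K + 1"] by simp
    then show ?case using Suc by simp
  qed simp
  also have "\<dots> \<le> 1 / sqrt 2" by simp
  finally show ?thesis .
qed

text \<open>Since \<open>\<zeta>(3/2) - 1 > 1\<close>, the first term does not dominate the rest of the sum. After removing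
  the Euler factor at \<open>2\<close> it does, because only odd integers remain.\<close>

lemma multiplicative_sum_lower:
  fixes u :: "nat \<Rightarrow> complex"
  assumes mult: "\<And>b. u (2 * b) = u 2 * u b" and u1: "u 1 = 1"
    and le: "\<And>b. b > 0 \<Longrightarrow> cmod (u b) \<le> 1 / (real b * sqrt (real b))" and q: "q > 1"
  shows "cmod (\<Sum>b\<in>{1..<q}. u b) \<ge> 1 / 10 - 1 / sqrt (real q)"
proof -
  define S where "S = (\<Sum>b\<in>{1..<q}. u b)"
  define Od where "Od = {b\<in>{1..<q}. odd b}"
  define Ev where "Ev = {b\<in>{1..<q}. even b}"
  define Lo where "Lo = {b\<in>{1..<q}. 2 * b < q}"
  define Hi where "Hi = {b\<in>{1..<q}. \<not> 2 * b < q}"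
  have S1: "S = sum u Od + sum u Ev"
    unfolding S_def Od_def Ev_def by (subst sum.union_disjoint[symmetric]) (auto intro: sum.cong)
  have S2: "u 2 * S = (\<Sum>b\<in>Lo. u (2 * b)) + (\<Sum>b\<in>Hi. u (2 * b))"
  proof -
    have "u 2 * S = (\<Sum>b\<in>{1..<q}. u (2 * b))" unfolding S_def mult by (rule sum_distrib_left)
    also have "{1..<q} = Lo \<union> Hi" by (auto simp: Lo_def Hi_def)
    finally show ?thesis by (simp add: sum.union_disjoint Lo_def Hi_def disjoint_iff)
  qed
  have "(\<Sum>b\<in>Lo. u (2 * b)) = sum u Ev"
    by (rule sum.reindex_bij_witness[of _ "\<lambda>b. b div 2" "\<lambda>b. 2 * b"]) (auto simp: Lo_def Ev_def elim!: evenE)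
  \<comment> \<open>Multiplication by \<open>1 - u 2\<close> removes the Euler factor at 2; the sum
    over \<open>Hi\<close> is the defect of truncating at \<open>q\<close>, at most \<open>q\<close>
    terms of size \<open>q^(-3/2)\<close>.\<close>
  with S1 S2 have eq: "(1 - u 2) * S = sum u Od - (\<Sum>b\<in>Hi. u (2 * b))"
    by (simp add: algebra_simps)
  have hi: "cmod (\<Sum>b\<in>Hi. u (2 * b)) \<le> 1 / sqrt (real q)"
  proof -
    have "cmod (\<Sum>b\<in>Hi. u (2 * b)) \<le> (\<Sum>b\<in>Hi. 1 / (real q * sqrt (real q)))"
    proof (intro sum_norm_le)
      fix b assume b: "b \<in> Hi"
      then have qb: "real q \<le> real (2 * b)" unfolding Hi_def by (simp only: of_nat_le_iff) simp
      have "cmod (u (2 * b)) \<le> 1 / (real (2 * b) * sqrt (real (2 * b)))" using b by (intro le) (simp add: Hi_def)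
      also have "\<dots> \<le> 1 / (real q * sqrt (real q))"
        using q by (intro frac_le mult_mono mult_pos_pos real_sqrt_le_mono qb) auto
      finally show "cmod (u (2 * b)) \<le> 1 / (real q * sqrt (real q))" .
    qed
    also have "\<dots> = real (card Hi) * (1 / (real q * sqrt (real q)))" by simp
    also have "\<dots> \<le> real q * (1 / (real q * sqrt (real q)))"
    proof (intro mult_right_mono)
      have "card Hi \<le> card {1..<q}" by (rule card_mono) (auto simp: Hi_def)
      then show "real (card Hi) \<le> real q" by simp
    qed auto
    also have "\<dots> = 1 / sqrt (real q)" using q by simp
    finally show ?thesis .
  qed
  have od: "cmod (sum u Od) \<ge> 1 - 1 / sqrt 2"
  proof -
    have "Od = insert 1 (Od - {1})" using q by (auto simp: Od_def)
    moreover have fin: "finite Od" by (simp add: Od_def)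
    ultimately have "sum u Od = u 1 + sum u (Od - {1})" by (metis sum.remove insertI1)
    then have "cmod (u 1) \<le> cmod (sum u Od) + cmod (sum u (Od - {1}))"
      by (metis add_diff_cancel_right' norm_triangle_ineq4)
    moreover have "cmod (sum u (Od - {1})) \<le> 1 / sqrt 2"
    proof -
      have "cmod (sum u (Od - {1})) \<le> (\<Sum>b\<in>Od - {1}. 1 / (real b * sqrt (real b)))"
        by (intro sum_norm_le le) (auto simp: Od_def)
      also have "\<dots> \<le> (\<Sum>b\<in>(\<lambda>k. 2 * k + 1) ` {1..q}. 1 / (real b * sqrt (real b)))"
      proof (rule sum_mono2)
        show "Od - {1} \<subseteq> (\<lambda>k. 2 * k + 1) ` {1..q}"
        proof
          fix b assume b: "b \<in> Od - {1}"
          then have "b = 2 * (b div 2) + 1" "b div 2 \<in> {1..q}" by (auto simp: Od_def elim!: oddE)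
          then show "b \<in> (\<lambda>k. 2 * k + 1) ` {1..q}" by blast
        qed
      qed auto
      also have "\<dots> = (\<Sum>k=1..q. 1 / (real (2 * k + 1) * sqrt (real (2 * k + 1))))"
        by (subst sum.reindex) (auto simp: inj_on_def)
      also have "\<dots> \<le> 1 / sqrt 2" by (rule sum_odd_three_halves)
      finally show ?thesis .
    qed
    ultimately show ?thesis using u1 by simp
  qed
  \<comment> \<open>This gives \<open>1 - 1 / sqrt 2 \<ge> 1 / 4\<close>; division by
    \<open>cmod (1 - u 2) \<le> 2\<close> leaves 1/8, rounded down to 1/10.\<close>
  have "14 / 10 \<le> sqrt (2::real)" by (rule real_le_rsqrt) (simp add: power2_eq_square)
  then have "1 / sqrt 2 \<le> 1 / (14 / 10 :: real)" by (intro frac_le) auto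
  then have "1 / sqrt 2 \<le> (3 / 4 :: real)" by simp
  with od hi have "1 / 4 - 1 / sqrt (real q) \<le> cmod (sum u Od) - cmod (\<Sum>b\<in>Hi. u (2 * b))" by linarith
  also have "\<dots> \<le> cmod ((1 - u 2) * S)" unfolding eq by (rule norm_triangle_ineq2)
  also have "\<dots> \<le> 2 * cmod S"
  proof -
    have "1 / (2 * sqrt 2) \<le> (1 :: real)" using \<open>14 / 10 \<le> sqrt 2\<close> by (simp add: divide_le_eq_1)
    moreover have "cmod (u 2) \<le> 1 / (2 * sqrt 2)" using le[of 2] by simp
    ultimately have "cmod (u 2) \<le> 1" by linarith
    then have "cmod (1 - u 2) \<le> 2" using norm_triangle_ineq4[of 1 "u 2"] by simp
    then show ?thesis by (simp add: norm_mult mult_right_mono)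
  qed
  finally have "1 / 4 - 1 / sqrt (real q) \<le> 2 * cmod S" .
  moreover have "1 / sqrt (real q) \<ge> 0" by simp
  ultimately show ?thesis unfolding S_def by linarith
qed

text \<open>The factors are exchanged one at a time; each exchange costs \<open>d\<close>, and the
  remaining factors are at most \<open>x + d\<close>.\<close>

lemma norm_prod_diff_le:
  fixes y a :: "nat \<Rightarrow> complex"
  assumes "\<And>i. i < n \<Longrightarrow> cmod (a i) \<le> x" "\<And>i. i < n \<Longrightarrow> cmod (y i - a i) \<le> d" "x \<ge> 0" "d \<ge> 0"
  shows "cmod ((\<Prod>i<n. y i) - (\<Prod>i<n. a i)) \<le> real n * d * (x + d) ^ (n - 1)"
  using assms
proof (induction n)
  case (Suc n)
  have yn: "cmod (y n) \<le> x + d"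
    using Suc.prems(1)[of n] Suc.prems(2)[of n] norm_triangle_ineq2[of "y n" "a n"] by simp
  have IH: "cmod ((\<Prod>i<n. y i) - (\<Prod>i<n. a i)) \<le> real n * d * (x + d) ^ (n - 1)"
    by (rule Suc.IH) (use Suc.prems in auto)
  have pa: "cmod (\<Prod>i<n. a i) \<le> (x + d) ^ n"
  proof -
    have "cmod (\<Prod>i<n. a i) = (\<Prod>i<n. cmod (a i))" by (simp add: prod_norm)
    also have "\<dots> \<le> (\<Prod>i<n. x + d)"
    proof (intro prod_mono conjI)
      fix i assume "i \<in> {..<n}"
      then have "cmod (a i) \<le> x" by (intro Suc.prems(1)) simp
      then show "cmod (a i) \<le> x + d" using Suc.prems(4) by linarith
    qed simp
    finally show ?thesis by simp
  qed
  have "(\<Prod>i<Suc n. y i) - (\<Prod>i<Suc n. a i) =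
      y n * ((\<Prod>i<n. y i) - (\<Prod>i<n. a i)) + (y n - a n) * (\<Prod>i<n. a i)"
    by (simp add: algebra_simps)
  then have "cmod ((\<Prod>i<Suc n. y i) - (\<Prod>i<Suc n. a i)) \<le>
      cmod (y n) * cmod ((\<Prod>i<n. y i) - (\<Prod>i<n. a i)) + cmod (y n - a n) * cmod (\<Prod>i<n. a i)"
    by (simp only: norm_mult[symmetric] norm_triangle_ineq)
  also have "\<dots> \<le> (x + d) * (real n * d * (x + d) ^ (n - 1)) + d * (x + d) ^ n"
    using Suc.prems yn IH pa by (intro add_mono mult_mono) auto
  also have "\<dots> = real (Suc n) * d * (x + d) ^ (Suc n - 1)"
    by (cases n) (simp_all add: algebra_simps)
  finally show ?case .
qed simp

lemma add_power_le:
  fixes x d :: real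
  assumes "x \<ge> 0" "d \<ge> 0"
  shows "(x + d) ^ n \<le> 2 ^ n * (x ^ n + d ^ n)"
proof -
  have "(x + d) ^ n \<le> (2 * max x d) ^ n" using assms by (intro power_mono) auto
  also have "\<dots> = 2 ^ n * max x d ^ n" by (rule power_mult_distrib)
  also have "max x d ^ n \<le> x ^ n + d ^ n" using assms by (auto simp: max_def)
  finally show ?thesis by simp
qed

text \<open>Extensional functions are the form in which a product of sums expands.
  \<open>Wide_star\<close> pads with zero functions instead; \<open>card_nonvanishing_le\<close>
  translates.\<close>

definition wide_tuples :: "nat \<Rightarrow> nat \<Rightarrow> (nat \<Rightarrow> complex) \<Rightarrow> (nat \<Rightarrow> (nat \<Rightarrow> complex) set) \<Rightarrow> (nat \<Rightarrow> nat \<Rightarrow> complex) set" where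
  "wide_tuples q m chi A = {g \<in> PiE {..<m} A. \<forall>n. (\<Prod>i<m. g i n) = chi n}"

lemma dirichlet_char_Prod:
  fixes m :: nat
  assumes "m > 0" "\<And>i. i < m \<Longrightarrow> dirichlet_char q (g i)"
  shows "dirichlet_char q (\<lambda>n. \<Prod>i<m. g i n)"
  unfolding dirichlet_char_def
proof (intro conjI allI)
  have g: "dirichlet_char q (g i)" if "i < m" for i using assms that by simp
  show "q > 0" using g[OF assms(1)] by (rule dirichlet_char_pos)
  show "(\<Prod>i<m. g i (n + q)) = (\<Prod>i<m. g i n)" for n
    using g by (intro prod.cong refl) (auto simp: dirichlet_char_def)
  show "(\<Prod>i<m. g i (a * b)) = (\<Prod>i<m. g i a) * (\<Prod>i<m. g i b)" for a b
    unfolding prod.distrib[symmetric] using g by (intro prod.cong refl dirichlet_char_mult) auto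
  show "(\<Prod>i<m. g i 1) = 1" using g by (intro prod.neutral ballI dirichlet_char_1) auto
  show "(\<Prod>i<m. g i n) \<noteq> 0 \<longleftrightarrow> coprime n q" for n
  proof -
    have iff: "g i n \<noteq> 0 \<longleftrightarrow> coprime n q" if "i < m" for i
      using g[OF that] unfolding dirichlet_char_def by blast
    then show ?thesis using assms(1) by auto
  qed
qed

lemma sum_char_cnj_char:
  assumes q: "prime q" and chi: "dirichlet_char q chi" and th: "dirichlet_char q th"
  shows "(\<Sum>b\<in>{1..<q}. chi b * cnj (th b)) = (if \<forall>n. th n = chi n then of_nat (q - 1) else 0)"
proof (cases "\<forall>n. th n = chi n")
  case True
  have "chi b * cnj (th b) = 1" if "b \<in> {1..<q}" for b
  proof -
    have "coprime b q" using coprime_less_prime[OF q, of b] that by simp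
    then have "cmod (chi b) = 1" by (rule norm_dirichlet_char[OF chi])
    then show ?thesis using True complex_norm_square[of "chi b"] by simp
  qed
  then have "(\<Sum>b\<in>{1..<q}. chi b * cnj (th b)) = (\<Sum>b\<in>{1..<q}. 1)" by (intro sum.cong refl) auto
  then show ?thesis using True by simp
next
  case False
  have q1: "q > 1" using q by (rule prime_gt_1_nat)
  have c: "dirichlet_char q (\<lambda>n. chi n * cnj (th n))"
    using chi th unfolding dirichlet_char_def by auto
  obtain n where n: "th n \<noteq> chi n" using False by blast
  have cop: "coprime n q" using n dirichlet_char_eq_0[OF chi, of n] dirichlet_char_eq_0[OF th, of n] by fastforce
  have "chi n * cnj (th n) \<noteq> 1"
  proof
    assume "chi n * cnj (th n) = 1"
    then have "chi n * (cnj (th n) * th n) = th n" by (simp add: mult.assoc[symmetric])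
    moreover have "cnj (th n) * th n = 1"
      using norm_dirichlet_char[OF th cop] complex_norm_square[of "th n"] by (simp add: mult.commute)
    ultimately show False using n by simp
  qed
  then have "(\<Sum>b<q. chi b * cnj (th b)) = 0" using sum_dirichlet_char_eq_0[OF c cop] by simp
  moreover have "(\<Sum>b<q. chi b * cnj (th b)) = (\<Sum>b\<in>{1..<q}. chi b * cnj (th b))"
  proof (rule sum.mono_neutral_right)
    have "chi 0 = 0" using q1 by (intro dirichlet_char_eq_0[OF chi]) auto
    then show "\<forall>i\<in>{..<q} - {1..<q}. chi i * cnj (th i) = 0" by (auto simp: not_le)
  qed auto
  ultimately show ?thesis by (simp only: False if_False)
qed

context
  fixes q m :: nat and l :: "nat \<Rightarrow> nat" and psi :: "nat \<Rightarrow> nat \<Rightarrow> complex" and chi :: "nat \<Rightarrow> complex"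
  assumes q: "prime q" and m: "m \<ge> 3" and prim: "\<And>i. i < m \<Longrightarrow> primitive_char (l i) (psi i)"
    and chi: "dirichlet_char q chi"
begin

definition good where "good i = good_chars q (l i) (psi i)"

definition Lv where "Lv i th = twist_sum (psi i) (l i) q th"

lemma finite_good: "i < m \<Longrightarrow> finite (good i)"
  unfolding good_def by (rule finite_good_chars[OF q prim])

lemma finite_wide_tuples: "finite (wide_tuples q m chi good)"
proof (rule finite_subset)
  show "wide_tuples q m chi good \<subseteq> PiE {..<m} good" by (auto simp: wide_tuples_def)
  show "finite (PiE {..<m} good)" by (intro finite_PiE) (auto intro: finite_good)
qed

text \<open>Expanding the product of class sums gives all tuples of good characters, and summation
  over \<open>b\<close> against \<open>chi\<close> selects those with product \<open>chi\<close>.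
  Normalisation costs \<open>(q - 1)^m\<close>, of which orthogonality returns one factor.\<close>

lemma first_moment:
  "(\<Sum>g\<in>wide_tuples q m chi good. \<Prod>i<m. Lv i (g i)) =
    of_nat (q - 1) ^ (m - 1) * (\<Sum>b\<in>{1..<q}. chi b * (\<Prod>i<m. good_class_sum (psi i) (l i) q b))"
proof -
  define P where "P = PiE {..<m} good"
  have finP: "finite P" unfolding P_def by (intro finite_PiE) (auto intro: finite_good)
  have q1: "of_nat (q - 1) \<noteq> (0 :: complex)" using prime_gt_1_nat[OF q] by simp
  have "(\<Prod>i<m. good_class_sum (psi i) (l i) q b) * of_nat (q - 1) ^ m = (\<Sum>g\<in>P. \<Prod>i<m. Lv i (g i) * cnj (g i b))" for b
  proof -
    have "(\<Prod>i<m. good_class_sum (psi i) (l i) q b) * of_nat (q - 1) ^ m = (\<Prod>i<m. good_class_sum (psi i) (l i) q b * of_nat (q - 1))"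
      by (simp add: prod.distrib)
    also have "\<dots> = (\<Prod>i<m. \<Sum>th\<in>good i. Lv i th * cnj (th b))"
      using q1 by (intro prod.cong refl) (simp add: good_class_sum_def good_def Lv_def)
    also have "\<dots> = (\<Sum>g\<in>P. \<Prod>i<m. Lv i (g i) * cnj (g i b))"
      unfolding P_def by (intro prod_sum_PiE) (auto intro: finite_good)
    finally show ?thesis .
  qed
  then have "(\<Sum>b\<in>{1..<q}. chi b * (\<Prod>i<m. good_class_sum (psi i) (l i) q b)) * of_nat (q - 1) ^ m
      = (\<Sum>b\<in>{1..<q}. chi b * (\<Sum>g\<in>P. \<Prod>i<m. Lv i (g i) * cnj (g i b)))"
    by (simp only: sum_distrib_right mult.assoc)
  also have "\<dots> = (\<Sum>b\<in>{1..<q}. \<Sum>g\<in>P. (\<Prod>i<m. Lv i (g i)) * (chi b * cnj (\<Prod>i<m. g i b)))"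
    by (simp add: sum_distrib_left prod.distrib mult_ac)
  also have "\<dots> = (\<Sum>g\<in>P. (\<Prod>i<m. Lv i (g i)) * (\<Sum>b\<in>{1..<q}. chi b * cnj (\<Prod>i<m. g i b)))"
    by (subst sum.swap) (simp only: sum_distrib_left)
  also have "\<dots> = (\<Sum>g\<in>P. (\<Prod>i<m. Lv i (g i)) * (if \<forall>n. (\<Prod>i<m. g i n) = chi n then of_nat (q - 1) else 0))"
  proof (intro sum.cong refl arg_cong2[of _ _ _ _ "(*)"])
    fix g assume g: "g \<in> P"
    have "dirichlet_char q (\<lambda>n. \<Prod>i<m. g i n)"
    proof (rule dirichlet_char_Prod)
      show "dirichlet_char q (g i)" if "i < m" for i
        using good_chars_char[OF q prim[OF that], of "g i"] PiE_mem[of g "{..<m}" good i] g that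
        by (simp add: P_def good_def)
    qed (use m in auto)
    then show "(\<Sum>b\<in>{1..<q}. chi b * cnj (\<Prod>i<m. g i b)) = (if \<forall>n. (\<Prod>i<m. g i n) = chi n then of_nat (q - 1) else 0)"
      by (rule sum_char_cnj_char[OF q chi])
  qed
  also have "\<dots> = (\<Sum>g\<in>P. if \<forall>n. (\<Prod>i<m. g i n) = chi n then (\<Prod>i<m. Lv i (g i)) * of_nat (q - 1) else 0)"
    by (intro sum.cong refl) auto
  also have "\<dots> = (\<Sum>g\<in>wide_tuples q m chi good. (\<Prod>i<m. Lv i (g i)) * of_nat (q - 1))"
    unfolding wide_tuples_def P_def[symmetric] by (rule sum.inter_filter[OF finP, symmetric])
  also have "\<dots> = (\<Sum>g\<in>wide_tuples q m chi good. \<Prod>i<m. Lv i (g i)) * of_nat (q - 1)"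
    by (rule sum_distrib_right[symmetric])
  finally have e: "(\<Sum>b\<in>{1..<q}. chi b * (\<Prod>i<m. good_class_sum (psi i) (l i) q b)) * of_nat (q - 1) ^ m =
    (\<Sum>g\<in>wide_tuples q m chi good. \<Prod>i<m. Lv i (g i)) * of_nat (q - 1)" .
  have "of_nat (q - 1) ^ m = of_nat (q - 1) ^ (m - 1) * (of_nat (q - 1) :: complex)"
    using m by (cases m) auto
  with e have "((\<Sum>b\<in>{1..<q}. chi b * (\<Prod>i<m. good_class_sum (psi i) (l i) q b)) * of_nat (q - 1) ^ (m - 1)) * of_nat (q - 1) =
    (\<Sum>g\<in>wide_tuples q m chi good. \<Prod>i<m. Lv i (g i)) * of_nat (q - 1)" by (simp only: mult.assoc)
  then show ?thesis using q1 by (simp only: mult_cancel_right mult.commute) simp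
qed

text \<open>With \<open>x = b^(-1/2)\<close> the error at \<open>b\<close> is at most a constant
  times \<open>d * (x^(m-1) + d^(m-1))\<close>. Since \<open>m - 1 \<ge> 2\<close>, the first part
  sums to \<open>d\<close> times a logarithm; the second sums to \<open>q * d^m\<close>, the term
  that decides the range of \<open>q\<close>.\<close>

lemma main_term_lower:
  assumes d: "\<And>i. i < m \<Longrightarrow> 28 * (sqrt (sqrt (real (l i))) * loglen (l i) / sqrt (real q)) \<le> d"
  shows "cmod (\<Sum>b\<in>{1..<q}. chi b * (\<Prod>i<m. good_class_sum (psi i) (l i) q b)) \<ge>
    1 / 10 - 1 / sqrt (real q) - real m * 2 ^ (m - 1) * (d * loglen q + real q * d ^ m)"
proof -
  have q1: "q > 1" using q by (rule prime_gt_1_nat)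
  define a where "a i b = psi i b * of_real (1 / sqrt (real b))" for i b
  define u where "u b = chi b * (\<Prod>i<m. a i b)" for b
  define C where "C = real m * 2 ^ (m - 1)"
  have ch: "dirichlet_char (l i) (psi i)" if "i < m" for i using prim[OF that] by (simp add: primitive_char_def)
  have d0: "d \<ge> 0"
  proof -
    have "28 * (sqrt (sqrt (real (l 0))) * loglen (l 0) / sqrt (real q)) \<le> d" using m by (intro d) auto
    moreover have "loglen (l 0) \<ge> 1" using ch[of 0] m by (intro loglen_ge_1 dirichlet_char_pos) auto
    then have "28 * (sqrt (sqrt (real (l 0))) * loglen (l 0) / sqrt (real q)) \<ge> 0" by simp
    ultimately show ?thesis by linarith
  qed
  have an: "cmod (a i b) \<le> 1 / sqrt (real b)" if "i < m" for i b
  proof -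
    have "cmod (a i b) = cmod (psi i b) * (1 / sqrt (real b))" by (simp add: a_def norm_mult norm_divide)
    also have "\<dots> \<le> 1 * (1 / sqrt (real b))"
      by (intro mult_right_mono norm_dirichlet_char_le[OF ch[OF that]]) auto
    finally show ?thesis by simp
  qed
  have pw: "(1 / sqrt (real b)) ^ n \<le> (1 / sqrt (real b)) ^ k" if "b > 0" "k \<le> n" for b k n
    using that by (intro power_decreasing) auto
  have err: "cmod (chi b * (\<Prod>i<m. good_class_sum (psi i) (l i) q b) - u b) \<le> C * (1 / real b * d + d ^ m)"
    if b: "b \<in> {1..<q}" for b
  proof -
    define x where "x = 1 / sqrt (real b)"
    have x0: "x \<ge> 0" by (simp add: x_def)
    have "cmod (chi b * (\<Prod>i<m. good_class_sum (psi i) (l i) q b) - u b) =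
        cmod (chi b) * cmod ((\<Prod>i<m. good_class_sum (psi i) (l i) q b) - (\<Prod>i<m. a i b))"
      by (simp add: u_def norm_mult[symmetric] right_diff_distrib)
    also have "\<dots> \<le> 1 * cmod ((\<Prod>i<m. good_class_sum (psi i) (l i) q b) - (\<Prod>i<m. a i b))"
      by (intro mult_right_mono norm_dirichlet_char_le[OF chi]) auto
    also have "\<dots> \<le> 1 * (real m * d * (x + d) ^ (m - 1))"
    proof (intro mult_left_mono norm_prod_diff_le)
      fix i assume i: "i < m"
      show "cmod (a i b) \<le> x" unfolding x_def by (rule an[OF i])
      show "cmod (good_class_sum (psi i) (l i) q b - a i b) \<le> d"
        unfolding a_def by (rule order_trans[OF norm_good_class_sum_diff_le[OF q prim[OF i] b] d[OF i]])
    qed (use d0 x0 in auto)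
    also have "\<dots> \<le> 1 * (real m * d * (2 ^ (m - 1) * (x ^ (m - 1) + d ^ (m - 1))))"
      using d0 x0 by (intro mult_left_mono add_power_le) auto
    also have "\<dots> = C * (x ^ (m - 1) * d + d ^ (m - 1) * d)" by (simp add: C_def algebra_simps)
    also have "d ^ (m - 1) * d = d ^ m" using m by (cases m) auto
    also have "C * (x ^ (m - 1) * d + d ^ m) \<le> C * (x ^ 2 * d + d ^ m)"
      unfolding x_def using m b d0 pw[of b 2 "m - 1"]
      by (intro mult_left_mono add_right_mono mult_right_mono) (auto simp: C_def)
    also have "x ^ 2 = 1 / real b" by (simp add: x_def power_divide)
    finally show ?thesis .
  qed
  have "cmod ((\<Sum>b\<in>{1..<q}. chi b * (\<Prod>i<m. good_class_sum (psi i) (l i) q b)) - (\<Sum>b\<in>{1..<q}. u b))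
     \<le> (\<Sum>b\<in>{1..<q}. C * (1 / real b * d + d ^ m))"
    unfolding sum_subtractf[symmetric] by (intro sum_norm_le err)
  also have "\<dots> = C * ((\<Sum>b\<in>{1..<q}. 1 / real b) * d + real (q - 1) * d ^ m)"
    by (simp add: sum_distrib_left[symmetric] sum.distrib sum_distrib_right)
  also have "\<dots> \<le> C * (loglen q * d + real q * d ^ m)"
  proof (intro mult_left_mono add_mono mult_right_mono)
    have "(\<Sum>b\<in>{1..<q}. 1 / real b) \<le> (\<Sum>b=1..q. 1 / real b)" by (intro sum_mono2) auto
    also have "\<dots> \<le> loglen q" unfolding loglen_def using q1 by (intro sum_inverse_le_ln) auto
    finally show "(\<Sum>b\<in>{1..<q}. 1 / real b) \<le> loglen q" .
  qed (use d0 in \<open>auto simp: C_def\<close>)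
  finally have e: "cmod ((\<Sum>b\<in>{1..<q}. chi b * (\<Prod>i<m. good_class_sum (psi i) (l i) q b)) - (\<Sum>b\<in>{1..<q}. u b))
     \<le> C * (d * loglen q + real q * d ^ m)" by (simp only: mult.commute[of d])
  have main: "cmod (\<Sum>b\<in>{1..<q}. u b) \<ge> 1 / 10 - 1 / sqrt (real q)"
  proof (rule multiplicative_sum_lower[OF _ _ _ q1])
    fix b
    have "a i (2 * b) = a i 2 * a i b" if "i < m" for i
      by (simp add: a_def dirichlet_char_mult[OF ch[OF that]] real_sqrt_mult)
    then have "(\<Prod>i<m. a i (2 * b)) = (\<Prod>i<m. a i 2 * a i b)" by (intro prod.cong) auto
    then show "u (2 * b) = u 2 * u b"
      by (simp add: u_def dirichlet_char_mult[OF chi] prod.distrib)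
  next
    have "a i 1 = 1" if "i < m" for i
      using dirichlet_char_1[OF ch[OF that]] by (simp add: a_def)
    then have "(\<Prod>i<m. a i 1) = 1" by (intro prod.neutral) auto
    then show "u 1 = 1" using dirichlet_char_1[OF chi] by (simp only: u_def mult_1_right)
  next
    fix b :: nat assume b: "b > 0"
    have "cmod (u b) \<le> 1 * (1 / sqrt (real b)) ^ m"
      unfolding u_def norm_mult
    proof (intro mult_mono norm_dirichlet_char_le[OF chi])
      have "cmod (\<Prod>i<m. a i b) = (\<Prod>i<m. cmod (a i b))" by (simp add: prod_norm)
      also have "\<dots> \<le> (\<Prod>i<m. 1 / sqrt (real b))" using an by (intro prod_mono) auto
      finally show "cmod (\<Prod>i<m. a i b) \<le> (1 / sqrt (real b)) ^ m" by simp
    qed auto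
    also have "\<dots> \<le> (1 / sqrt (real b)) ^ 3" using pw[OF b m] by simp
    also have "\<dots> = 1 / (real b * sqrt (real b))" by (simp add: power3_eq_cube)
    finally show "cmod (u b) \<le> 1 / (real b * sqrt (real b))" .
  qed
  have tri: "cmod U \<le> cmod V + cmod (V - U)" for U V :: complex
    using norm_triangle_sub[of U V] by (simp add: norm_minus_commute)
  have "cmod (\<Sum>b\<in>{1..<q}. u b) \<le> cmod (\<Sum>b\<in>{1..<q}. chi b * (\<Prod>i<m. good_class_sum (psi i) (l i) q b)) +
    cmod ((\<Sum>b\<in>{1..<q}. chi b * (\<Prod>i<m. good_class_sum (psi i) (l i) q b)) - (\<Sum>b\<in>{1..<q}. u b))"
    by (rule tri)
  with main e show ?thesis unfolding C_def[symmetric] by linarith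
qed

text \<open>The product condition recovers the last character from the others, so forgetting it is
  injective. The last factor is bounded by \<open>P\<close>, and the rest extends to a sum over all
  free tuples, which factorises.\<close>

lemma sum_wide_tuples_sq_le:
  assumes P: "\<And>th. th \<in> good (m - 1) \<Longrightarrow> (cmod (Lv (m - 1) th))\<^sup>2 \<le> P" and P0: "P \<ge> 0"
    and M: "\<And>i. i < m - 1 \<Longrightarrow> (\<Sum>th\<in>chars q. (cmod (Lv i th))\<^sup>2) \<le> M"
  shows "(\<Sum>g\<in>wide_tuples q m chi good. \<Prod>i<m. (cmod (Lv i (g i)))\<^sup>2) \<le> P * M ^ (m - 1)"
proof -
  define k where "k = m - 1"
  have mk: "m = Suc k" using m by (simp add: k_def)
  define W where "W = wide_tuples q m chi good"
  define r where "r g = restrict g {..<k}" for g :: "nat \<Rightarrow> nat \<Rightarrow> complex"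
  have gd: "g i \<in> good i" if "g \<in> W" "i < m" for g i
    using that by (auto simp: W_def wide_tuples_def)
  have ch: "dirichlet_char q (g i)" if "g \<in> W" "i < m" for g i
    using good_chars_char[OF q prim[OF that(2)]] gd[OF that] by (simp add: good_def)
  have inj: "inj_on r W"
  proof (rule inj_onI)
    fix g h assume gh: "g \<in> W" "h \<in> W" "r g = r h"
    have lt: "g i = h i" if "i < k" for i
      using fun_cong[OF gh(3), of i] that by (simp add: r_def)
    have "g k n = h k n" for n
    proof (cases "coprime n q")
      case True
      have "(\<Prod>i<k. g i n) * g k n = chi n" "(\<Prod>i<k. h i n) * h k n = chi n"
        using gh(1,2) by (auto simp: W_def wide_tuples_def mk)
      moreover have "(\<Prod>i<k. g i n) = (\<Prod>i<k. h i n)" using lt by (intro prod.cong) auto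
      moreover have "chi n \<noteq> 0" using chi True by (simp add: dirichlet_char_def)
      ultimately show ?thesis by (metis mult_cancel_left mult_zero_left)
    next
      case False
      then show ?thesis using dirichlet_char_eq_0[OF ch[OF gh(1)], of k n] dirichlet_char_eq_0[OF ch[OF gh(2)], of k n]
        by (simp add: mk)
    qed
    then have "g i = h i" if "i < m" for i using lt[of i] that by (cases "i = k") (auto simp: mk)
    moreover have "g \<in> PiE {..<m} good" "h \<in> PiE {..<m} good" using gh by (auto simp: W_def wide_tuples_def)
    ultimately show "g = h" by (intro PiE_ext) auto
  qed
  have "(\<Sum>g\<in>W. \<Prod>i<m. (cmod (Lv i (g i)))\<^sup>2) \<le> (\<Sum>g\<in>W. P * (\<Prod>i<k. (cmod (Lv i (r g i)))\<^sup>2))"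
  proof (intro sum_mono)
    fix g assume g: "g \<in> W"
    have "(\<Prod>i<m. (cmod (Lv i (g i)))\<^sup>2) = (\<Prod>i<k. (cmod (Lv i (r g i)))\<^sup>2) * (cmod (Lv k (g k)))\<^sup>2"
      by (simp add: mk r_def)
    also have "\<dots> \<le> (\<Prod>i<k. (cmod (Lv i (r g i)))\<^sup>2) * P"
      using P[of "g k"] gd[OF g, of k] by (intro mult_left_mono prod_nonneg) (auto simp: mk)
    finally show "(\<Prod>i<m. (cmod (Lv i (g i)))\<^sup>2) \<le> P * (\<Prod>i<k. (cmod (Lv i (r g i)))\<^sup>2)"
      by (simp add: mult.commute)
  qed
  also have "\<dots> = P * (\<Sum>h\<in>r ` W. \<Prod>i<k. (cmod (Lv i (h i)))\<^sup>2)"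
    by (simp add: sum_distrib_left sum.reindex[OF inj])
  also have "\<dots> \<le> P * (\<Sum>h\<in>PiE {..<k} good. \<Prod>i<k. (cmod (Lv i (h i)))\<^sup>2)"
  proof (intro mult_left_mono P0 sum_mono2)
    show "finite (PiE {..<k} good)" by (intro finite_PiE) (auto intro: finite_good simp: mk)
    show "r ` W \<subseteq> PiE {..<k} good" using gd by (auto simp: r_def mk)
    show "0 \<le> (\<Prod>i<k. (cmod (Lv i (h i)))\<^sup>2)" for h by (intro prod_nonneg) auto
  qed
  also have "(\<Sum>h\<in>PiE {..<k} good. \<Prod>i<k. (cmod (Lv i (h i)))\<^sup>2) = (\<Prod>i<k. \<Sum>th\<in>good i. (cmod (Lv i th))\<^sup>2)"
    by (rule prod_sum_PiE[symmetric]) (auto intro: finite_good simp: mk)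
  also have "\<dots> \<le> (\<Prod>i<k. M)"
  proof (intro prod_mono conjI)
    fix i assume i: "i \<in> {..<k}"
    have "finite (chars q)" unfolding chars_def by (rule sum_chars_orthogonal(1)[OF q])
    then have "(\<Sum>th\<in>good i. (cmod (Lv i th))\<^sup>2) \<le> (\<Sum>th\<in>chars q. (cmod (Lv i th))\<^sup>2)"
      by (intro sum_mono2) (auto simp: good_def good_chars_def)
    also have "\<dots> \<le> M" using i by (intro M) (simp add: k_def)
    finally show "(\<Sum>th\<in>good i. (cmod (Lv i th))\<^sup>2) \<le> M" .
  qed (auto intro: sum_nonneg)
  finally show ?thesis using P0 by (simp add: W_def k_def mult_left_mono)
qed

text \<open>Padding with zero functions is an injection into the target set. Finiteness of the
  target is proved because \<open>card\<close> of an infinite set would be 0.\<close>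

lemma card_nonvanishing_le:
  "card {g \<in> wide_tuples q m chi good. (\<Prod>i<m. Lv i (g i)) \<noteq> 0} \<le>
   card {t \<in> Wide_star q m chi. (\<Prod>i<m. dirichlet_L (\<lambda>n. psi i n * t i n) (1/2)) \<noteq> 0}"
proof -
  define e where "e g = (\<lambda>i. if i < m then g i else (\<lambda>_. 0))" for g :: "nat \<Rightarrow> nat \<Rightarrow> complex"
  define N where "N = {g \<in> wide_tuples q m chi good. (\<Prod>i<m. Lv i (g i)) \<noteq> 0}"
  define T where "T = {t \<in> Wide_star q m chi. (\<Prod>i<m. dirichlet_L (\<lambda>n. psi i n * t i n) (1/2)) \<noteq> 0}"
  have "finite (chars q)" unfolding chars_def by (rule sum_chars_orthogonal(1)[OF q])
  then have "finite (PiE {..<m} (\<lambda>_. chars q))" by (intro finite_PiE) auto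
  moreover have "T \<subseteq> e ` PiE {..<m} (\<lambda>_. chars q)"
  proof
    fix t assume "t \<in> T"
    then have t: "\<forall>i<m. primitive_char q (t i)" "\<forall>i\<ge>m. t i = (\<lambda>_. 0)"
      by (auto simp: T_def Wide_star_def)
    have "t = e (restrict t {..<m})" using t(2) by (auto simp: e_def fun_eq_iff)
    moreover have "restrict t {..<m} \<in> PiE {..<m} (\<lambda>_. chars q)"
      using t(1) by (auto simp: chars_def primitive_char_def)
    ultimately show "t \<in> e ` PiE {..<m} (\<lambda>_. chars q)" by blast
  qed
  ultimately have finT: "finite T" by (meson finite_imageI finite_subset)
  have inj: "inj_on e N"
  proof (rule inj_onI)
    fix g h assume gh: "g \<in> N" "h \<in> N" "e g = e h"
    have "g i = h i" if "i < m" for i using fun_cong[OF gh(3), of i] that by (simp add: e_def)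
    moreover have "g \<in> PiE {..<m} good" "h \<in> PiE {..<m} good" using gh by (auto simp: N_def wide_tuples_def)
    ultimately show "g = h" by (intro PiE_ext) auto
  qed
  have "e ` N \<subseteq> T"
  proof (rule image_subsetI)
    fix g assume g: "g \<in> N"
    have gd: "g i \<in> good_chars q (l i) (psi i)" if "i < m" for i
      using g that by (auto simp: N_def wide_tuples_def good_def)
    have "(\<Prod>i<m. dirichlet_L (\<lambda>n. psi i n * e g i n) (1/2)) = (\<Prod>i<m. Lv i (g i))"
      using twist_sum_good[OF q prim gd] by (intro prod.cong) (auto simp: Lv_def e_def)
    then have nz: "(\<Prod>i<m. dirichlet_L (\<lambda>n. psi i n * e g i n) (1/2)) \<noteq> 0"
      using g unfolding N_def by (simp only: mem_Collect_eq) simp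
    have "primitive_char q (e g i)" if "i < m" for i
      using good_chars_primitive[OF q prim gd] that by (simp add: e_def)
    moreover have "(\<Prod>i<m. e g i n) = chi n" for n
    proof -
      have "(\<Prod>i<m. e g i n) = (\<Prod>i<m. g i n)" by (intro prod.cong) (auto simp: e_def)
      then show ?thesis using g by (simp add: N_def wide_tuples_def)
    qed
    moreover have "e g i = (\<lambda>_. 0)" if "i \<ge> m" for i using that by (simp add: e_def)
    ultimately have "e g \<in> Wide_star q m chi" unfolding Wide_star_def by blast
    with nz show "e g \<in> T" unfolding T_def by blast
  qed
  then have "card N \<le> card T" by (rule card_inj_on_le[OF inj _ finT])
  then show ?thesis by (simp only: N_def T_def)
qed

lemma card_nonvanishing_lower:
  assumes L: "\<And>i. i < m \<Longrightarrow> l i \<le> L" and Lam: "loglen (L * q) \<le> Lam"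
    and s: "0 \<le> s" "s \<le> cmod (\<Sum>b\<in>{1..<q}. chi b * (\<Prod>i<m. good_class_sum (psi i) (l i) q b))"
  shows "s\<^sup>2 * real (q - 1) ^ (2 * (m - 1)) \<le>
    real (card {t \<in> Wide_star q m chi. (\<Prod>i<m. dirichlet_L (\<lambda>n. psi i n * t i n) (1/2)) \<noteq> 0}) *
    (66 * Lam\<^sup>2 * sqrt (real L * real q) * (66 * Lam\<^sup>2 * real q * max 1 (sqrt (real L / real q))) ^ (m - 1))"
proof -
  define W where "W = wide_tuples q m chi good"
  define N where "N = {g \<in> W. (\<Prod>i<m. Lv i (g i)) \<noteq> 0}"
  define D where "D = 66 * Lam\<^sup>2 * sqrt (real L * real q) * (66 * Lam\<^sup>2 * real q * max 1 (sqrt (real L / real q))) ^ (m - 1)"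
  have q1: "q > 1" using q by (rule prime_gt_1_nat)
  have l0: "l i > 0" if "i < m" for i using l_gt_0[OF q prim[OF that]] .
  have L0: "L > 0" using L[of 0] l0[of 0] m by simp
  have finW: "finite W" unfolding W_def by (rule finite_wide_tuples)
  have mono: "loglen x \<le> Lam" if "0 < x" "x \<le> L * q" for x
  proof -
    have "real x \<le> real (L * q)" using that by (simp only: of_nat_le_iff)
    then have "loglen x \<le> loglen (L * q)" using that unfolding loglen_def by simp
    then show ?thesis using Lam by linarith
  qed
  have lam_l: "loglen (l i) \<le> Lam" and lam_lq: "loglen (l i * q) \<le> Lam" if "i < m" for i
  proof -
    have "l i * 1 \<le> L * q" using L[OF that] q1 by (intro mult_le_mono) auto
    then show "loglen (l i) \<le> Lam" using l0[OF that] by (intro mono) auto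
    show "loglen (l i * q) \<le> Lam" using l0[OF that] L[OF that] q1 by (intro mono) auto
  qed
  have lam_q: "loglen q \<le> Lam"
    using q1 L0 by (intro mono) auto
  have Y: "sqrt (real (l i) / real q) \<le> sqrt (real L / real q)" if "i < m" for i
    using L[OF that] by (intro real_sqrt_le_mono divide_right_mono) auto
  have sq: "(\<Sum>g\<in>W. \<Prod>i<m. (cmod (Lv i (g i)))\<^sup>2) \<le> D"
    unfolding W_def D_def
  proof (rule sum_wide_tuples_sq_le)
    fix th assume th: "th \<in> good (m - 1)"
    have i: "m - 1 < m" using m by simp
    have "(cmod (Lv (m - 1) th))\<^sup>2 \<le> 66 * Lam\<^sup>2 * sqrt (real (l (m - 1)) * real q)"
      unfolding Lv_def using th by (intro norm_twist_sum_sq_le[OF q prim[OF i]] lam_lq i) (simp add: good_def)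
    also have "\<dots> \<le> 66 * Lam\<^sup>2 * sqrt (real L * real q)"
      using L[OF i] by (intro mult_left_mono real_sqrt_le_mono mult_right_mono) auto
    finally show "(cmod (Lv (m - 1) th))\<^sup>2 \<le> 66 * Lam\<^sup>2 * sqrt (real L * real q)" .
  next
    fix i assume "i < m - 1"
    then have i: "i < m" by simp
    have "(\<Sum>th\<in>chars q. (cmod (Lv i th))\<^sup>2) \<le> 66 * Lam\<^sup>2 * real q * max 1 (sqrt (real (l i) / real q))"
      unfolding Lv_def by (rule twist_sum_second_moment[OF q prim[OF i] lam_l[OF i] lam_q])
    also have "\<dots> \<le> 66 * Lam\<^sup>2 * real q * max 1 (sqrt (real L / real q))"
      by (intro mult_left_mono max.mono order_refl Y[OF i]) auto
    finally show "(\<Sum>th\<in>chars q. (cmod (Lv i th))\<^sup>2) \<le> 66 * Lam\<^sup>2 * real q * max 1 (sqrt (real L / real q))" .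
  qed auto
  have "s * real (q - 1) ^ (m - 1) \<le> cmod (\<Sum>g\<in>W. \<Prod>i<m. Lv i (g i))"
    unfolding W_def first_moment norm_mult norm_power norm_of_nat
    using mult_right_mono[OF s(2), of "real (q - 1) ^ (m - 1)"] by (simp only: mult.commute zero_le_power of_nat_0_le_iff)
  also have "(\<Sum>g\<in>W. \<Prod>i<m. Lv i (g i)) = (\<Sum>g\<in>N. \<Prod>i<m. Lv i (g i))"
    unfolding N_def using finW by (intro sum.mono_neutral_right) auto
  also have "cmod \<dots> \<le> (\<Sum>g\<in>N. cmod (\<Prod>i<m. Lv i (g i)) * 1)"
    by (rule order_trans[OF norm_sum]) simp
  finally have "(s * real (q - 1) ^ (m - 1))\<^sup>2 \<le> (\<Sum>g\<in>N. cmod (\<Prod>i<m. Lv i (g i)) * 1)\<^sup>2"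
    using s by (intro power_mono) auto
  also have "\<dots> \<le> (\<Sum>g\<in>N. (cmod (\<Prod>i<m. Lv i (g i)))\<^sup>2) * (\<Sum>g\<in>N. 1\<^sup>2)"
    by (rule Cauchy_Schwarz_ineq_sum)
  also have "\<dots> = real (card N) * (\<Sum>g\<in>N. \<Prod>i<m. (cmod (Lv i (g i)))\<^sup>2)"
    by (simp add: prod_norm[symmetric] prod_power_distrib)
  also have "\<dots> \<le> real (card N) * (\<Sum>g\<in>W. \<Prod>i<m. (cmod (Lv i (g i)))\<^sup>2)"
    using finW by (intro mult_left_mono sum_mono2 prod_nonneg) (auto simp: N_def)
  also have "\<dots> \<le> real (card N) * D" by (intro mult_left_mono sq) auto
  also have "\<dots> \<le> real (card {t \<in> Wide_star q m chi. (\<Prod>i<m. dirichlet_L (\<lambda>n. psi i n * t i n) (1/2)) \<noteq> 0}) * D"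
    using card_nonvanishing_le by (intro mult_right_mono) (auto simp: N_def W_def D_def)
  finally show ?thesis by (simp add: D_def power_mult_distrib power_mult[symmetric] mult.commute)
qed

end

section \<open>The count of nonvanishing tuples\<close>

text \<open>Source of the constant \<open>K\<close>: from \<open>ln y \<le> y - 1\<close> at
  \<open>y = x powr t\<close> follows \<open>ln x \<le> x powr t / t\<close>.\<close>

lemma one_plus_ln_le_powr:
  assumes "x \<ge> 1" "t > 0"
  shows "1 + 3 * ln x \<le> (1 + 3 / t) * x powr (t :: real)"
proof -
  have "ln (x powr t) \<le> x powr t - 1" using assms by (intro ln_le_minus_one) auto
  then have "t * ln x \<le> x powr t" using assms by (simp add: ln_powr)
  then have "ln x \<le> x powr t / t" using assms by (simp add: field_simps)
  moreover have "1 \<le> x powr t" using assms by (simp add: ge_one_powr_ge_zero)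
  ultimately have "1 + 3 * ln x \<le> x powr t + 3 * (x powr t / t)" by linarith
  also have "\<dots> = (1 + 3 / t) * x powr t" by (simp add: algebra_simps)
  finally show ?thesis .
qed

text \<open>For \<open>R \<le> Q\<close> the maximum is 1 and the claim is
  \<open>1/2 \<le> m/6\<close>. For \<open>R > Q\<close>, in logarithms \<open>a\<close> and
  \<open>b\<close>, six times the difference of the exponents is
  \<open>2 * ((2m-4) * b - m * a) + 2 * b\<close>, nonnegative by the threshold condition.\<close>

lemma moment_exponent_le:
  fixes R Q :: real
  assumes "m \<ge> 3" "R \<ge> 1" "Q \<ge> 1" "R powr (real m / (2 * real m - 4)) \<le> Q"
  shows "sqrt (R * Q) * max 1 (sqrt (R / Q)) ^ (m - 1) \<le> (R * Q) powr (real m / 6)"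
proof (cases "R \<le> Q")
  case True
  then have "sqrt (R / Q) \<le> 1" using assms by simp
  then have "sqrt (R * Q) * max 1 (sqrt (R / Q)) ^ (m - 1) = sqrt (R * Q)" by (simp add: max_def)
  also have "\<dots> = (R * Q) powr (1 / 2)" using assms by (simp add: powr_half_sqrt)
  also have "\<dots> \<le> (R * Q) powr (real m / 6)"
  proof (rule powr_mono)
    have "1 * 1 \<le> R * Q" using assms by (intro mult_mono) auto
    then show "1 \<le> R * Q" by simp
  qed (use assms in auto)
  finally show ?thesis .
next
  case False
  define a b where "a = ln R" and "b = ln Q"
  have R: "R = exp a" and Q: "Q = exp b" using assms by (simp_all add: a_def b_def)
  have b0: "b \<ge> 0" using assms by (simp add: b_def)
  have ab: "real m * a \<le> (2 * real m - 4) * b"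
  proof -
    have "exp (real m / (2 * real m - 4) * a) \<le> exp b" using assms(4) by (simp add: R Q powr_def)
    then have "real m / (2 * real m - 4) * a \<le> b" by simp
    moreover have pos: "2 * real m - 4 > 0" using assms(1) by simp
    ultimately show ?thesis by (simp add: divide_le_eq mult.commute)
  qed
  have m1: "real (m - 1) = real m - 1" using assms(1) by simp
  have half: "sqrt (exp x) = exp (x / 2)" for x :: real
    by (rule real_sqrt_unique) (simp_all add: power2_eq_square exp_add[symmetric])
  have "1 \<le> sqrt (R / Q)" using False assms by simp
  then have "max 1 (sqrt (R / Q)) = exp ((a - b) / 2)" by (simp add: max_def R Q exp_diff[symmetric] half)
  then have "sqrt (R * Q) * max 1 (sqrt (R / Q)) ^ (m - 1) = exp ((a + b) / 2) * exp (real (m - 1) * ((a - b) / 2))"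
    by (simp only: R Q exp_add[symmetric] half exp_of_nat_mult)
  also have "\<dots> = exp ((a + b) / 2 + (real m - 1) * ((a - b) / 2))" by (simp only: m1 exp_add)
  also have "\<dots> \<le> exp (real m / 6 * (a + b))"
  proof -
    have "0 \<le> 2 * ((2 * real m - 4) * b - real m * a) + 2 * b" using ab b0 by simp
    also have "\<dots> = real m * (a + b) - (3 * (a + b) + 3 * (real m - 1) * (a - b))"
      by (simp add: algebra_simps)
    finally have "3 * (a + b) + 3 * (real m - 1) * (a - b) \<le> real m * (a + b)"
      by (simp only: diff_ge_0_iff_ge)
    then have "(3 * (a + b) + 3 * (real m - 1) * (a - b)) / 6 \<le> real m * (a + b) / 6"
      by (rule divide_right_mono) simp
    then show ?thesis by (simp add: field_simps)
  qed
  also have "\<dots> = (R * Q) powr (real m / 6)" by (simp add: R Q exp_add[symmetric] powr_def)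
  finally show ?thesis .
qed

text \<open>These are the errors of \<open>main_term_lower\<close> after inserting the bound for
  \<open>d\<close> in powers of \<open>q\<close>; all exponents are negative.\<close>

lemma error_terms_small:
  fixes K eta :: real
  assumes "eta > 0" "m > (0 :: nat)"
  shows "\<exists>q0 \<ge> 2. \<forall>x \<ge> q0. 1 / sqrt x + real m * 2 ^ (m - 1) *
     (28 * K\<^sup>2 * x powr (- 1 / real m) + (28 * K) ^ m * x powr (- real m * eta / 2)) \<le> 1 / 20"
proof -
  have l1: "((\<lambda>x :: real. x powr (- 1 / 2)) \<longlongrightarrow> 0) at_top" by (rule tendsto_neg_powr) (auto intro: filterlim_ident)
  have l2: "((\<lambda>x :: real. x powr (- 1 / real m)) \<longlongrightarrow> 0) at_top"
    using assms by (intro tendsto_neg_powr filterlim_ident) auto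
  have l3: "((\<lambda>x :: real. x powr (- real m * eta / 2)) \<longlongrightarrow> 0) at_top"
    using assms by (intro tendsto_neg_powr filterlim_ident) auto
  have "((\<lambda>x :: real. x powr (- 1 / 2) + real m * 2 ^ (m - 1) *
     (28 * K\<^sup>2 * x powr (- 1 / real m) + (28 * K) ^ m * x powr (- real m * eta / 2))) \<longlongrightarrow>
     0 + real m * 2 ^ (m - 1) * (28 * K\<^sup>2 * 0 + (28 * K) ^ m * 0)) at_top"
    by (intro tendsto_add tendsto_mult tendsto_const l1 l2 l3)
  then have lim: "((\<lambda>x :: real. x powr (- 1 / 2) + real m * 2 ^ (m - 1) *
     (28 * K\<^sup>2 * x powr (- 1 / real m) + (28 * K) ^ m * x powr (- real m * eta / 2))) \<longlongrightarrow> 0) at_top"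
    by simp
  have "eventually (\<lambda>x :: real. x powr (- 1 / 2) + real m * 2 ^ (m - 1) *
     (28 * K\<^sup>2 * x powr (- 1 / real m) + (28 * K) ^ m * x powr (- real m * eta / 2)) < 1 / 20) at_top"
    using order_tendstoD(2)[OF lim, of "1 / 20"] by simp
  then obtain q1 where q1: "\<And>x. x \<ge> q1 \<Longrightarrow> x powr (- 1 / 2) + real m * 2 ^ (m - 1) *
     (28 * K\<^sup>2 * x powr (- 1 / real m) + (28 * K) ^ m * x powr (- real m * eta / 2)) < 1 / 20"
    by (auto simp: eventually_at_top_linorder)
  show ?thesis
  proof (intro exI[of _ "max 2 q1"] conjI allI impI)
    fix x assume x: "x \<ge> max 2 q1"
    then have "1 / sqrt x = x powr (- 1 / 2)" by (simp add: powr_minus_divide powr_half_sqrt)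
    then show "1 / sqrt x + real m * 2 ^ (m - 1) *
     (28 * K\<^sup>2 * x powr (- 1 / real m) + (28 * K) ^ m * x powr (- real m * eta / 2)) \<le> 1 / 20"
      using q1[of x] x by simp
  qed simp
qed

text \<open>\<open>L\<close> is at most \<open>q^(1/beta)\<close>, so \<open>1 / (4 * beta)\<close>
  is the exponent of \<open>L^(1/4)\<close>, and \<open>eta\<close> is the margin by which
  \<open>d\<close> stays below \<open>q^(-1/m)\<close>; it is positive exactly when
  \<open>beta\<close> exceeds \<open>m / (2m-4)\<close>. With \<open>tau\<close>, logarithms cost at
  most \<open>q^(eta/2)\<close> in \<open>d\<close> and \<open>q^eps\<close> in the second
  moment.\<close>

lemma nonvanishing_count:
  fixes m q :: nat and eps C :: real
  defines "beta \<equiv> real m / (2 * real m - 4) + eps"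
  defines "eta \<equiv> 1 / 2 - 1 / real m - 1 / (4 * beta)"
  defines "tau \<equiv> min (eta / 2) (eps / (2 * real m))"
  defines "K \<equiv> 1 + 3 / tau"
  assumes m: "m \<ge> 3" and eps: "eps > 0" and eta: "eta > 0" and tau: "tau > 0"
    and prim: "\<And>i. i < m \<Longrightarrow> primitive_char (ell i) (psi i)" and q: "prime q" and chi: "dirichlet_char q chi"
    and Lq: "real L powr beta \<le> real q" and L: "\<And>i. i < m \<Longrightarrow> ell i \<le> L"
    and small: "1 / sqrt (real q) + real m * 2 ^ (m - 1) *
     (28 * K\<^sup>2 * real q powr (- 1 / real m) + (28 * K) ^ m * real q powr (- real m * eta / 2)) \<le> 1 / 20"
  shows "real (card {t \<in> Wide_star q m chi. (\<Prod>i<m. dirichlet_L (\<lambda>n. psi i n * t i n) (1/2)) \<noteq> 0})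
     \<ge> (1 / 20)\<^sup>2 / (4 ^ (m - 1) * 66 ^ m * K ^ (2 * m)) * real q powr (5 * real m / 6 - 1 - eps) * real L powr (- real m / 6)"
proof -
  define N where "N = real (card {t \<in> Wide_star q m chi. (\<Prod>i<m. dirichlet_L (\<lambda>n. psi i n * t i n) (1/2)) \<noteq> 0})"
  define Q where "Q = real q"
  define R where "R = real L"
  \<comment> \<open>The factor 3 is legitimate because \<open>beta \<ge> 1/2\<close> forces
    \<open>R \<le> Q^2\<close>, hence \<open>ln (R * Q) \<le> 3 * ln Q\<close>.\<close>
  define Lam where "Lam = 1 + 3 * ln Q"
  define d where "d = 28 * (sqrt (sqrt R) * Lam / sqrt Q)"
  define Y where "Y = max 1 (sqrt (R / Q))"
  have q1: "q > 1" using q by (rule prime_gt_1_nat)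
  have Q: "Q \<ge> 2" using q1 by (simp add: Q_def)
  have l0: "ell i > 0" if "i < m" for i using l_gt_0[OF q prim[OF that]] .
  have "L > 0" using L[of 0] l0[of 0] m by simp
  then have R: "R \<ge> 1" by (simp add: R_def)
  have m4: "2 * real m - 4 > 0" using m by simp
  have half: "1 / 2 \<le> real m / (2 * real m - 4)" using m4 by (simp add: field_simps)
  have beta1: "beta \<ge> 1 / 2" unfolding beta_def using half eps by linarith
  then have beta: "beta \<ge> 1 / 2" "beta > 0" by linarith+
  have RQ: "R powr beta \<le> Q" using Lq by (simp add: R_def Q_def)
  have R_le: "R \<le> Q powr (1 / beta)"
  proof -
    have "R = (R powr beta) powr (1 / beta)" using R beta by (simp add: powr_powr)
    also have "\<dots> \<le> Q powr (1 / beta)" using RQ beta by (intro powr_mono2) auto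
    finally show ?thesis .
  qed
  have "1 / beta \<le> 2" using beta by (simp add: divide_le_eq)
  then have "Q powr (1 / beta) \<le> Q powr 2" using Q by (intro powr_mono) auto
  then have R2: "R \<le> Q ^ 2" using R_le Q by (simp add: powr_realpow)
  have lnR: "ln R \<le> 2 * ln Q"
  proof -
    have "ln R \<le> ln (Q ^ 2)" using R2 R Q by simp
    then show ?thesis using Q by (simp add: ln_realpow)
  qed
  have Lam_lq: "loglen (L * q) \<le> Lam"
    using lnR R Q by (simp add: loglen_def Lam_def R_def Q_def ln_mult)
  have lnQ: "ln Q \<ge> 0" "ln R \<ge> 0" using Q R by simp_all
  have Lam1: "Lam \<ge> 1" using lnQ by (simp add: Lam_def)
  have K1: "K \<ge> 1" using tau by (simp add: K_def)
  have LamK: "Lam \<le> K * Q powr tau" unfolding Lam_def K_def using Q tau by (intro one_plus_ln_le_powr) auto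
  have Lam_eta: "Lam \<le> K * Q powr (eta / 2)"
  proof -
    have "Q powr tau \<le> Q powr (eta / 2)" using Q by (intro powr_mono) (auto simp: tau_def)
    then show ?thesis using LamK K1 by (meson mult_left_mono order_trans zero_le_one)
  qed
  have Lam_eps: "Lam ^ (2 * m) \<le> K ^ (2 * m) * Q powr eps"
  proof -
    have "Q powr tau \<le> Q powr (eps / (2 * real m))" using Q by (intro powr_mono) (auto simp: tau_def)
    then have "Lam \<le> K * Q powr (eps / (2 * real m))" using LamK K1 by (meson mult_left_mono order_trans zero_le_one)
    then have "Lam ^ (2 * m) \<le> (K * Q powr (eps / (2 * real m))) ^ (2 * m)"
      using Lam1 by (intro power_mono) auto
    also have "\<dots> = K ^ (2 * m) * (Q powr (eps / (2 * real m))) ^ (2 * m)" by (rule power_mult_distrib)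
    also have "(Q powr (eps / (2 * real m))) ^ (2 * m) = Q powr (real (2 * m) * (eps / (2 * real m)))"
      using Q by (subst powr_power) (auto simp: mult.commute)
    also have "real (2 * m) * (eps / (2 * real m)) = eps" using m by simp
    finally show ?thesis .
  qed
  have d0: "d \<ge> 0" unfolding d_def using Lam1 R Q
    by (intro mult_nonneg_nonneg divide_nonneg_nonneg) auto
  have dle: "d \<le> 28 * K * Q powr (- 1 / real m - eta / 2)"
  proof -
    have "sqrt (sqrt R) = R powr (1 / 4)"
      using R by (simp add: powr_half_sqrt[symmetric] powr_powr)
    also have "\<dots> \<le> (Q powr (1 / beta)) powr (1 / 4)" using R R_le by (intro powr_mono2) auto
    also have "\<dots> = Q powr (1 / (4 * beta))" by (simp add: powr_powr mult.commute)
    finally have "sqrt (sqrt R) * Lam \<le> Q powr (1 / (4 * beta)) * (K * Q powr (eta / 2))"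
      using Lam_eta Lam1 by (intro mult_mono) auto
    then have "d \<le> 28 * (Q powr (1 / (4 * beta)) * (K * Q powr (eta / 2)) / sqrt Q)"
      unfolding d_def by (intro mult_left_mono divide_right_mono) (use Q in auto)
    also have "\<dots> = 28 * K * (Q powr (1 / (4 * beta)) * Q powr (eta / 2) * Q powr (- 1 / 2))"
      using Q by (simp add: powr_minus_divide powr_half_sqrt)
    also have "Q powr (1 / (4 * beta)) * Q powr (eta / 2) * Q powr (- 1 / 2) = Q powr (1 / (4 * beta) + eta / 2 + - 1 / 2)"
      by (simp only: powr_add)
    also have "1 / (4 * beta) + eta / 2 + - 1 / 2 = - 1 / real m - eta / 2"
      by (simp add: eta_def field_simps)
    finally show ?thesis .
  qed
  have e1: "d * loglen q \<le> 28 * K\<^sup>2 * Q powr (- 1 / real m)"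
  proof -
    have "loglen q \<le> Lam" using lnQ by (simp add: loglen_def Lam_def Q_def)
    then have "d * loglen q \<le> (28 * K * Q powr (- 1 / real m - eta / 2)) * (K * Q powr (eta / 2))"
      using dle d0 Lam_eta loglen_ge_1[of q] q1 K1 by (intro mult_mono) auto
    also have "\<dots> = 28 * K\<^sup>2 * (Q powr (- 1 / real m - eta / 2) * Q powr (eta / 2))"
      by (simp add: power2_eq_square)
    also have "Q powr (- 1 / real m - eta / 2) * Q powr (eta / 2) = Q powr (- 1 / real m)"
      by (simp add: powr_add[symmetric])
    finally show ?thesis .
  qed
  have e2: "Q * d ^ m \<le> (28 * K) ^ m * Q powr (- real m * eta / 2)"
  proof -
    have "Q * d ^ m \<le> Q * (28 * K * Q powr (- 1 / real m - eta / 2)) ^ m"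
      using dle d0 Q by (intro mult_left_mono power_mono) auto
    also have "\<dots> = (28 * K) ^ m * (Q powr 1 * (Q powr (- 1 / real m - eta / 2)) ^ m)"
      using Q by (simp add: power_mult_distrib)
    also have "(Q powr (- 1 / real m - eta / 2)) ^ m = Q powr (real m * (- 1 / real m - eta / 2))"
      using Q by (subst powr_power) (auto simp: mult.commute)
    also have "Q powr 1 * \<dots> = Q powr (1 + real m * (- 1 / real m - eta / 2))" by (simp only: powr_add)
    also have "1 + real m * (- 1 / real m - eta / 2) = - real m * eta / 2"
      using m by (simp add: field_simps)
    finally show ?thesis .
  qed
  \<comment> \<open>By \<open>small\<close>, half of the lower bound 1/10 survives the
    errors.\<close>
  have main: "1 / 20 \<le> cmod (\<Sum>b\<in>{1..<q}. chi b * (\<Prod>i<m. good_class_sum (psi i) (ell i) q b))"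
  proof -
    have "1 / 10 - 1 / sqrt (real q) - real m * 2 ^ (m - 1) * (d * loglen q + real q * d ^ m)
        \<le> cmod (\<Sum>b\<in>{1..<q}. chi b * (\<Prod>i<m. good_class_sum (psi i) (ell i) q b))"
    proof (rule main_term_lower[OF q m prim chi])
      fix i assume i: "i < m"
      have "loglen (ell i) \<le> loglen (L * q)"
      proof -
        have "ell i * 1 \<le> L * q" using L[OF i] q1 by (intro mult_le_mono) auto
        then have "real (ell i) \<le> real (L * q)" by (simp only: of_nat_le_iff mult_1_right)
        then show ?thesis using l0[OF i] unfolding loglen_def by simp
      qed
      then have "sqrt (sqrt (real (ell i))) * loglen (ell i) \<le> sqrt (sqrt R) * Lam"
        using L[OF i] Lam_lq loglen_ge_1[OF l0[OF i]] by (intro mult_mono) (auto simp: R_def)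
      then show "28 * (sqrt (sqrt (real (ell i))) * loglen (ell i) / sqrt (real q)) \<le> d"
        unfolding d_def Q_def by (intro mult_left_mono divide_right_mono) auto
    qed
    moreover have "real m * 2 ^ (m - 1) * (d * loglen q + Q * d ^ m) \<le> real m * 2 ^ (m - 1) *
      (28 * K\<^sup>2 * Q powr (- 1 / real m) + (28 * K) ^ m * Q powr (- real m * eta / 2))"
      by (intro mult_left_mono add_mono e1 e2) auto
    ultimately show ?thesis using small unfolding Q_def by linarith
  qed
  define B where "B = 66 * Lam\<^sup>2 * sqrt (R * Q) * (66 * Lam\<^sup>2 * Q * Y) ^ (m - 1)"
  have count: "(1 / 20)\<^sup>2 * real (q - 1) ^ (2 * (m - 1)) \<le> N * B"
    unfolding N_def B_def Y_def R_def Q_def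
    by (rule card_nonvanishing_lower[OF q m prim chi L Lam_lq _ main]) auto
  \<comment> \<open>\<open>q - 1 \<ge> q / 2\<close> in the power \<open>2 * (m - 1)\<close>
    produces the factor \<open>4 ^ (m - 1)\<close>.\<close>
  have low: "(1 / 20)\<^sup>2 * (Q ^ (2 * (m - 1)) / 4 ^ (m - 1)) \<le> N * B"
  proof -
    have "(Q / 2) ^ (2 * (m - 1)) \<le> real (q - 1) ^ (2 * (m - 1))"
      using q1 by (intro power_mono) (auto simp: Q_def)
    moreover have "(Q / 2) ^ (2 * (m - 1)) = Q ^ (2 * (m - 1)) / 4 ^ (m - 1)"
      by (simp add: power_divide power_mult)
    ultimately show ?thesis using count by (intro order_trans[OF _ count] mult_left_mono) auto
  qed
  have Ble: "B \<le> 66 ^ m * K ^ (2 * m) * (Q powr eps * Q ^ (m - 1) * (R * Q) powr (real m / 6))"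
  proof -
    obtain k where k: "m = Suc k" using m by (cases m) auto
    have sq: "Lam ^ (k * 2) = Lam ^ k * Lam ^ k" by (simp only: mult_2_right power_add)
    have "B = 66 ^ m * Lam ^ (2 * m) * Q ^ (m - 1) * (sqrt (R * Q) * Y ^ (m - 1))"
      unfolding B_def by (simp add: k power_mult_distrib mult_2 power_add mult_ac power2_eq_square sq)
    also have "\<dots> \<le> 66 ^ m * (K ^ (2 * m) * Q powr eps) * Q ^ (m - 1) * (R * Q) powr (real m / 6)"
    proof (intro mult_mono Lam_eps order_refl)
      have "R powr (real m / (2 * real m - 4)) \<le> R powr beta"
        using R eps by (intro powr_mono) (auto simp: beta_def)
      then show "sqrt (R * Q) * Y ^ (m - 1) \<le> (R * Q) powr (real m / 6)"
        unfolding Y_def using m R Q RQ by (intro moment_exponent_le) auto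
    qed (use Q R K1 Lam1 in \<open>auto simp: Y_def\<close>)
    finally show ?thesis by (simp add: mult_ac)
  qed
  define D where "D = 66 ^ m * K ^ (2 * m) * (Q powr eps * Q ^ (m - 1) * (R * Q) powr (real m / 6))"
  have Dpos: "D > 0" unfolding D_def using K1 Q R by (intro mult_pos_pos) auto
  have "(1 / 20)\<^sup>2 * (Q ^ (2 * (m - 1)) / 4 ^ (m - 1)) \<le> N * D"
    by (rule order_trans[OF low]) (use Ble in \<open>auto simp: D_def N_def intro: mult_left_mono\<close>)
  then have fin: "(1 / 20)\<^sup>2 * (Q ^ (2 * (m - 1)) / 4 ^ (m - 1)) / D \<le> N"
    by (simp only: pos_divide_le_eq[OF Dpos])
  have "(1 / 20)\<^sup>2 * (Q ^ (2 * (m - 1)) / 4 ^ (m - 1)) / D =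
      (1 / 20)\<^sup>2 / (4 ^ (m - 1) * 66 ^ m * K ^ (2 * m)) * (Q ^ (2 * (m - 1)) / (Q powr eps * Q ^ (m - 1) * (R * Q) powr (real m / 6)))"
    by (simp add: D_def)
  also have "Q ^ (2 * (m - 1)) / (Q powr eps * Q ^ (m - 1) * (R * Q) powr (real m / 6)) =
      Q powr (5 * real m / 6 - 1 - eps) * R powr (- real m / 6)"
  proof -
    have "Q ^ (2 * (m - 1)) = Q ^ (m - 1) * Q ^ (m - 1)" by (simp add: mult_2 power_add)
    then have "Q ^ (2 * (m - 1)) / (Q powr eps * Q ^ (m - 1) * (R * Q) powr (real m / 6)) =
        Q ^ (m - 1) / (Q powr eps * (R * Q) powr (real m / 6))" using Q by simp
    also have "\<dots> = Q powr (real m - 1) / (Q powr eps * (R powr (real m / 6) * Q powr (real m / 6)))"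
      using R Q m by (simp add: powr_mult powr_realpow[symmetric] of_nat_diff)
    also have "\<dots> = (Q powr (real m - 1) / Q powr eps / Q powr (real m / 6)) / R powr (real m / 6)" by simp
    also have "\<dots> = Q powr (real m - 1 - eps - real m / 6) / R powr (real m / 6)"
      by (simp only: powr_diff)
    also have "real m - 1 - eps - real m / 6 = 5 * real m / 6 - 1 - eps" by simp
    finally show ?thesis using R by (simp add: powr_minus_divide)
  qed
  finally show ?thesis using fin unfolding N_def Q_def R_def by (simp only: mult.assoc)
qed

theorem theorem1p2:
  fixes m :: nat
  assumes "m \<ge> 3"
  shows "\<forall>eps::real. eps > 0 \<longrightarrow>
    (\<exists>C c :: real. C > 0 \<and> c > 0 \<and>
      (\<forall>(ell :: nat \<Rightarrow> nat) (psi :: nat \<Rightarrow> nat \<Rightarrow> complex) (q :: nat) (chi :: nat \<Rightarrow> complex).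
         (\<forall>i<m. primitive_char (ell i) (psi i)) \<longrightarrow>
         prime q \<longrightarrow>
         real q \<ge> C * real (Max (ell ` {..<m})) powr (real m / (2 * real m - 4) + eps) \<longrightarrow>
         dirichlet_char q chi \<longrightarrow>
         real (card {t \<in> Wide_star q m chi.
                 (\<Prod>i<m. dirichlet_L (\<lambda>n. psi i n * t i n) (1/2)) \<noteq> 0})
           \<ge> c * real q powr (5 * real m / 6 - 1 - eps)
               * real (Max (ell ` {..<m})) powr (- real m / 6)))"
proof (intro allI impI)
  fix eps :: real assume eps: "eps > 0"
  define beta where "beta = real m / (2 * real m - 4) + eps"
  define eta where "eta = 1 / 2 - 1 / real m - 1 / (4 * beta)"
  define tau where "tau = min (eta / 2) (eps / (2 * real m))"
  define K where "K = 1 + 3 / tau"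
  have m0: "m > 0" using assms by simp
  have m4: "2 * real m - 4 > 0" using assms by simp
  have apos: "real m / (2 * real m - 4) > 0" using assms m4 by simp
  have "beta > real m / (2 * real m - 4)" using eps by (simp add: beta_def)
  moreover have "beta > 0 \<and> 1 / (4 * beta) < 1 / (4 * a)" if "a < beta" "a > 0" for a
    using that by (auto intro!: divide_strict_left_mono mult_pos_pos)
  ultimately have beta: "beta > 0" "1 / (4 * beta) < 1 / (4 * (real m / (2 * real m - 4)))"
    using apos by blast+
  \<comment> \<open>At the bare threshold exponent \<open>eta\<close> would be 0; the
    \<open>eps\<close> inside \<open>beta\<close> makes it positive.\<close>
  have "1 / (4 * (real m / (2 * real m - 4))) = 1 / 2 - 1 / real m"
    using assms m4 by (simp add: field_simps)
  then have eta: "eta > 0" using beta(2) by (simp add: eta_def)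
  have tau: "tau > 0" using eta eps assms by (simp add: tau_def)
  obtain q0 where q0: "q0 \<ge> 2" "\<And>x. x \<ge> q0 \<Longrightarrow> 1 / sqrt x + real m * 2 ^ (m - 1) *
     (28 * K\<^sup>2 * x powr (- 1 / real m) + (28 * K) ^ m * x powr (- real m * eta / 2)) \<le> 1 / 20"
    using error_terms_small[OF eta m0, of K] by blast
  define c where "c = (1 / 20)\<^sup>2 / (4 ^ (m - 1) * 66 ^ m * K ^ (2 * m))"
  have K: "K > 0" using tau by (simp add: K_def add_pos_pos)
  have c: "c > 0" unfolding c_def using K by simp
  show "\<exists>C c :: real. C > 0 \<and> c > 0 \<and>
      (\<forall>(ell :: nat \<Rightarrow> nat) (psi :: nat \<Rightarrow> nat \<Rightarrow> complex) (q :: nat) (chi :: nat \<Rightarrow> complex).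
         (\<forall>i<m. primitive_char (ell i) (psi i)) \<longrightarrow>
         prime q \<longrightarrow>
         real q \<ge> C * real (Max (ell ` {..<m})) powr (real m / (2 * real m - 4) + eps) \<longrightarrow>
         dirichlet_char q chi \<longrightarrow>
         real (card {t \<in> Wide_star q m chi.
                 (\<Prod>i<m. dirichlet_L (\<lambda>n. psi i n * t i n) (1/2)) \<noteq> 0})
           \<ge> c * real q powr (5 * real m / 6 - 1 - eps)
               * real (Max (ell ` {..<m})) powr (- real m / 6))"
  \<comment> \<open>\<open>C = q0\<close> does two jobs: since \<open>q0 \<ge> 1\<close> and
    \<open>L powr beta \<ge> 1\<close>, the single hypothesis yields both \<open>q \<ge> q0\<close>
    and \<open>q \<ge> L powr beta\<close>.\<close>
  proof (rule exI[of _ q0], rule exI[of _ c], intro conjI allI impI c)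
    show "q0 > 0" using q0 by simp
    fix ell psi q chi
    assume prim: "\<forall>i<m. primitive_char (ell i) (psi i)" and q: "prime q"
      and qge: "q0 * real (Max (ell ` {..<m})) powr (real m / (2 * real m - 4) + eps) \<le> real q"
      and chi: "dirichlet_char q chi"
    define L where "L = Max (ell ` {..<m})"
    have L: "ell i \<le> L" if "i < m" for i unfolding L_def using that by (intro Max_ge) auto
    have "ell 0 > 0" using prim m0 by (simp add: primitive_char_def dirichlet_char_def)
    then have "real L \<ge> 1" using L[OF m0] by simp
    then have Lp: "real L powr beta \<ge> 1" using beta by (intro ge_one_powr_ge_zero) auto
    have qb: "q0 * real L powr beta \<le> real q" using qge by (simp only: L_def beta_def)
    have "q0 * 1 \<le> q0 * real L powr beta" using Lp q0(1) by (intro mult_left_mono) auto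
    then have "q0 \<le> real q" using qb by simp
    note small = q0(2)[OF this]
    have "1 * real L powr beta \<le> q0 * real L powr beta" using q0(1) by (intro mult_right_mono) auto
    then have Lq: "real L powr beta \<le> real q" using qb by simp
    show "c * real q powr (5 * real m / 6 - 1 - eps) * real (Max (ell ` {..<m})) powr (- real m / 6)
       \<le> real (card {t \<in> Wide_star q m chi. (\<Prod>i<m. dirichlet_L (\<lambda>n. psi i n * t i n) (1/2)) \<noteq> 0})"
      using nonvanishing_count[OF assms eps, of ell psi q chi L, folded beta_def, folded eta_def,
        folded tau_def, folded K_def, OF eta tau _ q chi Lq L small] prim
      by (simp add: c_def L_def)
  qed
qed

end
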